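(* In the setting described in the context, suppose $\nu$ is the exponential distribution with intensity $r>0$. Then $\underline{b}^\nu$ is finely lower semi-continuous and $\bar{b}^\nu$ is finely upper semi-continuous with respect to the right process $Y$.
   Context: Let $(E,\mathcal{B}(E))$ be a Radon space and $(X,Y)=(\Omega,\mathcal{F},\mathcal{F}_t,(X_t,Y_t),\theta_t,\mathbf{P}_{(x,y)})$ an $\mathbb{R}\times E$-valued right process without killing, $X$ càdlàg, with $\mathbf{E}_{(x,y)}[f(X_t,Y_t)]=\mathbf{E}_{(0,y)}[f(X_t+x,Y_t)]$ for all non-negative measurable $f$, $t\ge0$, $(x,y)$; $Y$ alone is a right process with laws $\mathbf{P}^Y_y$. Assume $\sup_y\mathbf{E}_{(0,y)}[\sup_{s\in[0,1]}|X_s|]<\infty$. Fix $q>0$, measurable $\mathbf{q}:E\to(q,\infty)$, $\beta>1$, $\mathfrak{q}(t)=\int_0^t\mathbf{q}(Y_s)ds$, $e^{-\mathfrak{q}(\infty)}:=0$. Let $(r_k)$ be i.i.d. $\sim\nu$ independent of $(X,Y)$, $T^\nu_n=r_1+\dots+r_n$. Let $\tau^-_0=\inf\{t>0:X_t<0\}$, $\tau^-_{0+}=\inf\{t\ge0:X_t\le0\}$, $T^{\nu,+}_b=\min\{T^\nu_k>0:X_{T^\nu_k}>b(Y_{T^\nu_k})\}$, $T^{\nu,+}_{b-}$ the same with $\ge$ ($\min\emptyset=\infty$). For non-negative measurable $b$: $\rho^{\nu,1}_b(y)=\mathbf{E}_{(b(y),y)}[e^{-\mathfrak{q}(T^{\nu,+}_{b-})};T^{\nu,+}_{b-}\le\tau^-_0]+\beta\mathbf{E}_{(b(y),y)}[e^{-\mathfrak{q}(\tau^-_0)};\tau^-_0<T^{\nu,+}_{b-}]$,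 $\rho^{\nu,2}_b(y)=\mathbf{E}_{(b(y),y)}[e^{-\mathfrak{q}(T^{\nu,+}_{b})};T^{\nu,+}_{b}<\tau^-_{0+}]+\beta\mathbf{E}_{(b(y),y)}[e^{-\mathfrak{q}(\tau^-_{0+})};\tau^-_{0+}<T^{\nu,+}_{b}]$; $\Xi^\nu$ = non-negative measurable $b$ with $\rho^{\nu,1}_b(y)\le1\le\rho^{\nu,2}_b(y)$ for all $y$. $\underline{b}^\nu,\bar{b}^\nu$ denote the unique finite-valued measurable functions in $\Xi^\nu$ such that a non-negative measurable $b$ lies in $\Xi^\nu$ iff $\underline{b}^\nu\le b\le\bar{b}^\nu$ on $E$. Fine topology: for $A\in\mathcal{B}(E)$ let $T_A=\inf\{t>0:Y_t\in A\}$. A set $B$ is finely open (w.r.t. $Y$) if $\mathbf{P}^Y_y(T_{E\setminus B}>0)=1$ for every $y\in B$. A function $g$ on $E$ is finely lower (resp. upper) semi-continuous if $\{y:g(y)>a\}$ (resp. $\{y:g(y)<a\}$) is finely open for every $a\in\mathbb{R}$. *)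

theory Defs
  imports "HOL-Probability.Probability"
begin

definition umeas_sets :: "'a::topological_space set set" where
  "umeas_sets = {A. \<forall>M::'a measure. finite_measure M \<and> sets M = sets borel
                       \<longrightarrow> A \<in> sets (completion M)}"

definition umeas_fun :: "('a::topological_space \<Rightarrow> 'b::topological_space) \<Rightarrow> bool" where
  "umeas_fun f \<longleftrightarrow> (\<forall>B \<in> sets (borel :: 'b measure). f -` B \<in> umeas_sets)"

definition radon_embedding :: "('e::topological_space \<Rightarrow> 'k::metric_space) \<Rightarrow> bool" where
  "radon_embedding h \<longleftrightarrow> compact (UNIV :: 'k set) \<and>
     (\<exists>A g. A \<in> umeas_sets \<and> homeomorphism (UNIV :: 'e set) A h g)"

definition universally_complete :: "'w set set \<Rightarrow> bool" where
  "universally_complete F \<longleftrightarrow>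
     (\<forall>A. (\<forall>M::'w measure. finite_measure M \<and> space M = UNIV \<and> sets M = F
              \<longrightarrow> A \<in> sets (completion M)) \<longrightarrow> A \<in> F)"

definition excessive ::
  "('s::topological_space \<Rightarrow> 'w measure) \<Rightarrow> (real \<Rightarrow> 'w \<Rightarrow> 's) \<Rightarrow> real \<Rightarrow> ('s \<Rightarrow> ennreal) \<Rightarrow> bool"
  where
  "excessive P Z \<alpha> f \<longleftrightarrow> umeas_fun f \<and>
     (\<forall>t\<ge>0. \<forall>z. ennreal (exp (- \<alpha> * t)) * (\<integral>\<^sup>+ \<omega>. f (Z t \<omega>) \<partial>P z) \<le> f z) \<and>
     (\<forall>z. ((\<lambda>t. ennreal (exp (- \<alpha> * t)) * (\<integral>\<^sup>+ \<omega>. f (Z t \<omega>) \<partial>P z)) \<longlongrightarrow> f z) (at_right 0))"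

text \<open>Right process (Sharpe's hypotheses HD1, HD2) without killing:
  sample space the universe of type 'w with universally complete sigma-algebra F,
  filtration Ft, right-continuous paths Z, shift operators theta, laws P z.\<close>
definition right_process ::
  "'w set set \<Rightarrow> (real \<Rightarrow> 'w set set) \<Rightarrow> (real \<Rightarrow> 'w \<Rightarrow> 's::topological_space)
     \<Rightarrow> (real \<Rightarrow> 'w \<Rightarrow> 'w) \<Rightarrow> ('s \<Rightarrow> 'w measure) \<Rightarrow> bool" where
  "right_process F Ft Z \<theta> P \<longleftrightarrow>
     universally_complete F \<and>
     (\<forall>z. prob_space (P z) \<and> space (P z) = UNIV \<and> sets (P z) = F) \<and>
     (\<forall>t\<ge>0. sigma_algebra UNIV (Ft t) \<and> Ft t \<subseteq> F) \<and>
     (\<forall>s t. 0 \<le> s \<longrightarrow> s \<le> t \<longrightarrow> Ft s \<subseteq> Ft t) \<and>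
     (\<forall>t\<ge>0. \<forall>B \<in> sets (borel :: 's measure). Z t -` B \<in> Ft t) \<and>
     (\<forall>\<omega>. \<forall>t\<ge>0. ((\<lambda>s. Z s \<omega>) \<longlongrightarrow> Z t \<omega>) (at_right t)) \<and>
     (\<forall>s\<ge>0. \<forall>t\<ge>0. \<forall>\<omega>. Z s (\<theta> t \<omega>) = Z (t + s) \<omega>) \<and>
     (\<forall>z. AE \<omega> in P z. Z 0 \<omega> = z) \<and>
     (\<forall>A \<in> F. umeas_fun (\<lambda>z. measure (P z) A)) \<and>
     (\<forall>z s t A f. 0 \<le> s \<longrightarrow> 0 \<le> t \<longrightarrow> A \<in> Ft t \<longrightarrow> umeas_fun (f :: 's \<Rightarrow> ennreal) \<longrightarrow>
        (\<integral>\<^sup>+ \<omega>. indicator A \<omega> * f (Z (t + s) \<omega>) \<partial>P z)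
          = (\<integral>\<^sup>+ \<omega>. indicator A \<omega> * (\<integral>\<^sup>+ \<omega>'. f (Z s \<omega>') \<partial>P (Z t \<omega>)) \<partial>P z)) \<and>
     (\<forall>\<alpha>>0. \<forall>f. excessive P Z \<alpha> f \<longrightarrow>
        (\<forall>z. AE \<omega> in P z. \<forall>t\<ge>0. ((\<lambda>s. f (Z s \<omega>)) \<longlongrightarrow> f (Z t \<omega>)) (at_right t)))"

definition hit_time :: "(real \<Rightarrow> 'w \<Rightarrow> 'e) \<Rightarrow> 'e set \<Rightarrow> 'w \<Rightarrow> ennreal" where
  "hit_time Y A \<omega> = Inf (ennreal ` {t. t > 0 \<and> Y t \<omega> \<in> A})"

definition finely_open :: "(real \<Rightarrow> 'w \<Rightarrow> 'e) \<Rightarrow> ('e \<Rightarrow> 'w measure) \<Rightarrow> 'e set \<Rightarrow> bool" where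
  "finely_open Y PY B \<longleftrightarrow> (\<forall>y\<in>B. AE \<omega> in PY y. hit_time Y (UNIV - B) \<omega> > 0)"

definition finely_lsc :: "(real \<Rightarrow> 'w \<Rightarrow> 'e) \<Rightarrow> ('e \<Rightarrow> 'w measure) \<Rightarrow> ('e \<Rightarrow> real) \<Rightarrow> bool" where
  "finely_lsc Y PY g \<longleftrightarrow> (\<forall>a. finely_open Y PY {y. g y > a})"

definition finely_usc :: "(real \<Rightarrow> 'w \<Rightarrow> 'e) \<Rightarrow> ('e \<Rightarrow> 'w measure) \<Rightarrow> ('e \<Rightarrow> real) \<Rightarrow> bool" where
  "finely_usc Y PY g \<longleftrightarrow> (\<forall>a. finely_open Y PY {y. g y < a})"

definition tau_minus :: "(real \<Rightarrow> 'w \<Rightarrow> real) \<Rightarrow> 'w \<Rightarrow> ennreal" where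
  "tau_minus X \<omega> = Inf (ennreal ` {t. t > 0 \<and> X t \<omega> < 0})"

definition tau_minus_plus :: "(real \<Rightarrow> 'w \<Rightarrow> real) \<Rightarrow> 'w \<Rightarrow> ennreal" where
  "tau_minus_plus X \<omega> = Inf (ennreal ` {t. t \<ge> 0 \<and> X t \<omega> \<le> 0})"

text \<open>T^nu_n = r_1 + ... + r_n, where r_k is the (k-1)-th entry of the stream rs.\<close>
definition arr_time :: "real stream \<Rightarrow> nat \<Rightarrow> real" where
  "arr_time rs n = (\<Sum>i<n. rs !! i)"

definition T_plus ::
  "(real \<Rightarrow> 'w \<Rightarrow> real) \<Rightarrow> (real \<Rightarrow> 'w \<Rightarrow> 'e) \<Rightarrow> ('e \<Rightarrow> real) \<Rightarrow> 'w \<Rightarrow> real stream \<Rightarrow> ennreal" where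
  "T_plus X Y b \<omega> rs = Inf (ennreal ` {arr_time rs k | k. k \<ge> 1 \<and> arr_time rs k > 0 \<and>
        X (arr_time rs k) \<omega> > b (Y (arr_time rs k) \<omega>)})"

definition T_plus_minus ::
  "(real \<Rightarrow> 'w \<Rightarrow> real) \<Rightarrow> (real \<Rightarrow> 'w \<Rightarrow> 'e) \<Rightarrow> ('e \<Rightarrow> real) \<Rightarrow> 'w \<Rightarrow> real stream \<Rightarrow> ennreal" where
  "T_plus_minus X Y b \<omega> rs = Inf (ennreal ` {arr_time rs k | k. k \<ge> 1 \<and> arr_time rs k > 0 \<and>
        X (arr_time rs k) \<omega> \<ge> b (Y (arr_time rs k) \<omega>)})"

text \<open>frak q(T) = int_0^T q(Y_s) ds (for T = \<infinity> this is \<infinity>, since q > 0 is bounded below).\<close>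
definition qint :: "('e \<Rightarrow> real) \<Rightarrow> (real \<Rightarrow> 'w \<Rightarrow> 'e) \<Rightarrow> 'w \<Rightarrow> ennreal \<Rightarrow> ennreal" where
  "qint qq Y \<omega> T = (\<integral>\<^sup>+ s. indicator {s. 0 \<le> s \<and> ennreal s < T} s * ennreal (qq (Y s \<omega>)) \<partial>lborel)"

definition exp_neg :: "ennreal \<Rightarrow> ennreal" where
  "exp_neg a = (if a = \<infinity> then 0 else ennreal (exp (- enn2real a)))"

text \<open>Expectation under P_(x,y) jointly with the i.i.d. sequence (r_k) ~ nu independent of (X,Y).\<close>
definition rho1 ::
  "((real \<times> 'e) \<Rightarrow> 'w measure) \<Rightarrow> real measure \<Rightarrow> (real \<Rightarrow> 'w \<Rightarrow> real) \<Rightarrow> (real \<Rightarrow> 'w \<Rightarrow> 'e)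
     \<Rightarrow> ('e \<Rightarrow> real) \<Rightarrow> real \<Rightarrow> ('e \<Rightarrow> real) \<Rightarrow> 'e \<Rightarrow> ennreal" where
  "rho1 P \<nu> X Y qq \<beta> b y =
     (\<integral>\<^sup>+ (\<omega>, rs). (if T_plus_minus X Y b \<omega> rs \<le> tau_minus X \<omega>
                     then exp_neg (qint qq Y \<omega> (T_plus_minus X Y b \<omega> rs)) else 0)
        \<partial>(P (b y, y) \<Otimes>\<^sub>M stream_space \<nu>))
   + ennreal \<beta> *
     (\<integral>\<^sup>+ (\<omega>, rs). (if tau_minus X \<omega> < T_plus_minus X Y b \<omega> rs
                     then exp_neg (qint qq Y \<omega> (tau_minus X \<omega>)) else 0)
        \<partial>(P (b y, y) \<Otimes>\<^sub>M stream_space \<nu>))"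

definition rho2 ::
  "((real \<times> 'e) \<Rightarrow> 'w measure) \<Rightarrow> real measure \<Rightarrow> (real \<Rightarrow> 'w \<Rightarrow> real) \<Rightarrow> (real \<Rightarrow> 'w \<Rightarrow> 'e)
     \<Rightarrow> ('e \<Rightarrow> real) \<Rightarrow> real \<Rightarrow> ('e \<Rightarrow> real) \<Rightarrow> 'e \<Rightarrow> ennreal" where
  "rho2 P \<nu> X Y qq \<beta> b y =
     (\<integral>\<^sup>+ (\<omega>, rs). (if T_plus X Y b \<omega> rs < tau_minus_plus X \<omega>
                     then exp_neg (qint qq Y \<omega> (T_plus X Y b \<omega> rs)) else 0)
        \<partial>(P (b y, y) \<Otimes>\<^sub>M stream_space \<nu>))
   + ennreal \<beta> *
     (\<integral>\<^sup>+ (\<omega>, rs). (if tau_minus_plus X \<omega> < T_plus X Y b \<omega> rs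
                     then exp_neg (qint qq Y \<omega> (tau_minus_plus X \<omega>)) else 0)
        \<partial>(P (b y, y) \<Otimes>\<^sub>M stream_space \<nu>))"

definition Xi ::
  "((real \<times> 'e::topological_space) \<Rightarrow> 'w measure) \<Rightarrow> real measure \<Rightarrow> (real \<Rightarrow> 'w \<Rightarrow> real)
     \<Rightarrow> (real \<Rightarrow> 'w \<Rightarrow> 'e) \<Rightarrow> ('e \<Rightarrow> real) \<Rightarrow> real \<Rightarrow> ('e \<Rightarrow> real) set" where
  "Xi P \<nu> X Y qq \<beta> = {b. b \<in> borel_measurable borel \<and> (\<forall>y. b y \<ge> 0) \<and>
      (\<forall>y. rho1 P \<nu> X Y qq \<beta> b y \<le> 1 \<and> 1 \<le> rho2 P \<nu> X Y qq \<beta> b y)}"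

definition exp_dist :: "real \<Rightarrow> real measure" where
  "exp_dist r = density lborel (\<lambda>x. ennreal (exponential_density r x))"

end

theory Submission
  imports Defs
begin

text \<open>
Let \<open>V k R (x, y)\<close> be the mean payoff from \<open>(x, y)\<close> when the process is stopped at the first arrival
that finds it in the region \<open>R\<close>; the quantities \<open>rho1\<close> and \<open>rho2\<close> of a barrier \<open>b\<close> are its
values at \<open>(b y, y)\<close>. Conditioning on the first arrival gives a fixed point equation that contracts with factor
\<open>r / (r + q)\<close>. Coupling two starting levels by translation and iterating shows, for a barrier
\<open>b\<close> in \<open>Xi\<close>, that the value is non-increasing in the level, at least 1 below \<open>b\<close> and at most
1 above it. Moving \<open>b\<close> at a single state across levels where the value equals 1 changes no value, so
extremality of \<open>b_low\<close> and \<open>b_up\<close> forces the value to be strictly above 1 below \<open>b_low\<close> and strictly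
below 1 above \<open>b_up\<close>. Since arrivals are memoryless, the value is a limit of differences of excessive functions and
hence right-continuous along the paths of \<open>(X, Y)\<close>; with monotonicity in the level this turns the strict
inequalities into fine semicontinuity of the two barriers.
\<close>

section \<open>Universal completion\<close>


text \<open>The fine topology concerns \<open>Y\<close> alone, with laws \<open>P (0, y)\<close>,
  whereas the value lives on pairs. A starting level \<open>c\<close> is therefore carried as a
  translation of the first coordinate, and translation invariance, assumed for single times only,
  has to be lifted to whole paths. The time \<open>tau_minus_plus\<close> is the entrance time of a
  closed set; its level sets are projections and in general only universally measurable, as are the
  kernels of a right process. Hence the Markov property is developed for universally measurable path
  functionals. Right limits are proved only for the variant with \<open>tau_minus\<close>, which is
  measurable on path space; comparison at distinct levels links it to the other variant. The value
  itself need not be excessive, and right-continuity is given along excessive functions only. An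
  auxiliary exponential clock of rate \<alpha> bridges this: the value now differs from the
  discounted value at the clock time by at most \<beta> times the chance of an earlier arrival,
  \<open>r / (\<alpha> + r)\<close>, or of an earlier ruin. Writing the discount factor as 1 minus
  its complement leaves two weights that grow with time, and such weights give excessive
  potentials.\<close>

definition ucomp :: "'a measure \<Rightarrow> 'a measure" where
  "ucomp M = sigma (space M)
     {A. A \<subseteq> space M \<and> (\<forall>N. finite_measure N \<longrightarrow> sets N = sets M \<longrightarrow> A \<in> sets (completion N))}"

lemma space_ucomp [simp]: "space (ucomp M) = space M"
  unfolding ucomp_def by (rule space_measure_of) auto

text \<open>Each completion is closed under complements and countable unions, so the sets common to
  all of them form a sigma-algebra already and generating one adds nothing.\<close>

lemma sets_ucomp:
  "sets (ucomp M) =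
     {A. A \<subseteq> space M \<and> (\<forall>N. finite_measure N \<longrightarrow> sets N = sets M \<longrightarrow> A \<in> sets (completion N))}"
proof -
  let ?U = "{A. A \<subseteq> space M \<and> (\<forall>N. finite_measure N \<longrightarrow> sets N = sets M \<longrightarrow> A \<in> sets (completion N))}"
  have "sigma_algebra (space M) ?U"
  proof (rule sigma_algebra_iff2[THEN iffD2], intro conjI ballI allI impI)
    fix A assume A: "A \<in> ?U"
    have "space M - A \<in> sets (completion N)" if "finite_measure N" "sets N = sets M" for N
    proof -
      have "A \<in> sets (completion N)" using A that by auto
      then have "space (completion N) - A \<in> sets (completion N)" by (rule sets.compl_sets)
      then show ?thesis using sets_eq_imp_space_eq[OF that(2)] by simp
    qed
    then show "space M - A \<in> ?U" by auto
  qed auto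
  then show ?thesis
    unfolding ucomp_def by (simp add: sigma_algebra.sets_measure_of_eq)
qed

lemma sets_ucompD:
  "A \<in> sets (ucomp M) \<Longrightarrow> finite_measure N \<Longrightarrow> sets N = sets M \<Longrightarrow> A \<in> sets (completion N)"
  by (simp add: sets_ucomp)

lemma sets_ucompI: "A \<in> sets M \<Longrightarrow> A \<in> sets (ucomp M)"
  by (auto simp: sets_ucomp dest: sets.sets_into_space)

lemma measurable_ucomp_completion:
  assumes "f \<in> ucomp M \<rightarrow>\<^sub>M K" "finite_measure N" "sets N = sets M"
  shows "f \<in> completion N \<rightarrow>\<^sub>M K"
  using assms by (auto simp: measurable_def sets_eq_imp_space_eq[OF assms(3)] intro!: sets_ucompD)

lemma measurable_ucompI: "f \<in> M \<rightarrow>\<^sub>M K \<Longrightarrow> f \<in> ucomp M \<rightarrow>\<^sub>M K"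
  by (auto simp: measurable_def intro!: sets_ucompI)

lemma ucomp_AE_eq:
  fixes f :: "'a \<Rightarrow> ennreal"
  assumes "f \<in> borel_measurable (ucomp M)" "finite_measure N" "sets N = sets M"
  obtains g where "g \<in> borel_measurable M" "AE x in N. f x = g x"
proof -
  obtain g where "g \<in> borel_measurable N" "AE x in N. f x = g x"
    using completion_ex_borel_measurable[OF measurable_ucomp_completion[OF assms]] by auto
  then show ?thesis using that measurable_cong_sets[OF assms(3) refl] by metis
qed

text \<open>A finite measure on \<open>M\<close> has an image on \<open>K\<close>, and a universally
  measurable set differs from a measurable one inside a null set of that image. Preimages of null
  sets of the image are null, which carries the sandwich back to \<open>M\<close>.\<close>

lemma measurable_ucomp_ucomp:
  assumes f: "f \<in> M \<rightarrow>\<^sub>M K"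
  shows "f \<in> ucomp M \<rightarrow>\<^sub>M ucomp K"
proof (rule measurableI)
  show "f x \<in> space (ucomp K)" if "x \<in> space (ucomp M)" for x
    using that measurable_space[OF f] by simp
  fix A assume A: "A \<in> sets (ucomp K)"
  have "f -` A \<inter> space M \<in> sets (completion N)" if N: "finite_measure N" "sets N = sets M" for N
  proof -
    have f': "f \<in> N \<rightarrow>\<^sub>M K" using f measurable_cong_sets[OF N(2) refl] by auto
    have sp: "space N = space M" using N(2) by (rule sets_eq_imp_space_eq)
    have "finite_measure (distr N K f)"
      by (rule finite_measure.finite_measure_distr[OF N(1) f'])
    then have "A \<in> sets (completion (distr N K f))" using A by (auto intro: sets_ucompD)
    then obtain S Z Z' where S: "A = S \<union> Z" "Z \<subseteq> Z'" "Z' \<in> null_sets (distr N K f)" "S \<in> sets (distr N K f)"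
      by (rule sets_completionE)
    show ?thesis
    proof (rule sets_completionI)
      show "f -` A \<inter> space M = (f -` S \<inter> space N) \<union> (f -` Z \<inter> space N)" using S sp by auto
      show "f -` Z \<inter> space N \<subseteq> f -` Z' \<inter> space N" using S by auto
      show "f -` Z' \<inter> space N \<in> null_sets N" using S(3) null_sets_distr_iff[OF f'] by auto
      show "f -` S \<inter> space N \<in> sets N" using S(4) f' by (auto intro: measurable_sets)
    qed
  qed
  then show "f -` A \<inter> space (ucomp M) \<in> sets (ucomp M)" by (auto simp: sets_ucomp)
qed

lemma sets_ucomp_borel: "sets (ucomp borel) = umeas_sets"
  by (auto simp: sets_ucomp umeas_sets_def)

lemma umeas_fun_iff: "umeas_fun f \<longleftrightarrow> f \<in> ucomp borel \<rightarrow>\<^sub>M borel"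
  by (auto simp: umeas_fun_def measurable_def sets_ucomp_borel)

text \<open>This is what makes universally measurable functionals of the path measurable for the
  laws \<open>P z\<close> themselves.\<close>

lemma sets_ucomp_universally_complete:
  assumes "universally_complete F" "sets M = F" "space M = UNIV"
  shows "sets (ucomp M) = F"
proof
  show "sets (ucomp M) \<subseteq> F"
    using assms by (auto simp: sets_ucomp universally_complete_def)
  show "F \<subseteq> sets (ucomp M)" using sets_ucompI[of _ M] assms by auto
qed

text \<open>Under the image law \<open>f\<close> agrees almost everywhere with a measurable version,
  and the exceptional set pulls back to a null set, so the usual change of variables applies to the
  version.\<close>

lemma nn_integral_ucomp_eq:
  fixes f :: "'a \<Rightarrow> ennreal"
  assumes "f \<in> borel_measurable (ucomp K)" "g \<in> M \<rightarrow>\<^sub>M K" "finite_measure M"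
  shows "(\<integral>\<^sup>+x. f (g x) \<partial>M) = (\<integral>\<^sup>+y. f y \<partial>distr M K g)"
proof -
  have fin: "finite_measure (distr M K g)"
    by (rule finite_measure.finite_measure_distr[OF assms(3,2)])
  obtain h where h: "h \<in> borel_measurable K" "AE x in distr M K g. f x = h x"
    using ucomp_AE_eq[OF assms(1) fin] by auto
  have "AE x in M. f (g x) = h (g x)"
  proof -
    obtain Z where Z: "Z \<in> null_sets (distr M K g)" "{x\<in>space (distr M K g). f x \<noteq> h x} \<subseteq> Z"
      using h(2) by (auto elim!: AE_E simp: null_sets_def)
    have "g -` Z \<inter> space M \<in> null_sets M" using Z(1) null_sets_distr_iff[OF assms(2)] by auto
    then show ?thesis
      by (rule AE_I') (use Z(2) measurable_space[OF assms(2)] in auto)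
  qed
  then have "(\<integral>\<^sup>+x. f (g x) \<partial>M) = (\<integral>\<^sup>+x. h (g x) \<partial>M)" by (rule nn_integral_cong_AE)
  also have "\<dots> = (\<integral>\<^sup>+x. h x \<partial>distr M K g)" using h assms by (simp add: nn_integral_distr)
  also have "\<dots> = (\<integral>\<^sup>+x. f x \<partial>distr M K g)" by (rule nn_integral_cong_AE) (use h(2) in auto)
  finally show ?thesis .
qed

text \<open>The outer measure of \<open>A\<close> is attained by a measurable hull \<open>E\<close>.
  A countable union of inner sets of nearly that measure fills \<open>E\<close> up to a null set,
  which squeezes \<open>A\<close> between measurable sets. This is the form in which a
  capacitability argument yields measurability.\<close>

lemma in_sets_completion_inner_approx:
  assumes "finite_measure N" "A \<subseteq> space N"
    and approx: "\<And>\<theta>. \<theta> < outer_measure_of N A \<Longrightarrow> \<exists>B\<in>sets N. B \<subseteq> A \<and> \<theta> \<le> emeasure N B"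
  shows "A \<in> sets (completion N)"
proof -
  interpret finite_measure N by fact
  let ?c = "outer_measure_of N A"
  obtain E where E: "E \<in> sets N" "A \<subseteq> E" "?c = emeasure N E"
    using outer_measure_of_attain[OF assms(2)] by auto
  have fin: "?c \<noteq> \<infinity>" using E(3) by simp
  show ?thesis
  proof (cases "?c = 0")
    case True
    then have "E \<in> null_sets N" using E by (auto simp: null_sets_def)
    then show ?thesis using E(2) by (intro sets_completionI_sub)
  next
    case False
    obtain c where c: "?c = ennreal c" "c > 0"
      using fin False by (cases ?c) (auto simp: less_le)
    \<comment> \<open>These levels increase to the outer measure; a negative level is truncated to 0
      by \<open>ennreal\<close>, which is harmless.\<close>
    define \<theta> where "\<theta> n = ennreal (c - inverse (real (Suc n)))" for n
    have "\<theta> n < ?c" for n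
      unfolding \<theta>_def c(1) using c(2) by (intro ennreal_lessI) auto
    then have "\<exists>B\<in>sets N. B \<subseteq> A \<and> \<theta> n \<le> emeasure N B" for n using approx by blast
    then obtain B where B: "\<And>n. B n \<in> sets N" "\<And>n. B n \<subseteq> A" "\<And>n. \<theta> n \<le> emeasure N (B n)" by metis
    let ?B = "\<Union>n. B n"
    have Bs: "?B \<in> sets N" "?B \<subseteq> A" using B by auto
    have "?c \<le> emeasure N ?B"
    proof (rule ennreal_le_epsilon)
      fix e :: real assume e: "0 < e"
      then obtain n where n: "inverse (real (Suc n)) < e" using reals_Archimedean by blast
      have "?c \<le> \<theta> n + ennreal (inverse (real (Suc n)))"
        unfolding \<theta>_def c(1)
        by (cases "inverse (real (Suc n)) \<le> c")
           (auto simp flip: ennreal_plus simp del: of_nat_Suc simp: ennreal_neg intro!: ennreal_leI)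
      also have "\<dots> \<le> emeasure N ?B + ennreal e"
      proof (rule add_mono)
        show "\<theta> n \<le> emeasure N ?B" using B(3)[of n] emeasure_mono[OF _ Bs(1), of "B n"] by (auto intro: order_trans)
        show "ennreal (inverse (real (Suc n))) \<le> ennreal e" using n by (simp add: ennreal_leI)
      qed
      finally show "?c \<le> emeasure N ?B + ennreal e" .
    qed
    then have "emeasure N (E - ?B) = 0"
      using emeasure_Diff[of N ?B E] Bs E
      by (subst emeasure_Diff) (auto intro!: diff_eq_0_ennreal simp: less_top[symmetric])
    then have "E - ?B \<in> null_sets N" using Bs E by (auto simp: null_sets_def)
    then show ?thesis
      by (rule sets_completionI[of _ ?B "A - ?B" "E - ?B", rotated 2]) (use Bs E in auto)
  qed
qed

text \<open>Consulting only rational times strictly after \<open>s\<close> turns the condition at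
  \<open>s\<close> into a countable intersection over tolerances \<open>j\<close> of countable
  unions over window lengths \<open>m\<close>. Windows are open and bounds non-strict, so the
  conditions survive limits in \<open>s\<close>.\<close>

lemma right_cont_le_zero_iff:
  fixes x :: "real \<Rightarrow> real"
  assumes "(x \<longlongrightarrow> x s) (at_right s)"
  shows "x s \<le> 0 \<longleftrightarrow>
    (\<forall>j. \<exists>m. \<forall>u\<in>\<rat>. s < u \<and> u < s + 1 / real (Suc m) \<longrightarrow> x u \<le> 1 / real (Suc j))"
proof
  assume le: "x s \<le> 0"
  show "\<forall>j. \<exists>m. \<forall>u\<in>\<rat>. s < u \<and> u < s + 1 / real (Suc m) \<longrightarrow> x u \<le> 1 / real (Suc j)"
  proof
    fix j
    have "x s < 1 / real (Suc j)" using le by (smt (verit) of_nat_0_less_iff zero_less_Suc zero_less_divide_1_iff)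
    then have "\<forall>\<^sub>F u in at_right s. x u < 1 / real (Suc j)" using assms by (rule order_tendstoD(2)[rotated])
    then obtain b where b: "b > s" "\<And>u. s < u \<Longrightarrow> u < b \<Longrightarrow> x u < 1 / real (Suc j)"
      by (auto simp: eventually_at_right_field)
    obtain m where "inverse (real (Suc m)) < b - s" using reals_Archimedean b(1) by (metis diff_gt_0_iff_gt)
    then show "\<exists>m. \<forall>u\<in>\<rat>. s < u \<and> u < s + 1 / real (Suc m) \<longrightarrow> x u \<le> 1 / real (Suc j)"
      by (intro exI[of _ m]) (auto simp del: of_nat_Suc simp: inverse_eq_divide intro!: less_imp_le b(2))
  qed
next
  assume *: "\<forall>j. \<exists>m. \<forall>u\<in>\<rat>. s < u \<and> u < s + 1 / real (Suc m) \<longrightarrow> x u \<le> 1 / real (Suc j)"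
  show "x s \<le> 0"
  proof (rule ccontr)
    assume "\<not> x s \<le> 0"
    then obtain j where j: "inverse (real (Suc j)) < x s" using reals_Archimedean[of "x s"] by auto
    obtain m where m: "\<And>u. u \<in> \<rat> \<Longrightarrow> s < u \<Longrightarrow> u < s + 1 / real (Suc m) \<Longrightarrow> x u \<le> 1 / real (Suc j)"
      using * by blast
    have "\<forall>\<^sub>F u in at_right s. inverse (real (Suc j)) < x u"
      using order_tendstoD(1)[OF assms j] .
    then obtain b where b: "b > s" "\<And>u. s < u \<Longrightarrow> u < b \<Longrightarrow> inverse (real (Suc j)) < x u"
      by (auto simp: eventually_at_right_field)
    obtain u where "u \<in> \<rat>" "s < u" "u < min b (s + 1 / real (Suc m))"
      using Rats_dense_in_real[of s "min b (s + 1 / real (Suc m))"] b(1) by auto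
    with m[of u] b(2)[of u] show False by (auto simp: inverse_eq_divide)
  qed
qed

text \<open>The zero set of a right-continuous path is only a countable intersection of countable unions of
  compact sets, so its projection is analytic rather than measurable. The proof is Choquet's
  capacitability argument: choosing the inner unions one after another loses arbitrarily little outer
  measure, and leaves a compact-valued set whose projection is measurable.\<close>

lemma exists_le_zero_ucomp:
  fixes X :: "real \<Rightarrow> 'w \<Rightarrow> real"
  assumes meas: "\<And>t. t \<ge> 0 \<Longrightarrow> X t \<in> borel_measurable M"
    and rc: "\<And>\<omega> t. \<omega> \<in> space M \<Longrightarrow> t \<ge> 0 \<Longrightarrow> ((\<lambda>s. X s \<omega>) \<longlongrightarrow> X t \<omega>) (at_right t)"
    and c: "c \<ge> 0"
  shows "{\<omega> \<in> space M. \<exists>s. 0 \<le> s \<and> s \<le> c \<and> X s \<omega> \<le> 0} \<in> sets (ucomp M)"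
proof -
  let ?A = "{\<omega> \<in> space M. \<exists>s. 0 \<le> s \<and> s \<le> c \<and> X s \<omega> \<le> 0}"
  have "?A \<in> sets (completion N)" if fin: "finite_measure N" and sN: "sets N = sets M" for N
  proof (rule in_sets_completion_inner_approx[OF fin])
    interpret finite_measure N by fact
    have sp: "space N = space M" using sN by (rule sets_eq_imp_space_eq)
    show "?A \<subseteq> space N" using sp by auto
    fix \<theta> assume \<theta>: "\<theta> < outer_measure_of N ?A"
    define good where "good m j s \<omega> \<longleftrightarrow>
      (\<forall>u\<in>\<rat>. s < u \<and> u < s + 1 / real (Suc m) \<longrightarrow> X u \<omega> \<le> 1 / real (Suc j))" for m j :: nat and s \<omega>
    have good_mono: "good m j s \<omega> \<Longrightarrow> m \<le> m' \<Longrightarrow> good m' j s \<omega>" for m m' j s \<omega>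
    proof -
      assume g: "good m j s \<omega>" and "m \<le> m'"
      then have "1 / real (Suc m') \<le> 1 / real (Suc m)" by (simp add: frac_le)
      then show ?thesis using g unfolding good_def by force
    qed
    \<comment> \<open>The list \<open>ms\<close> records the windows already chosen for the first
      tolerances; \<open>S ms\<close> keeps the outcomes having a time that respects all these
      choices at once.\<close>
    define S where "S ms = {\<omega> \<in> space M. \<exists>s. 0 \<le> s \<and> s \<le> c \<and> X s \<omega> \<le> 0 \<and>
      (\<forall>j<length ms. good (ms ! j) j s \<omega>)}" for ms
    \<comment> \<open>A larger \<open>n\<close> means a shorter window and a weaker demand, so the
      sets \<open>S (ms @ [n])\<close> increase to \<open>S ms\<close>. Outer measure is continuous
      along increasing sequences even without measurability, so some \<open>n\<close> stays above
      \<theta>.\<close>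
    have step: "\<exists>n. \<theta> < outer_measure_of N (S (ms @ [n]))" if "\<theta> < outer_measure_of N (S ms)" for ms
    proof -
      have "S ms = (\<Union>n. S (ms @ [n]))"
      proof (intro equalityI subsetI)
        fix \<omega> assume "\<omega> \<in> S ms"
        then obtain s where s: "\<omega> \<in> space M" "0 \<le> s" "s \<le> c" "X s \<omega> \<le> 0"
            "\<And>j. j < length ms \<Longrightarrow> good (ms ! j) j s \<omega>" unfolding S_def by auto
        obtain m where "good m (length ms) s \<omega>"
          using right_cont_le_zero_iff[of "\<lambda>s. X s \<omega>" s, OF rc] s unfolding good_def by blast
        then have "\<omega> \<in> S (ms @ [m])" using s unfolding S_def
          by (auto simp: nth_append less_Suc_eq intro!: exI[of _ s])
        then show "\<omega> \<in> (\<Union>n. S (ms @ [n]))" by auto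
      next
        fix \<omega> assume "\<omega> \<in> (\<Union>n. S (ms @ [n]))"
        then obtain n s where s: "\<omega> \<in> space M" "0 \<le> s" "s \<le> c" "X s \<omega> \<le> 0"
            "\<And>j. j < Suc (length ms) \<Longrightarrow> good ((ms @ [n]) ! j) j s \<omega>" unfolding S_def by auto
        have "good (ms ! j) j s \<omega>" if "j < length ms" for j using s(5)[of j] that by (simp add: nth_append)
        then show "\<omega> \<in> S ms" using s unfolding S_def by auto
      qed
      moreover have "incseq (\<lambda>n. S (ms @ [n]))"
      proof (rule incseq_SucI, rule subsetI)
        fix n \<omega> assume "\<omega> \<in> S (ms @ [n])"
        then obtain s where s: "\<omega> \<in> space M" "0 \<le> s" "s \<le> c" "X s \<omega> \<le> 0"
            "\<And>j. j < Suc (length ms) \<Longrightarrow> good ((ms @ [n]) ! j) j s \<omega>" unfolding S_def by auto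
        have "good ((ms @ [Suc n]) ! j) j s \<omega>" if "j < Suc (length ms)" for j
          using s(5)[of j] that good_mono[of n j s \<omega> "Suc n"]
          by (cases "j = length ms") (auto simp: nth_append)
        then show "\<omega> \<in> S (ms @ [Suc n])" using s unfolding S_def by auto
      qed
      moreover have "S (ms @ [n]) \<subseteq> space N" for n unfolding S_def sp by auto
      ultimately have "(SUP n. outer_measure_of N (S (ms @ [n]))) = outer_measure_of N (S ms)"
        using SUP_outer_measure_of_incseq[of "\<lambda>n. S (ms @ [n])" N] by metis
      then show ?thesis using that less_SUP_iff[of \<theta> "\<lambda>n. outer_measure_of N (S (ms @ [n]))" UNIV] by auto
    qed
    obtain f where f: "\<And>k. f (Suc k) = f k @ [SOME n. \<theta> < outer_measure_of N (S (f k @ [n]))]" "f 0 = ([]::nat list)"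
      using that[of "rec_nat [] (\<lambda>k ms. ms @ [SOME n. \<theta> < outer_measure_of N (S (ms @ [n]))])"] by auto
    have fS: "\<theta> < outer_measure_of N (S (f k))" for k
    proof (induction k)
      case 0
      have "S [] = ?A" unfolding S_def by auto
      then show ?case using \<theta> f(2) by simp
    next
      case (Suc k)
      show ?case unfolding f(1) using someI_ex[OF step[OF Suc]] .
    qed
    have len: "length (f k) = k" for k by (induction k) (auto simp: f)
    \<comment> \<open>Successive lists extend one another, so a single sequence \<open>m\<close> of
      windows serves every stage.\<close>
    define m where "m j = f (Suc j) ! j" for j
    have fm: "f k ! j = m j" if "j < k" for j k
      using that
    proof (induction k)
      case (Suc k)
      then show ?case by (cases "j = k") (auto simp: f m_def nth_append len)
    qed simp
    \<comment> \<open>A measurable superset of \<open>S (f k)\<close>: time becomes rational, may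
      overshoot \<open>c\<close> slightly, and the window is shrunk by
      \<open>1 / real (Suc k)\<close> at both ends, so that moving from the true time to a nearby
      rational loses nothing.\<close>
    define D where "D k = {\<omega> \<in> space M. \<exists>s\<in>\<rat>. 0 \<le> s \<and> s \<le> c + 1 / real (Suc k) \<and> (\<forall>j<k. \<forall>u\<in>\<rat>.
      s + 1 / real (Suc k) < u \<and> u < s + 1 / real (Suc (m j)) - 1 / real (Suc k) \<longrightarrow> X u \<omega> \<le> 1 / real (Suc j))}" for k
    have D_meas: "D k \<in> sets M" for k
    proof -
      have "{\<omega>\<in>space M. s + 1 / real (Suc k) < u \<and> u < s + 1 / real (Suc (m j)) - 1 / real (Suc k) \<longrightarrow> X u \<omega> \<le> 1 / real (Suc j)} \<in> sets M"
        if "0 \<le> s" for s u j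
      proof -
        define Q where "Q \<longleftrightarrow> s + 1 / real (Suc k) < u \<and> u < s + 1 / real (Suc (m j)) - 1 / real (Suc k)"
        define d where "d = 1 / real (Suc j)"
        have X: "X u \<in> borel_measurable M" if Q
        proof (rule meas)
          have "0 < 1 / real (Suc k)" by simp
          then show "0 \<le> u" using \<open>0 \<le> s\<close> \<open>Q\<close> unfolding Q_def by linarith
        qed
        have "{\<omega>\<in>space M. Q \<longrightarrow> X u \<omega> \<le> d} \<in> sets M"
        proof (cases Q)
          case True
          note X[OF True, measurable]
          show ?thesis by measurable
        qed simp
        then show ?thesis unfolding Q_def d_def .
      qed
      note 1 = this
      have 2: "{\<omega>\<in>space M. \<forall>j\<in>{..<k}. \<forall>u\<in>\<rat>. s + 1 / real (Suc k) < u \<and> u < s + 1 / real (Suc (m j)) - 1 / real (Suc k)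
          \<longrightarrow> X u \<omega> \<le> 1 / real (Suc j)} \<in> sets M" if "0 \<le> s" for s
        by (intro sets.sets_Collect_countable_All' countable_rat countable_finite finite_lessThan 1[OF that])
      have 3: "{\<omega>\<in>space M. 0 \<le> s \<and> s \<le> c + 1 / real (Suc k) \<and> (\<forall>j\<in>{..<k}. \<forall>u\<in>\<rat>.
          s + 1 / real (Suc k) < u \<and> u < s + 1 / real (Suc (m j)) - 1 / real (Suc k) \<longrightarrow> X u \<omega> \<le> 1 / real (Suc j))} \<in> sets M" for s
        using 2[of s] by (cases "0 \<le> s \<and> s \<le> c + 1 / real (Suc k)") (simp_all del: of_nat_Suc)
      have "D k = {\<omega> \<in> space M. \<exists>s\<in>\<rat>. 0 \<le> s \<and> s \<le> c + 1 / real (Suc k) \<and> (\<forall>j\<in>{..<k}. \<forall>u\<in>\<rat>.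
          s + 1 / real (Suc k) < u \<and> u < s + 1 / real (Suc (m j)) - 1 / real (Suc k) \<longrightarrow> X u \<omega> \<le> 1 / real (Suc j))}"
        unfolding D_def by (simp only: Ball_def lessThan_iff)
      also have "\<dots> \<in> sets M" by (intro sets.sets_Collect_countable_Ex' countable_rat 3)
      finally show ?thesis .
    qed
    have SD: "S (f k) \<subseteq> D i" if "i \<le> k" for i k
    proof
      fix \<omega> assume "\<omega> \<in> S (f k)"
      then obtain s where s: "\<omega> \<in> space M" "0 \<le> s" "s \<le> c" "\<And>j. j < k \<Longrightarrow> good (m j) j s \<omega>"
        unfolding S_def by (auto simp: len fm)
      obtain s' where s': "s' \<in> \<rat>" "s < s'" "s' < s + 1 / real (Suc i)"
        using Rats_dense_in_real[of s "s + 1 / real (Suc i)"] by auto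
      show "\<omega> \<in> D i" unfolding D_def
      proof (intro CollectI conjI bexI[of _ s'] allI impI ballI)
        fix j u assume "j < i" and u: "u \<in> \<rat>" and
          "s' + 1 / real (Suc i) < u \<and> u < s' + 1 / real (Suc (m j)) - 1 / real (Suc i)"
        moreover have "0 < 1 / real (Suc i)" by simp
        ultimately have "j < k" "s < u" "u < s + 1 / real (Suc (m j))"
          using s'(2,3) \<open>i \<le> k\<close> by linarith+
        then show "X u \<omega> \<le> 1 / real (Suc j)" using s(4)[of j] u unfolding good_def by auto
      qed (use s s' in auto)
    qed
    define B where "B = (\<Inter>k. D k)"
    \<comment> \<open>Compactness enters here. The approximate times for different \<open>k\<close>
      accumulate at some \<open>l\<close> in [0, c], the shrinkage vanishes in the limit, and
      \<open>l\<close> respects every window fixed by \<open>m\<close>.\<close>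
    have BA: "B \<subseteq> ?A"
    proof
      fix \<omega> assume \<omega>: "\<omega> \<in> B"
      then have "\<omega> \<in> D 0" unfolding B_def by auto
      then have \<omega>s: "\<omega> \<in> space M" unfolding D_def by auto
      have "\<exists>s. 0 \<le> s \<and> s \<le> c + 1 / real (Suc k) \<and> (\<forall>j<k. \<forall>u\<in>\<rat>.
        s + 1 / real (Suc k) < u \<and> u < s + 1 / real (Suc (m j)) - 1 / real (Suc k) \<longrightarrow> X u \<omega> \<le> 1 / real (Suc j))" for k
        using \<omega> unfolding B_def D_def by blast
      then obtain s where s: "\<And>k. 0 \<le> s k" "\<And>k. s k \<le> c + 1 / real (Suc k)"
        "\<And>k j u. j < k \<Longrightarrow> u \<in> \<rat> \<Longrightarrow> s k + 1 / real (Suc k) < u \<Longrightarrow>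
           u < s k + 1 / real (Suc (m j)) - 1 / real (Suc k) \<Longrightarrow> X u \<omega> \<le> 1 / real (Suc j)"
        by metis
      have "s k \<in> {0..c+1}" for k using s(1)[of k] s(2)[of k]
        by (smt (verit) atLeastAtMost_iff divide_le_eq_1_pos of_nat_0_less_iff of_nat_Suc of_nat_0_le_iff zero_less_Suc)
      then obtain l \<phi> where \<phi>: "strict_mono \<phi>" "(s \<circ> \<phi>) \<longlonglongrightarrow> l"
        using compact_Icc[of 0 "c+1"] unfolding compact_def by metis
      have inv0: "(\<lambda>k. 1 / real (Suc (\<phi> k))) \<longlonglongrightarrow> 0"
        using LIMSEQ_subseq_LIMSEQ[OF lim_1_over_n[THEN LIMSEQ_Suc] \<phi>(1)] by (simp add: o_def)
      have l: "0 \<le> l" "l \<le> c"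
      proof -
        show "0 \<le> l" using \<phi>(2) by (rule LIMSEQ_le_const) (auto simp: s)
        have "(\<lambda>k. c + 1 / real (Suc (\<phi> k))) \<longlonglongrightarrow> c + 0" by (intro tendsto_intros inv0)
        with \<phi>(2) have "l \<le> c + 0" by (rule LIMSEQ_le) (auto simp: s(2) simp del: of_nat_Suc)
        then show "l \<le> c" by simp
      qed
      have "X u \<omega> \<le> 1 / real (Suc j)" if u: "u \<in> \<rat>" "l < u" "u < l + 1 / real (Suc (m j))" for u j
      proof -
        have "(\<lambda>k. s (\<phi> k) + 1 / real (Suc (\<phi> k))) \<longlonglongrightarrow> l + 0"
          by (intro tendsto_intros inv0) (use \<phi>(2) in \<open>simp add: o_def\<close>)
        then have 1: "\<forall>\<^sub>F k in sequentially. s (\<phi> k) + 1 / real (Suc (\<phi> k)) < u"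
          using u by (intro order_tendstoD(2)) auto
        have "(\<lambda>k. s (\<phi> k) + 1 / real (Suc (m j)) - 1 / real (Suc (\<phi> k))) \<longlonglongrightarrow> l + 1 / real (Suc (m j)) - 0"
          by (intro tendsto_intros inv0) (use \<phi>(2) in \<open>simp add: o_def\<close>)
        then have 2: "\<forall>\<^sub>F k in sequentially. u < s (\<phi> k) + 1 / real (Suc (m j)) - 1 / real (Suc (\<phi> k))"
          using u by (intro order_tendstoD(1)) auto
        have 3: "\<forall>\<^sub>F k in sequentially. j < \<phi> k"
          using seq_suble[OF \<phi>(1)] by (intro eventually_sequentiallyI[of "Suc j"]) (meson Suc_le_lessD order_less_le_trans)
        obtain k where "s (\<phi> k) + 1 / real (Suc (\<phi> k)) < u"
          "u < s (\<phi> k) + 1 / real (Suc (m j)) - 1 / real (Suc (\<phi> k))" "j < \<phi> k"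
          using eventually_happens'[OF _ eventually_conj[OF 1 eventually_conj[OF 2 3]]] by auto
        then show ?thesis using s(3)[of j "\<phi> k" u] u(1) by auto
      qed
      then have "X l \<omega> \<le> 0"
        using right_cont_le_zero_iff[of "\<lambda>s. X s \<omega>" l, OF rc] \<omega>s l by blast
      then show "\<omega> \<in> ?A" using l \<omega>s by auto
    qed
    show "\<exists>B\<in>sets N. B \<subseteq> ?A \<and> \<theta> \<le> emeasure N B"
    proof (intro bexI conjI)
      show "B \<subseteq> ?A" by (rule BA)
      show Bs: "B \<in> sets N" unfolding B_def sN using D_meas by auto
      \<comment> \<open>Finite intersections decrease and each still contains
        \<open>S (f k)\<close>, so continuity from above transfers the bound \<theta> to
        \<open>B\<close>.\<close>
      define D' where "D' k = (\<Inter>i\<le>k. D i)" for k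
      have D's: "D' k \<in> sets N" for k unfolding D'_def sN using D_meas by auto
      have "(\<lambda>k. emeasure N (D' k)) \<longlonglongrightarrow> emeasure N (\<Inter>k. D' k)"
        by (rule Lim_emeasure_decseq) (use D's in \<open>auto simp: D'_def decseq_def\<close>)
      moreover have "(\<Inter>k. D' k) = B" unfolding D'_def B_def by auto
      moreover have "\<theta> \<le> emeasure N (D' k)" for k
      proof -
        have "\<theta> \<le> outer_measure_of N (S (f k))" using fS[of k] by simp
        also have "\<dots> \<le> outer_measure_of N (D' k)"
          by (rule outer_measure_of_mono) (use SD in \<open>auto simp: D'_def\<close>)
        finally show ?thesis using D's by simp
      qed
      ultimately show "\<theta> \<le> emeasure N B" by (auto intro: LIMSEQ_le_const)
    qed
  qed
  then show ?thesis by (auto simp: sets_ucomp)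
qed

section \<open>Paths and passage times\<close>


definition rcont :: "(real \<Rightarrow> 's::topological_space) \<Rightarrow> bool" where
  "rcont p \<longleftrightarrow> (\<forall>t\<ge>0. (p \<longlongrightarrow> p t) (at_right t))"

definition shift_path :: "real \<Rightarrow> (real \<Rightarrow> 's) \<Rightarrow> real \<Rightarrow> 's" where
  "shift_path t p = (\<lambda>s. p (t + s))"

definition stopped :: "real \<Rightarrow> (real \<Rightarrow> 's) \<Rightarrow> real \<Rightarrow> 's" where
  "stopped t p = (\<lambda>s. p (min s t))"

definition transl :: "real \<Rightarrow> (real \<Rightarrow> real \<times> 'e) \<Rightarrow> real \<Rightarrow> real \<times> 'e" where
  "transl c p = (\<lambda>s. (c + fst (p s), snd (p s)))"

text \<open>The two passage times and the two stopping regions of the paper differ only in the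
  strictness of their inequalities; the flag distinguishes the pair used in \<open>rho1\<close> (\<open>True\<close>) from
  the pair used in \<open>rho2\<close> (\<open>False\<close>).\<close>

definition tau :: "bool \<Rightarrow> (real \<Rightarrow> real \<times> 'e) \<Rightarrow> ennreal" where
  "tau k p = (if k then tau_minus (\<lambda>t p. fst (p t)) p else tau_minus_plus (\<lambda>t p. fst (p t)) p)"

definition reg :: "bool \<Rightarrow> ('e \<Rightarrow> real) \<Rightarrow> (real \<times> 'e) set" where
  "reg k b = {z. if k then b (snd z) \<le> fst z else b (snd z) < fst z}"

definition first_arr :: "(real \<times> 'e) set \<Rightarrow> (real \<Rightarrow> real \<times> 'e) \<Rightarrow> real stream \<Rightarrow> ennreal" where
  "first_arr R p rs = Inf (ennreal ` {arr_time rs k | k. k \<ge> 1 \<and> arr_time rs k > 0 \<and> p (arr_time rs k) \<in> R})"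

section \<open>Path operations and rational approximation of passage times\<close>

lemma shift_shift: "shift_path s (shift_path t p) = shift_path (t + s) p"
  by (simp add: shift_path_def add.assoc)

lemma transl_shift: "transl c (shift_path t p) = shift_path t (transl c p)"
  by (simp add: shift_path_def transl_def)

lemma transl_0 [simp]: "transl 0 p = p"
  by (simp add: transl_def)

lemma filterlim_add_at_right: "filterlim (\<lambda>s. t + s) (at_right (t + u)) (at_right (u::real))"
proof -
  have "((\<lambda>s. t + s) \<longlongrightarrow> t + u) (at_right u)" by (intro tendsto_intros)
  then show ?thesis
    unfolding filterlim_at by (auto intro: eventually_mono[OF eventually_at_right_less[of u]])
qed

lemma rcont_shift: "rcont p \<Longrightarrow> 0 \<le> t \<Longrightarrow> rcont (shift_path t p)"
  unfolding rcont_def shift_path_def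
proof (intro allI impI)
  fix u assume p: "\<forall>t\<ge>0. (p \<longlongrightarrow> p t) (at_right t)" and "0 \<le> t" "0 \<le> (u::real)"
  then have "(p \<longlongrightarrow> p (t + u)) (at_right (t + u))" by simp
  then show "((\<lambda>s. p (t + s)) \<longlongrightarrow> p (t + u)) (at_right u)"
    by (rule filterlim_compose[OF _ filterlim_add_at_right])
qed

lemma rcont_stopped:
  assumes p: "rcont p" and "0 \<le> t"
  shows "rcont (stopped t p)"
  unfolding rcont_def stopped_def
proof (intro allI impI)
  fix u :: real assume u: "0 \<le> u"
  show "((\<lambda>s. p (min s t)) \<longlongrightarrow> p (min u t)) (at_right u)"
  proof (cases "u < t")
    case True
    have "(p \<longlongrightarrow> p u) (at_right u)" using p u by (simp add: rcont_def)
    moreover have "\<forall>\<^sub>F s in at_right u. p s = p (min s t)"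
      using eventually_at_right_real[OF True] by eventually_elim auto
    ultimately show ?thesis using True by (auto intro: Lim_transform_eventually)
  next
    case False
    have "\<forall>\<^sub>F s in at_right u. p t = p (min s t)"
      using eventually_at_right_less[of u] False by (auto elim!: eventually_mono)
    then show ?thesis using False by (auto intro: Lim_transform_eventually)
  qed
qed

lemma rcont_transl:
  fixes p :: "real \<Rightarrow> real \<times> 'e::topological_space"
  shows "rcont p \<Longrightarrow> rcont (transl c p)"
  unfolding rcont_def transl_def by (intro allI impI tendsto_intros) auto

lemma rcont_fst:
  fixes p :: "real \<Rightarrow> real \<times> 'e::topological_space"
  shows "rcont p \<Longrightarrow> 0 \<le> t \<Longrightarrow> ((\<lambda>s. fst (p s)) \<longlongrightarrow> fst (p t)) (at_right t)"
  unfolding rcont_def by (intro tendsto_fst) auto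

lemma tau_True_less_iff: "tau True p < a \<longleftrightarrow> (\<exists>t>0. ennreal t < a \<and> fst (p t) < 0)"
  by (auto simp: tau_def tau_minus_def Inf_less_iff)

lemma tau_False_less_iff: "tau False p < a \<longleftrightarrow> (\<exists>t\<ge>0. ennreal t < a \<and> fst (p t) \<le> 0)"
  by (auto simp: tau_def tau_minus_plus_def Inf_less_iff)

text \<open>Right-continuity moves a strict inequality to a later rational time; the bound
  \<open>a\<close> is an \<open>ennreal\<close> because the time horizon may be infinite.\<close>

lemma right_rational:
  assumes "(f \<longlongrightarrow> (l::real)) (at_right t)" "l < c" "ennreal t < a" "0 \<le> t"
  shows "\<exists>u\<in>\<rat>. t < u \<and> ennreal u < a \<and> f u < c"
proof -
  obtain t' where t': "t < t'" "ennreal t' \<le> a"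
  proof (cases a)
    case (real x)
    then show ?thesis using that[of x] assms(3,4) by (auto simp: ennreal_less_iff)
  next
    case top
    then show ?thesis using that[of "t+1"] by auto
  qed
  obtain b where b: "b > t" "\<And>u. t < u \<Longrightarrow> u < b \<Longrightarrow> f u < c"
    using order_tendstoD(2)[OF assms(1,2)] by (auto simp: eventually_at_right_field)
  obtain u where "u \<in> \<rat>" "t < u" "u < min b t'"
    using Rats_dense_in_real[of t "min b t'"] b(1) t'(1) by auto
  moreover have "ennreal u < a"
    using calculation t' \<open>0 \<le> t\<close> by (intro order.strict_trans2[OF _ t'(2)] ennreal_lessI) auto
  ultimately show ?thesis using b(2)[of u] by auto
qed

text \<open>The topology of the source is the initial one for \<open>h\<close>. It lets limits of
  measurable maps be taken in a metric space while the Borel sets of the state space remain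
  preimages of Borel sets there.\<close>

definition embeds :: "('s::topological_space \<Rightarrow> 'm::metric_space) \<Rightarrow> bool" where
  "embeds h \<longleftrightarrow> continuous_on UNIV h \<and> (\<forall>U. open U \<longrightarrow> (\<exists>V. open V \<and> U = h -` V))"

text \<open>Open sets of the product are unions of boxes. The family \<open>\<W>\<close> takes all
  target boxes whose preimage stays in \<open>U\<close>, so no box has to be chosen for each
  point.\<close>

lemma embeds_Pair:
  fixes h :: "'e::topological_space \<Rightarrow> 'k::metric_space"
  assumes "embeds h"
  shows "embeds (\<lambda>z::real \<times> 'e. (fst z, h (snd z)))"
  unfolding embeds_def
proof (intro conjI allI impI)
  have hc: "continuous_on UNIV h" using assms by (simp add: embeds_def)
  show "continuous_on UNIV (\<lambda>z::real \<times> 'e. (fst z, h (snd z)))"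
    by (intro continuous_intros continuous_on_compose2[OF hc]) auto
  fix U :: "(real \<times> 'e) set" assume U: "open U"
  define \<W> where "\<W> = {A \<times> B | A B. open (A::real set) \<and> open (B::'k set) \<and> A \<times> (h -` B) \<subseteq> U}"
  show "\<exists>V. open V \<and> U = (\<lambda>z. (fst z, h (snd z))) -` V"
  proof (intro exI conjI)
    show "open (\<Union>\<W>)" unfolding \<W>_def by (auto intro: open_Times)
    show "U = (\<lambda>z. (fst z, h (snd z))) -` \<Union>\<W>"
    proof (intro equalityI subsetI)
      fix z assume "z \<in> U"
      then obtain A B where "open A" "open B" "z \<in> A \<times> B" "A \<times> B \<subseteq> U"
        using open_prod_elim[OF U] by blast
      moreover obtain V where "open V" "B = h -` V" using assms \<open>open B\<close> by (auto simp: embeds_def)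
      ultimately show "z \<in> (\<lambda>z. (fst z, h (snd z))) -` \<Union>\<W>"
        unfolding \<W>_def by (auto intro!: exI[of _ "A \<times> V"])
    qed (auto simp: \<W>_def)
  qed
qed

lemma measurable_embeds_iff:
  assumes "embeds h"
  shows "f \<in> borel_measurable M \<longleftrightarrow> (\<lambda>x. h (f x)) \<in> borel_measurable M"
proof
  assume "(\<lambda>x. h (f x)) \<in> borel_measurable M"
  show "f \<in> borel_measurable M"
  proof (rule borel_measurableI)
    fix U :: "'a set" assume "open U"
    then obtain V where "open V" "U = h -` V" using assms by (auto simp: embeds_def)
    then have "f -` U \<inter> space M = (\<lambda>x. h (f x)) -` V \<inter> space M" by auto
    then show "f -` U \<inter> space M \<in> sets M"
      using \<open>open V\<close> \<open>(\<lambda>x. h (f x)) \<in> borel_measurable M\<close> by (auto intro: measurable_sets)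
  qed
next
  assume [measurable]: "f \<in> borel_measurable M"
  have [measurable]: "h \<in> borel_measurable borel"
    using assms by (auto simp: embeds_def intro: borel_measurable_continuous_onI)
  show "(\<lambda>x. h (f x)) \<in> borel_measurable M" by measurable
qed

text \<open>Each time is replaced by the next point of the grid of mesh
  \<open>1 / real (Suc n)\<close>. Only countably many values occur, so the approximation is jointly
  measurable; the grid point lies strictly after the time, so right-continuity gives convergence.
  Negative times are clamped to 0 to make the map total.\<close>

lemma measurable_right_cont_process:
  fixes Z :: "real \<Rightarrow> 'w \<Rightarrow> 's::topological_space" and h :: "'s \<Rightarrow> 'm::metric_space"
  assumes h: "embeds h"
    and meas: "\<And>t. t \<ge> 0 \<Longrightarrow> Z t \<in> borel_measurable M"
    and rc: "\<And>\<omega>. \<omega> \<in> space M \<Longrightarrow> rcont (\<lambda>t. Z t \<omega>)"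
  shows "(\<lambda>(t, \<omega>). Z (max 0 t) \<omega>) \<in> borel_measurable (borel \<Otimes>\<^sub>M M)"
proof (subst measurable_embeds_iff[OF h], rule borel_measurable_LIMSEQ_metric)
  define a where "a n t = (real (nat \<lfloor>real (Suc n) * max 0 t\<rfloor>) + 1) / real (Suc n)" for n :: nat and t :: real
  fix n
  have [measurable]: "(\<lambda>x. h (Z ((real i + 1) / real (Suc n)) x)) \<in> borel_measurable M" for i
    using meas[of "(real i + 1) / real (Suc n)"] measurable_embeds_iff[OF h] by auto
  have "(\<lambda>(t, \<omega>). h (Z ((real (nat \<lfloor>real (Suc n) * max 0 t\<rfloor>) + 1) / real (Suc n)) \<omega>)) \<in> borel_measurable (borel \<Otimes>\<^sub>M M)"
    unfolding split_beta'
    by (rule measurable_compose_countable[where f="\<lambda>i x. h (Z ((real i + 1) / real (Suc n)) (snd x))"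
          and g="\<lambda>x. nat \<lfloor>real (Suc n) * max 0 (fst x)\<rfloor>"]) measurable
  then show "(\<lambda>x. h (Z (a n (fst x)) (snd x))) \<in> borel_measurable (borel \<Otimes>\<^sub>M M)"
    by (simp add: a_def split_beta')
next
  define a where "a n t = (real (nat \<lfloor>real (Suc n) * max 0 t\<rfloor>) + 1) / real (Suc n)" for n :: nat and t :: real
  fix x :: "real \<times> 'w" assume "x \<in> space (borel \<Otimes>\<^sub>M M)"
  then obtain t \<omega> where x: "x = (t, \<omega>)" "\<omega> \<in> space M" by (auto simp: space_pair_measure)
  define u where "u = max 0 t"
  have a: "u < a n t" "a n t \<le> u + 1 / real (Suc n)" for n
  proof -
    have 0: "0 \<le> real (Suc n) * u" by (auto simp: u_def)
    have "real (nat \<lfloor>real (Suc n) * u\<rfloor>) \<le> real (Suc n) * u" "real (Suc n) * u < real (nat \<lfloor>real (Suc n) * u\<rfloor>) + 1"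
      using 0 by linarith+
    then show "u < a n t" "a n t \<le> u + 1 / real (Suc n)" unfolding a_def u_def[symmetric]
      by (simp_all add: field_simps del: of_nat_Suc)
  qed
  have "(\<lambda>n. u + 1 / real (Suc n)) \<longlonglongrightarrow> u + 0"
    by (intro tendsto_intros lim_1_over_n[THEN LIMSEQ_Suc])
  then have "(\<lambda>n. a n t) \<longlonglongrightarrow> u"
    using a less_imp_le[OF a(1)]
    by (intro tendsto_sandwich[OF always_eventually always_eventually tendsto_const, of u "\<lambda>n. a n t" "\<lambda>n. u + 1 / real (Suc n)"])
       (simp_all del: of_nat_Suc add: a(2))
  then have "filterlim (\<lambda>n. a n t) (at_right u) sequentially"
    unfolding filterlim_at using a(1) less_imp_neq[OF a(1), symmetric] by (intro conjI always_eventually) simp_all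
  moreover have "((\<lambda>s. Z s \<omega>) \<longlongrightarrow> Z u \<omega>) (at_right u)" using rc[OF x(2)] by (auto simp: rcont_def u_def)
  ultimately have "(\<lambda>n. Z (a n t) \<omega>) \<longlonglongrightarrow> Z u \<omega>" by (rule filterlim_compose[rotated])
  moreover have "continuous_on UNIV h" using h by (auto simp: embeds_def)
  ultimately have "(\<lambda>n. h (Z (a n t) \<omega>)) \<longlonglongrightarrow> h (Z u \<omega>)"
    by (intro continuous_on_tendsto_compose[of UNIV h]) auto
  then show "(\<lambda>n. h (Z ((real (nat \<lfloor>real (Suc n) * max 0 (fst x)\<rfloor>) + 1) / real (Suc n)) (snd x)))
     \<longlonglongrightarrow> h ((\<lambda>(t, \<omega>). Z (max 0 t) \<omega>) x)"
    unfolding x a_def u_def by simp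
qed

text \<open>The level condition is strict, so right-continuity reduces it to rational times and no
  completion is required.\<close>

lemma measurable_tau_True:
  fixes Z :: "real \<Rightarrow> 'w \<Rightarrow> real \<times> 'e::topological_space"
  assumes meas: "\<And>t. t \<ge> 0 \<Longrightarrow> Z t \<in> borel_measurable M"
    and rc: "\<And>\<omega>. \<omega> \<in> space M \<Longrightarrow> rcont (\<lambda>t. Z t \<omega>)"
  shows "(\<lambda>\<omega>. tau True (\<lambda>t. Z t \<omega>)) \<in> borel_measurable M"
proof (rule borel_measurableI_less)
  fix a :: ennreal
  have "tau True (\<lambda>t. Z t \<omega>) < a \<longleftrightarrow> (\<exists>t\<in>{t\<in>\<rat>. 0 < t \<and> ennreal t < a}. fst (Z t \<omega>) < 0)"
    if \<omega>: "\<omega> \<in> space M" for \<omega>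
  proof
    assume "tau True (\<lambda>t. Z t \<omega>) < a"
    then obtain t where t: "0 < t" "ennreal t < a" "fst (Z t \<omega>) < 0" by (auto simp: tau_True_less_iff)
    obtain u where "u \<in> \<rat>" "t < u" "ennreal u < a" "fst (Z u \<omega>) < 0"
      using right_rational[OF rcont_fst[OF rc[OF \<omega>]], of t 0 a] t by auto
    then show "\<exists>t\<in>{t\<in>\<rat>. 0 < t \<and> ennreal t < a}. fst (Z t \<omega>) < 0"
      using t(1) by (intro bexI[of _ u]) auto
  qed (auto simp: tau_True_less_iff)
  then have eq: "{\<omega>\<in>space M. tau True (\<lambda>t. Z t \<omega>) < a} =
      {\<omega>\<in>space M. \<exists>t\<in>{t\<in>\<rat>. 0 < t \<and> ennreal t < a}. fst (Z t \<omega>) < 0}" by auto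
  have "{\<omega>\<in>space M. fst (Z t \<omega>) < 0} \<in> sets M" if "0 < t" for t
  proof -
    have [measurable]: "Z t \<in> borel_measurable M" "fst \<in> borel_measurable (borel :: (real \<times> 'e) measure)"
      using meas that by (auto intro!: borel_measurable_continuous_onI continuous_on_fst continuous_on_snd continuous_on_id)
    show ?thesis by measurable
  qed
  then show "{\<omega>\<in>space M. tau True (\<lambda>t. Z t \<omega>) < a} \<in> sets M" unfolding eq
    by (intro sets.sets_Collect_countable_Ex') (auto intro: countable_subset[OF _ countable_rat])
qed

text \<open>The level condition is not strict and may hold at a single irrational time, so a
  projection over an interval of times remains for each rational bound.\<close>

lemma measurable_tau_False:
  fixes Z :: "real \<Rightarrow> 'w \<Rightarrow> real \<times> 'e::topological_space"
  assumes meas: "\<And>t. t \<ge> 0 \<Longrightarrow> Z t \<in> borel_measurable M"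
    and rc: "\<And>\<omega>. \<omega> \<in> space M \<Longrightarrow> rcont (\<lambda>t. Z t \<omega>)"
  shows "(\<lambda>\<omega>. tau False (\<lambda>t. Z t \<omega>)) \<in> borel_measurable (ucomp M)"
proof (rule borel_measurableI_less)
  fix a :: ennreal
  have "tau False (\<lambda>t. Z t \<omega>) < a \<longleftrightarrow>
      (\<exists>c\<in>{t\<in>\<rat>. 0 \<le> t \<and> ennreal t < a}. \<exists>s. 0 \<le> s \<and> s \<le> c \<and> fst (Z s \<omega>) \<le> 0)" for \<omega>
  proof
    assume "tau False (\<lambda>t. Z t \<omega>) < a"
    then obtain t where t: "0 \<le> t" "ennreal t < a" "fst (Z t \<omega>) \<le> 0" by (auto simp: tau_False_less_iff)
    obtain u where "u \<in> \<rat>" "t < u" "ennreal u < a"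
      using right_rational[of "\<lambda>_. 0" 0 t 1 a] t by auto
    then show "\<exists>c\<in>{t\<in>\<rat>. 0 \<le> t \<and> ennreal t < a}. \<exists>s. 0 \<le> s \<and> s \<le> c \<and> fst (Z s \<omega>) \<le> 0"
      using t by (intro bexI[of _ u]) auto
  qed (auto simp: tau_False_less_iff intro: order.strict_trans1[OF ennreal_leI])
  then have eq: "{\<omega>\<in>space (ucomp M). tau False (\<lambda>t. Z t \<omega>) < a} =
      {\<omega>\<in>space (ucomp M). \<exists>c\<in>{t\<in>\<rat>. 0 \<le> t \<and> ennreal t < a}. \<omega> \<in> {\<omega> \<in> space M. \<exists>s. 0 \<le> s \<and> s \<le> c \<and> fst (Z s \<omega>) \<le> 0}}" by auto
  have "{\<omega> \<in> space M. \<exists>s. 0 \<le> s \<and> s \<le> c \<and> fst (Z s \<omega>) \<le> 0} \<in> sets (ucomp M)" if "0 \<le> c" for c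
  proof (rule exists_le_zero_ucomp[OF _ _ that])
    fix t :: real assume "0 \<le> t"
    then have [measurable]: "Z t \<in> borel_measurable M" "fst \<in> borel_measurable (borel :: (real \<times> 'e) measure)"
      using meas by (auto intro!: borel_measurable_continuous_onI continuous_on_fst continuous_on_snd continuous_on_id)
    show "(\<lambda>\<omega>. fst (Z t \<omega>)) \<in> borel_measurable M" by measurable
  qed (use rc rcont_fst in auto)
  then have *: "{\<omega> \<in> space (ucomp M). \<omega> \<in> {\<omega> \<in> space M. \<exists>s. 0 \<le> s \<and> s \<le> c \<and> fst (Z s \<omega>) \<le> 0}} \<in> sets (ucomp M)"
    if "0 \<le> c" for c
    by (rule back_subst[where P="\<lambda>A. A \<in> sets (ucomp M)"]) (use that in auto)
  show "{\<omega>\<in>space (ucomp M). tau False (\<lambda>t. Z t \<omega>) < a} \<in> sets (ucomp M)" unfolding eq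
    by (intro sets.sets_Collect_countable_Ex' *)
       (auto intro: countable_subset[OF _ countable_rat])
qed

section \<open>Measurability of the discounted payoff\<close>

lemma exp_neg_measurable [measurable]: "exp_neg \<in> borel_measurable borel"
  unfolding exp_neg_def[abs_def] by measurable

locale barrier_model =
  fixes h :: "'e::topological_space \<Rightarrow> 'k::metric_space"
    and qq :: "'e \<Rightarrow> real" and q \<beta> r :: real
  assumes h: "embeds h"
    and qq_meas [measurable]: "qq \<in> borel_measurable borel"
    and q_pos: "q > 0" and qq_gt: "\<And>y. qq y > q"
    and beta: "\<beta> > 1" and r_pos: "r > 0"
begin

definition qi :: "(real \<Rightarrow> real \<times> 'e) \<Rightarrow> ennreal \<Rightarrow> ennreal" where
  "qi p T = qint qq (\<lambda>t p. snd (p t)) p T"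

text \<open>A tie of arrival and passage counts as stopping when \<open>k\<close> holds and pays
  nothing otherwise. Exponential waiting times make finite ties negligible, which later gives both
  variants the same one-step equation.\<close>

definition payoff :: "bool \<Rightarrow> (real \<times> 'e) set \<Rightarrow> (real \<Rightarrow> real \<times> 'e) \<Rightarrow> real stream \<Rightarrow> ennreal" where
  "payoff k R p rs =
     (if (if k then first_arr R p rs \<le> tau k p else first_arr R p rs < tau k p)
      then exp_neg (qi p (first_arr R p rs)) else 0)
   + ennreal \<beta> * (if tau k p < first_arr R p rs then exp_neg (qi p (tau k p)) else 0)"

abbreviation "proc M Z \<equiv> (\<forall>t\<ge>0. Z t \<in> M \<rightarrow>\<^sub>M (borel :: (real \<times> 'e) measure)) \<and> (\<forall>\<omega>\<in>space M. rcont (\<lambda>t. Z t \<omega>))"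

lemma proc_joint: "proc M Z \<Longrightarrow> (\<lambda>(t, \<omega>). Z (max 0 t) \<omega>) \<in> borel_measurable (borel \<Otimes>\<^sub>M M)"
  by (rule measurable_right_cont_process[OF embeds_Pair[OF h]]) auto

lemma fst_borel [measurable]: "fst \<in> borel_measurable (borel :: (real \<times> 'e) measure)"
  by (auto intro!: borel_measurable_continuous_onI continuous_on_fst continuous_on_snd continuous_on_id)

lemma snd_borel [measurable]: "snd \<in> (borel :: (real \<times> 'e) measure) \<rightarrow>\<^sub>M borel"
  by (auto intro!: borel_measurable_continuous_onI continuous_on_fst continuous_on_snd continuous_on_id)

lemma proc_ucomp: "proc M Z \<Longrightarrow> proc (ucomp M) Z"
  by (auto intro: measurable_ucompI)

text \<open>Making the shift time part of the sample point lets joint measurability of shifting, in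
  time and path together, follow from the general criterion for maps into path space.\<close>

lemma proc_shift:
  assumes "proc M Z"
  shows "proc (borel \<Otimes>\<^sub>M M) (\<lambda>s (t, \<omega>). Z (max 0 t + s) \<omega>)"
proof (intro conjI allI impI ballI)
  fix s :: real assume "0 \<le> s"
  note proc_joint[OF assms, measurable]
  have "(\<lambda>x. (\<lambda>(t, \<omega>). Z (max 0 t) \<omega>) (max 0 (fst x) + s, snd x)) \<in> borel_measurable (borel \<Otimes>\<^sub>M M)"
    by measurable
  then show "(\<lambda>(t, \<omega>). Z (max 0 t + s) \<omega>) \<in> borel_measurable (borel \<Otimes>\<^sub>M M)"
    using \<open>0 \<le> s\<close> by (simp add: split_beta' max_def)
next
  fix x :: "real \<times> 'a" assume "x \<in> space (borel \<Otimes>\<^sub>M M)"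
  then obtain t \<omega> where "x = (t, \<omega>)" "\<omega> \<in> space M" by (auto simp: space_pair_measure)
  then show "rcont (\<lambda>s. (\<lambda>(t, \<omega>). Z (max 0 t + s) \<omega>) x)"
    using rcont_shift[of "\<lambda>t. Z t \<omega>" "max 0 t"] assms by (auto simp: shift_path_def)
qed

lemma first_arr_measurable:
  assumes "proc M Z" and [measurable]: "R \<in> sets borel"
  shows "(\<lambda>(\<omega>, rs). first_arr R (\<lambda>t. Z t \<omega>) rs) \<in> borel_measurable (M \<Otimes>\<^sub>M stream_space borel)"
proof -
  note proc_joint[OF assms(1), measurable]
  have arr [measurable]: "(\<lambda>rs. arr_time rs k) \<in> borel_measurable (stream_space borel)" for k
    unfolding arr_time_def by measurable
  have "(\<lambda>x. (\<lambda>(t, \<omega>). Z (max 0 t) \<omega>) (arr_time (snd x) k, fst x)) \<in> (M \<Otimes>\<^sub>M stream_space borel) \<rightarrow>\<^sub>M borel" for k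
    by measurable
  then have [measurable]: "(\<lambda>x. Z (max 0 (arr_time (snd x) k)) (fst x)) \<in> (M \<Otimes>\<^sub>M stream_space borel) \<rightarrow>\<^sub>M borel" for k
    by simp
  \<comment> \<open>Indices that fail the condition contribute infinity; the infimum over a random
    index set thus becomes a countable infimum of measurable functions.\<close>
  have "first_arr R (\<lambda>t. Z t \<omega>) rs = (INF k\<in>{1..}. if 0 < arr_time rs k \<and> Z (max 0 (arr_time rs k)) \<omega> \<in> R
      then ennreal (arr_time rs k) else \<top>)" for \<omega> rs
    unfolding first_arr_def
    by (intro antisym Inf_greatest INF_greatest)
       (auto intro!: Inf_lower INF_lower2 simp: max_def)
  then have "(\<lambda>(\<omega>, rs). first_arr R (\<lambda>t. Z t \<omega>) rs) = (\<lambda>x. INF k\<in>{1..}. if 0 < arr_time (snd x) k \<and>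
      Z (max 0 (arr_time (snd x) k)) (fst x) \<in> R then ennreal (arr_time (snd x) k) else \<top>)"
    by (simp only: split_beta')
  also have "\<dots> \<in> borel_measurable (M \<Otimes>\<^sub>M stream_space borel)" by measurable
  finally show ?thesis .
qed

lemma qi_measurable:
  assumes "proc M Z"
  shows "(\<lambda>(\<omega>, T). qi (\<lambda>t. Z t \<omega>) T) \<in> borel_measurable (M \<Otimes>\<^sub>M borel)"
proof -
  note proc_joint[OF assms(1), measurable]
  have "qi (\<lambda>t. Z t \<omega>) T = (\<integral>\<^sup>+ s. indicator {s. 0 \<le> s \<and> ennreal s < T} s *
      ennreal (qq (snd ((\<lambda>(t, \<omega>). Z (max 0 t) \<omega>) (s, \<omega>)))) \<partial>lborel)" for \<omega> T
    unfolding qi_def qint_def by (intro nn_integral_cong) (auto simp: indicator_def max_def)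
  then show ?thesis unfolding split_beta' indicator_def by simp measurable
qed

text \<open>The halves are kept apart because \<open>rho1\<close> and \<open>rho2\<close> are sums
  of two integrals, one for stopping and one for ruin.\<close>

lemma payoff_parts_measurable:
  assumes "proc M Z" and [measurable]: "R \<in> sets borel"
    and [measurable]: "(\<lambda>\<omega>. tau k (\<lambda>t. Z t \<omega>)) \<in> borel_measurable M"
  shows "(\<lambda>(\<omega>, rs). if (if k then first_arr R (\<lambda>t. Z t \<omega>) rs \<le> tau k (\<lambda>t. Z t \<omega>)
        else first_arr R (\<lambda>t. Z t \<omega>) rs < tau k (\<lambda>t. Z t \<omega>))
      then exp_neg (qi (\<lambda>t. Z t \<omega>) (first_arr R (\<lambda>t. Z t \<omega>) rs)) else 0)
      \<in> borel_measurable (M \<Otimes>\<^sub>M stream_space borel)" (is ?A)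
    and "(\<lambda>(\<omega>, rs). if tau k (\<lambda>t. Z t \<omega>) < first_arr R (\<lambda>t. Z t \<omega>) rs
      then exp_neg (qi (\<lambda>t. Z t \<omega>) (tau k (\<lambda>t. Z t \<omega>))) else 0)
      \<in> borel_measurable (M \<Otimes>\<^sub>M stream_space borel)" (is ?B)
proof -
  let ?M = "M \<Otimes>\<^sub>M stream_space borel"
  note qi_measurable[OF assms(1), measurable]
  have m1 [measurable]: "(\<lambda>x. first_arr R (\<lambda>t. Z t (fst x)) (snd x)) \<in> borel_measurable ?M"
    using first_arr_measurable[OF assms(1,2)] by (simp add: split_beta')
  have m2 [measurable]: "(\<lambda>x. tau k (\<lambda>t. Z t (fst x))) \<in> borel_measurable ?M"
    by measurable
  have "(\<lambda>x. (\<lambda>(\<omega>, T). qi (\<lambda>t. Z t \<omega>) T) (fst x, first_arr R (\<lambda>t. Z t (fst x)) (snd x))) \<in> borel_measurable ?M"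
    "(\<lambda>x. (\<lambda>(\<omega>, T). qi (\<lambda>t. Z t \<omega>) T) (fst x, tau k (\<lambda>t. Z t (fst x)))) \<in> borel_measurable ?M"
    by measurable
  then have m3: "(\<lambda>x. qi (\<lambda>t. Z t (fst x)) (first_arr R (\<lambda>t. Z t (fst x)) (snd x))) \<in> borel_measurable ?M"
    "(\<lambda>x. qi (\<lambda>t. Z t (fst x)) (tau k (\<lambda>t. Z t (fst x)))) \<in> borel_measurable ?M"
    by simp_all
  have parts: "(\<lambda>x. if (if k then A x \<le> B x else A x < B x) then exp_neg (C x) else 0) \<in> borel_measurable N"
      "(\<lambda>x. if B x < A x then exp_neg (D x) else 0) \<in> borel_measurable N"
    if [measurable]: "A \<in> borel_measurable N" "B \<in> borel_measurable N" "C \<in> borel_measurable N" "D \<in> borel_measurable N"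
    for A B C D :: "'c \<Rightarrow> ennreal" and N :: "'c measure"
    by measurable
  show ?A ?B unfolding split_beta' by (rule parts[OF m1 m2 m3])+
qed

lemma payoff_measurable:
  assumes "proc M Z" "R \<in> sets borel" "(\<lambda>\<omega>. tau k (\<lambda>t. Z t \<omega>)) \<in> borel_measurable M"
  shows "(\<lambda>(\<omega>, rs). payoff k R (\<lambda>t. Z t \<omega>) rs) \<in> borel_measurable (M \<Otimes>\<^sub>M stream_space borel)"
proof -
  have abstract: "(\<lambda>x. A x + ennreal \<beta> * B x) \<in> borel_measurable N"
    if [measurable]: "A \<in> borel_measurable N" "B \<in> borel_measurable N" for A B :: "'c \<Rightarrow> ennreal" and N :: "'c measure"
    by measurable
  show ?thesis unfolding payoff_def split_beta'
    by (rule abstract[OF payoff_parts_measurable[OF assms, unfolded split_beta']])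
qed

end

section \<open>Path laws of right processes\<close>


text \<open>Times are increments: each entry is read along the path shifted by the preceding ones.
  One use of the Markov property then matches one step of the list recursion.\<close>

fun cyl :: "(real \<times> 's set) list \<Rightarrow> (real \<Rightarrow> 's) \<Rightarrow> bool" where
  "cyl [] p = True"
| "cyl ((s, B) # l) p = (p s \<in> B \<and> cyl l (shift_path s p))"

definition cyl_ok :: "(real \<times> 's::topological_space set) list \<Rightarrow> bool" where
  "cyl_ok l \<longleftrightarrow> (\<forall>(s, B)\<in>set l. 0 \<le> s \<and> B \<in> sets borel)"

definition cyls :: "(real \<Rightarrow> 's::topological_space) set set" where
  "cyls = {{p. rcont p \<and> cyl l p} | l. cyl_ok l}"

definition path_space :: "(real \<Rightarrow> 's::topological_space) measure" where
  "path_space = sigma {p. rcont p} cyls"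

lemma cyls_subset: "cyls \<subseteq> Pow {p. rcont p}"
  by (auto simp: cyls_def)

lemma space_path_space [simp]: "space path_space = {p. rcont p}"
  by (simp add: path_space_def cyls_subset)

lemma sets_path_space: "sets path_space = sigma_sets {p. rcont p} cyls"
  by (simp add: path_space_def cyls_subset)

text \<open>Merging as for sorted lists: the smaller first increment leads and is subtracted from
  the head of the other list. This makes the cylinders stable under intersection, as uniqueness of
  measures on a generator demands.\<close>

lemma cyl_merge:
  assumes "cyl_ok l" "cyl_ok l'"
  shows "\<exists>m. cyl_ok m \<and> (\<forall>p. cyl m p \<longleftrightarrow> cyl l p \<and> cyl l' p)"
  using assms
proof (induction "length l + length l'" arbitrary: l l' rule: less_induct)
  case less
  consider "l = []" | "l' = []"
    | s B k s' B' k' where "l = (s, B) # k" "l' = (s', B') # k'" "s \<le> s'"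
    | s B k s' B' k' where "l = (s, B) # k" "l' = (s', B') # k'" "s' \<le> s"
  proof (cases l; cases l')
    fix x k x' k' assume l: "l = x # k" "l' = x' # k'"
    obtain s B s' B' where "x = (s, B)" "x' = (s', B')" by (cases x; cases x') auto
    then show ?thesis using l linear[of s s'] that(3)[of s B k s' B' k'] that(4)[of s B k s' B' k'] by auto
  qed (use that in auto)
  then show ?case
  proof cases
    case 3
    have "cyl_ok k" "cyl_ok ((s' - s, B') # k')" using less.prems 3 by (auto simp: cyl_ok_def)
    then obtain m where "cyl_ok m" "\<forall>p. cyl m p \<longleftrightarrow> cyl k p \<and> cyl ((s' - s, B') # k') p"
      using less.hyps[of k "(s' - s, B') # k'"] 3 by auto
    then show ?thesis using 3 less.prems
      by (intro exI[of _ "(s, B) # m"]) (auto simp: cyl_ok_def shift_path_def)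
  next
    case 4
    have "cyl_ok k'" "cyl_ok ((s - s', B) # k)" using less.prems 4 by (auto simp: cyl_ok_def)
    then obtain m where "cyl_ok m" "\<forall>p. cyl m p \<longleftrightarrow> cyl ((s - s', B) # k) p \<and> cyl k' p"
      using less.hyps[of "(s - s', B) # k" k'] 4 by auto
    then show ?thesis using 4 less.prems
      by (intro exI[of _ "(s', B') # m"]) (auto simp: cyl_ok_def shift_path_def)
  qed (use less.prems in auto)
qed

lemma Int_stable_cyls: "Int_stable cyls"
proof (rule Int_stableI)
  fix A B :: "(real \<Rightarrow> 'a) set" assume "A \<in> cyls" "B \<in> cyls"
  then obtain l l' where l: "cyl_ok l" "cyl_ok l'" "A = {p. rcont p \<and> cyl l p}" "B = {p. rcont p \<and> cyl l' p}"
    unfolding cyls_def by (elim CollectE exE conjE) (erule (1) that)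
  obtain m where "cyl_ok m" "\<forall>p. cyl m p \<longleftrightarrow> cyl l p \<and> cyl l' p" using cyl_merge[OF l(1,2)] by auto
  then show "A \<inter> B \<in> cyls" unfolding cyls_def using l by (intro CollectI exI[of _ m]) blast
qed

lemma path_space_eqI:
  assumes "finite_measure M" "finite_measure N" and sets: "sets M = sets path_space" "sets N = sets path_space"
    and eq: "\<And>l. cyl_ok l \<Longrightarrow> emeasure M {p. rcont p \<and> cyl l p} = emeasure N {p. rcont p \<and> cyl l p}"
  shows "M = (N :: (real \<Rightarrow> 's::topological_space) measure)"
proof (rule measure_eqI_generator_eq[OF Int_stable_cyls cyls_subset])
  interpret M: finite_measure M by fact
  have univ: "{p::real \<Rightarrow> 's. rcont p} \<in> cyls"
    unfolding cyls_def by (intro CollectI exI[of _ "[]"]) (auto simp: cyl_ok_def)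
  show "range (\<lambda>_::nat. {p::real \<Rightarrow> 's. rcont p}) \<subseteq> cyls" using univ by auto
  show "emeasure M X = emeasure N X" if "X \<in> cyls" for X using that eq by (auto simp: cyls_def)
qed (use sets sets_path_space finite_measure.emeasure_finite[OF assms(1)] in auto)

lemma measurable_coord: "0 \<le> t \<Longrightarrow> (\<lambda>p. p t) \<in> path_space \<rightarrow>\<^sub>M borel"
proof (rule measurableI)
  fix B :: "'a set" assume "0 \<le> t" "B \<in> sets borel"
  then have "{p. rcont p \<and> cyl [(t, B)] p} \<in> cyls" unfolding cyls_def by (intro CollectI exI[of _ "[(t,B)]"]) (auto simp: cyl_ok_def)
  then have "{p. rcont p \<and> cyl [(t, B)] p} \<in> sets path_space" unfolding sets_path_space by auto
  then show "(\<lambda>p. p t) -` B \<inter> space path_space \<in> sets path_space"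
    by (rule back_subst[where P="\<lambda>A. A \<in> sets path_space"]) auto
qed simp

lemma cyl_measurable:
  assumes meas: "\<And>t. 0 \<le> t \<Longrightarrow> Z t \<in> M \<rightarrow>\<^sub>M borel" and "cyl_ok l" "0 \<le> t"
  shows "{\<omega>\<in>space M. cyl l (\<lambda>s. Z (t + s) \<omega>)} \<in> sets M"
  using assms(2,3)
proof (induction l arbitrary: t)
  case (Cons a l)
  obtain s B where a: "a = (s, B)" by force
  have ok: "0 \<le> s" "B \<in> sets borel" "cyl_ok l" using Cons.prems a by (auto simp: cyl_ok_def)
  have 1: "{\<omega>\<in>space M. cyl l (\<lambda>u. Z (t + s + u) \<omega>)} \<in> sets M" using Cons ok by auto
  have "Z (t + s) -` B \<inter> space M \<in> sets M" using meas[of "t + s"] ok Cons.prems by (auto intro: measurable_sets)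
  with 1 have "(Z (t + s) -` B \<inter> space M) \<inter> {\<omega>\<in>space M. cyl l (\<lambda>u. Z (t + s + u) \<omega>)} \<in> sets M" by auto
  then show ?case
    by (rule back_subst[where P="\<lambda>A. A \<in> sets M"]) (auto simp: a shift_path_def add.assoc)
qed auto

lemma measurable_path:
  assumes meas: "\<And>t. 0 \<le> t \<Longrightarrow> Z t \<in> M \<rightarrow>\<^sub>M borel" and rc: "\<And>\<omega>. \<omega> \<in> space M \<Longrightarrow> rcont (\<lambda>t. Z t \<omega>)"
  shows "(\<lambda>\<omega> t. Z t \<omega>) \<in> M \<rightarrow>\<^sub>M path_space"
  unfolding path_space_def
proof (rule measurable_sigma_sets[OF _ cyls_subset])
  fix A :: "(real \<Rightarrow> 'b) set" assume "A \<in> cyls"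
  then obtain l where l: "cyl_ok l" "A = {p. rcont p \<and> cyl l p}" by (auto simp: cyls_def)
  have "{\<omega>\<in>space M. cyl l (\<lambda>s. Z (0 + s) \<omega>)} \<in> sets M" by (rule cyl_measurable[OF meas l(1)]) auto
  then show "(\<lambda>\<omega> t. Z t \<omega>) -` A \<inter> space M \<in> sets M"
    by (rule back_subst[where P="\<lambda>A. A \<in> sets M"]) (use rc l in auto)
qed (use rc sets_path_space in \<open>auto simp: path_space_def cyls_subset\<close>)

lemma measurable_shift [measurable]:
  assumes "0 \<le> t" shows "shift_path t \<in> path_space \<rightarrow>\<^sub>M (path_space :: (real \<Rightarrow> 's::topological_space) measure)"
proof -
  have "(\<lambda>(p :: real \<Rightarrow> 's) s. p (t + s)) \<in> path_space \<rightarrow>\<^sub>M path_space"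
    by (rule measurable_path[of "\<lambda>s p. p (t + s)"]) (use assms rcont_shift[of _ t] in \<open>auto intro: measurable_coord simp: shift_path_def\<close>)
  then show ?thesis by (simp add: shift_path_def[abs_def])
qed

lemma transl_borel: "(\<lambda>z. (c + fst z, snd z)) \<in> borel \<rightarrow>\<^sub>M (borel :: (real \<times> 'e::topological_space) measure)"
  by (intro borel_measurable_continuous_onI continuous_on_Pair continuous_on_add continuous_on_const
      continuous_on_fst continuous_on_snd continuous_on_id)

lemma measurable_transl:
  "transl c \<in> path_space \<rightarrow>\<^sub>M (path_space :: (real \<Rightarrow> real \<times> 'e::topological_space) measure)"
proof -
  have "(\<lambda>(p :: real \<Rightarrow> real \<times> 'e) s. (c + fst (p s), snd (p s))) \<in> path_space \<rightarrow>\<^sub>M path_space"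
  proof (rule measurable_path[of "\<lambda>s p. (c + fst (p s), snd (p s))"])
    fix t :: real assume "0 \<le> t"
    show "(\<lambda>p. (c + fst (p t), snd (p t))) \<in> path_space \<rightarrow>\<^sub>M (borel :: (real \<times> 'e) measure)"
      by (rule measurable_compose[OF measurable_coord[OF \<open>0 \<le> t\<close>] transl_borel])
  qed (use rcont_transl[of _ c] in \<open>auto simp: transl_def\<close>)
  then show ?thesis by (simp add: transl_def[abs_def])
qed

text \<open>The densities \<open>f\<close> and \<open>g\<close> induce the same measure on the
  smaller sigma-algebra, so integrals of all functions measurable there agree; this passes from
  events of the past to weights.\<close>

lemma nn_integral_subalgebra_eq:
  fixes f g :: "'a \<Rightarrow> ennreal"
  assumes sub: "sets N \<subseteq> sets M" "space N = space M"
    and [measurable]: "f \<in> borel_measurable M" "g \<in> borel_measurable M"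
    and eq: "\<And>A. A \<in> sets N \<Longrightarrow> (\<integral>\<^sup>+x. indicator A x * f x \<partial>M) = (\<integral>\<^sup>+x. indicator A x * g x \<partial>M)"
    and G: "G \<in> borel_measurable N"
  shows "(\<integral>\<^sup>+x. G x * f x \<partial>M) = (\<integral>\<^sup>+x. G x * g x \<partial>M)"
proof -
  have id: "(\<lambda>x. x) \<in> density M f' \<rightarrow>\<^sub>M N" for f' :: "'a \<Rightarrow> ennreal"
    using sub by (auto simp: measurable_def)
  have [measurable]: "G \<in> borel_measurable M"
    using G sub by (auto simp: measurable_def)
  have "distr (density M f) N (\<lambda>x. x) = distr (density M g) N (\<lambda>x. x)"
  proof (rule measure_eqI)
    fix A assume "A \<in> sets (distr (density M f) N (\<lambda>x. x))"
    then have A: "A \<in> sets N" "A \<in> sets M" using sub by auto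
    then have "A \<inter> space M = A" using sets.sets_into_space by blast
    then show "emeasure (distr (density M f) N (\<lambda>x. x)) A = emeasure (distr (density M g) N (\<lambda>x. x)) A"
      using A eq[OF A(1)] by (simp add: emeasure_distr[OF id] emeasure_density mult.commute)
  qed simp
  then have "(\<integral>\<^sup>+x. G x \<partial>distr (density M f) N (\<lambda>x. x)) = (\<integral>\<^sup>+x. G x \<partial>distr (density M g) N (\<lambda>x. x))" by simp
  then show ?thesis
    using G by (simp add: nn_integral_distr[OF id] nn_integral_density mult.commute)
qed

section \<open>The simple Markov property for functionals of the whole path\<close>

locale markov_process =
  fixes F :: "'w set set" and Ft :: "real \<Rightarrow> 'w set set"
    and Z :: "real \<Rightarrow> 'w \<Rightarrow> 's::topological_space"
    and \<theta> :: "real \<Rightarrow> 'w \<Rightarrow> 'w" and P :: "'s \<Rightarrow> 'w measure"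
  assumes rp: "right_process F Ft Z \<theta> P"
begin

definition path :: "'w \<Rightarrow> real \<Rightarrow> 's" where "path \<omega> = (\<lambda>t. Z t \<omega>)"

lemma universally_complete: "universally_complete F"
  and laws_all: "\<forall>z. prob_space (P z) \<and> space (P z) = UNIV \<and> sets (P z) = F"
  and filtration: "\<forall>t\<ge>0. sigma_algebra UNIV (Ft t) \<and> Ft t \<subseteq> F"
  and Ft_mono_all: "\<forall>s t. 0 \<le> s \<longrightarrow> s \<le> t \<longrightarrow> Ft s \<subseteq> Ft t"
  and Z_Ft_all: "\<forall>t\<ge>0. \<forall>B \<in> sets borel. Z t -` B \<in> Ft t"
  and Z_rcont_all: "\<forall>\<omega>. \<forall>t\<ge>0. ((\<lambda>s. Z s \<omega>) \<longlongrightarrow> Z t \<omega>) (at_right t)"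
  and start_all: "\<forall>z. AE \<omega> in P z. Z 0 \<omega> = z"
  and kernel_all: "\<forall>A \<in> F. umeas_fun (\<lambda>z. measure (P z) A)"
  and markov_all: "\<forall>z s t A f. 0 \<le> s \<longrightarrow> 0 \<le> t \<longrightarrow> A \<in> Ft t \<longrightarrow> umeas_fun (f :: 's \<Rightarrow> ennreal) \<longrightarrow>
        (\<integral>\<^sup>+ \<omega>. indicator A \<omega> * f (Z (t + s) \<omega>) \<partial>P z)
          = (\<integral>\<^sup>+ \<omega>. indicator A \<omega> * (\<integral>\<^sup>+ \<omega>'. f (Z s \<omega>') \<partial>P (Z t \<omega>)) \<partial>P z)"
  and excessive_all: "\<forall>\<alpha>>0. \<forall>f. excessive P Z \<alpha> f \<longrightarrow>
        (\<forall>z. AE \<omega> in P z. \<forall>t\<ge>0. ((\<lambda>s. f (Z s \<omega>)) \<longlongrightarrow> f (Z t \<omega>)) (at_right t))"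
  using rp unfolding right_process_def by - (elim conjE, assumption)+

lemma prob: "prob_space (P z)" and space_P [simp]: "space (P z) = UNIV" and sets_P: "sets (P z) = F"
  using laws_all by auto

lemma finite_P: "finite_measure (P z)"
  using prob by (rule prob_space.finite_measure)

lemma sets_ucomp_P: "sets (ucomp (P z)) = F"
  using sets_ucomp_universally_complete[OF universally_complete sets_P space_P] .

lemma measurable_ucomp_P: "f \<in> ucomp (P z) \<rightarrow>\<^sub>M N \<longleftrightarrow> f \<in> P z \<rightarrow>\<^sub>M N"
proof -
  have "sets (ucomp (P z)) = sets (P z)" by (simp only: sets_ucomp_P sets_P)
  then have "ucomp (P z) \<rightarrow>\<^sub>M N = P z \<rightarrow>\<^sub>M N" by (rule measurable_cong_sets) (rule refl)
  then show ?thesis by (rule arg_cong)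
qed

lemma Ft_sub: "0 \<le> t \<Longrightarrow> A \<in> Ft t \<Longrightarrow> A \<in> F"
  and Ft_sigma: "0 \<le> t \<Longrightarrow> sigma_algebra UNIV (Ft t)"
  using filtration by auto

lemma Ft_mono: "0 \<le> s \<Longrightarrow> s \<le> t \<Longrightarrow> Ft s \<subseteq> Ft t"
  using Ft_mono_all by blast

lemma Z_Ft: "0 \<le> t \<Longrightarrow> B \<in> sets borel \<Longrightarrow> Z t -` B \<in> Ft t"
  using Z_Ft_all by blast

lemma start: "AE \<omega> in P z. Z 0 \<omega> = z"
  by (rule start_all[rule_format])

lemma rcont_path [simp]: "rcont (path \<omega>)"
  using Z_rcont_all by (simp add: rcont_def path_def)

definition FtM :: "real \<Rightarrow> 'w measure" where "FtM t = sigma UNIV (Ft t)"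

lemma sets_FtM: "0 \<le> t \<Longrightarrow> sets (FtM t) = Ft t"
  unfolding FtM_def using sigma_algebra.sigma_sets_eq[OF Ft_sigma] by simp

lemma space_FtM [simp]: "space (FtM t) = UNIV"
  by (simp add: FtM_def space_measure_of_conv)

lemma Z_measurable: "0 \<le> t \<Longrightarrow> Z t \<in> P z \<rightarrow>\<^sub>M borel"
  using Z_Ft Ft_sub by (auto simp: measurable_def sets_P)

lemma Z_measurable_ucomp: "0 \<le> t \<Longrightarrow> Z t \<in> P z \<rightarrow>\<^sub>M ucomp borel"
  by (rule measurable_ucomp_P[THEN iffD1, OF measurable_ucomp_ucomp[OF Z_measurable]])

lemma Z_umeas: "0 \<le> t \<Longrightarrow> f \<in> borel_measurable (ucomp borel) \<Longrightarrow> (\<lambda>\<omega>. f (Z t \<omega>)) \<in> borel_measurable (P z)"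
  by (rule measurable_compose[OF Z_measurable_ucomp])

lemma path_measurable: "path \<in> P z \<rightarrow>\<^sub>M path_space"
  using measurable_path[of Z "P z"] Z_measurable rcont_path by (simp add: path_def[abs_def])

lemma path_umeas: "H \<in> borel_measurable (ucomp path_space) \<Longrightarrow> (\<lambda>\<omega>. H (path \<omega>)) \<in> borel_measurable (P z)"
  by (rule measurable_compose[OF measurable_ucomp_P[THEN iffD1, OF measurable_ucomp_ucomp[OF path_measurable]]])

lemma stopped_path_measurable: "0 \<le> t \<Longrightarrow> (\<lambda>\<omega>. stopped t (path \<omega>)) \<in> FtM t \<rightarrow>\<^sub>M path_space"
  unfolding stopped_def path_def
proof (rule measurable_path[of "\<lambda>s \<omega>. Z (min s t) \<omega>"])
  fix s :: real assume "0 \<le> t" "0 \<le> s"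
  then show "Z (min s t) \<in> FtM t \<rightarrow>\<^sub>M borel"
    using Z_Ft[of "min s t"] Ft_mono[of "min s t" t] by (auto simp: measurable_def sets_FtM)
next
  fix \<omega> assume "0 \<le> t"
  then show "rcont (\<lambda>s. Z (min s t) \<omega>)" using rcont_stopped[OF rcont_path, of t \<omega>] by (simp add: stopped_def path_def)
qed

text \<open>All laws share the sigma-algebra \<open>F\<close>, so the \<open>P z\<close> in the
  target is merely a representative of it.\<close>

lemma kernel: "P \<in> ucomp borel \<rightarrow>\<^sub>M subprob_algebra (P z)"
proof (rule measurable_subprob_algebra)
  fix A assume "A \<in> sets (P z)"
  then have "umeas_fun (\<lambda>z. measure (P z) A)" using kernel_all by (auto simp: sets_P)
  then have [measurable]: "(\<lambda>z. measure (P z) A) \<in> borel_measurable (ucomp borel)" by (simp add: umeas_fun_iff)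
  have "(\<lambda>z. ennreal (measure (P z) A)) \<in> borel_measurable (ucomp borel)" by measurable
  then show "(\<lambda>z. emeasure (P z) A) \<in> borel_measurable (ucomp borel)"
    by (simp add: finite_measure.emeasure_eq_measure[OF finite_P])
qed (auto simp: sets_P prob intro: prob_space_imp_subprob_space)

lemma nn_integral_P_umeas:
  "f \<in> borel_measurable (P z) \<Longrightarrow> (\<lambda>z. \<integral>\<^sup>+\<omega>. f \<omega> \<partial>P z) \<in> borel_measurable (ucomp borel)"
  by (rule measurable_compose[OF kernel nn_integral_measurable_subprob_algebra])

lemma markov_simple:
  "0 \<le> s \<Longrightarrow> 0 \<le> t \<Longrightarrow> A \<in> Ft t \<Longrightarrow> f \<in> borel_measurable (ucomp borel) \<Longrightarrow>
    (\<integral>\<^sup>+ \<omega>. indicator A \<omega> * f (Z (t + s) \<omega>) \<partial>P z)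
      = (\<integral>\<^sup>+ \<omega>. indicator A \<omega> * (\<integral>\<^sup>+ \<omega>'. f (Z s \<omega>') \<partial>P (Z t \<omega>)) \<partial>P z)"
  using markov_all unfolding umeas_fun_iff by blast

lemma cyl_path_sets: "cyl_ok l \<Longrightarrow> 0 \<le> t \<Longrightarrow> {\<omega>. cyl l (shift_path t (path \<omega>))} \<in> sets (P z)"
  using cyl_measurable[of Z "P z" l t] Z_measurable by (simp add: path_def shift_path_def)

text \<open>Induction on the number of constraints. The first constraint is absorbed into the past
  event, which then belongs to the later sigma-algebra, and the others become a function of the
  state at that time; the Markov property for one time then leads back to \<open>t\<close>.\<close>

lemma markov_cyl:
  assumes "cyl_ok l" "0 \<le> t" "A \<in> Ft t"
  shows "(\<integral>\<^sup>+ \<omega>. indicator A \<omega> * indicator {\<omega>. cyl l (shift_path t (path \<omega>))} \<omega> \<partial>P z)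
    = (\<integral>\<^sup>+ \<omega>. indicator A \<omega> * emeasure (P (Z t \<omega>)) {\<omega>. cyl l (path \<omega>)} \<partial>P z)"
  using assms
proof (induction l arbitrary: t A z)
  case Nil
  then show ?case using prob_space.emeasure_space_1[OF prob] by simp
next
  case (Cons a l)
  obtain s B where a: "a = (s, B)" by force
  have ok: "0 \<le> s" "B \<in> sets borel" "cyl_ok l" using Cons.prems a by (auto simp: cyl_ok_def)
  define f where "f z = indicator B z * emeasure (P z) {\<omega>. cyl l (path \<omega>)}" for z
  have f: "f \<in> borel_measurable (ucomp borel)"
  proof -
    have [measurable]: "B \<in> sets (ucomp borel)" using ok by (auto intro: sets_ucompI)
    have [measurable]: "(\<lambda>z. emeasure (P z) {\<omega>. cyl l (path \<omega>)}) \<in> borel_measurable (ucomp borel)"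
      by (rule measurable_emeasure_kernel[OF kernel[of undefined]]) (use cyl_path_sets[OF ok(3), of 0] in \<open>simp add: shift_path_def\<close>)
    show ?thesis unfolding f_def by measurable
  qed
  have one: "(\<integral>\<^sup>+ \<omega>. indicator A' \<omega> * indicator {\<omega>. cyl (a # l) (shift_path t' (path \<omega>))} \<omega> \<partial>P z')
      = (\<integral>\<^sup>+ \<omega>. indicator A' \<omega> * f (Z (t' + s) \<omega>) \<partial>P z')" if "A' \<in> Ft t'" "0 \<le> t'" for A' t' z'
  proof -
    have "A' \<inter> Z (t' + s) -` B \<in> Ft (t' + s)"
    proof -
      interpret sigma_algebra UNIV "Ft (t' + s)" using Ft_sigma ok that by simp
      show ?thesis using that ok Ft_mono[of t' "t' + s"] Z_Ft[of "t' + s" B] by auto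
    qed
    moreover have "(\<integral>\<^sup>+ \<omega>. indicator A' \<omega> * indicator {\<omega>. cyl (a # l) (shift_path t' (path \<omega>))} \<omega> \<partial>P z')
       = (\<integral>\<^sup>+ \<omega>. indicator (A' \<inter> Z (t' + s) -` B) \<omega> * indicator {\<omega>. cyl l (shift_path (t' + s) (path \<omega>))} \<omega> \<partial>P z')"
      by (intro nn_integral_cong) (auto simp: a indicator_def shift_path_def path_def add.assoc)
    ultimately show ?thesis
      using Cons.IH[of "t' + s" "A' \<inter> Z (t' + s) -` B" z'] ok that
      by (auto simp: f_def indicator_def intro!: nn_integral_cong)
  qed
  have sig: "sigma_algebra UNIV (Ft 0)" using Ft_sigma by simp
  \<comment> \<open>Applying \<open>one\<close> to the whole space at time 0 evaluates the
    continuation probability itself.\<close>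
  have "UNIV \<in> Ft 0" using sigma_algebra.sigma_sets_eq[OF sig] sigma_sets_top by metis
  then have "(\<integral>\<^sup>+ \<omega>'. f (Z s \<omega>') \<partial>P z') = emeasure (P z') {\<omega>. cyl (a # l) (path \<omega>)}" for z'
    using one[of UNIV 0 z'] cyl_path_sets[OF Cons.prems(1), of 0 z'] by (simp add: shift_path_def)
  then show ?case
    using one[OF Cons.prems(3,2)] markov_simple[OF ok(1) Cons.prems(2,3) f] by simp
qed

text \<open>Both sides integrate \<open>H\<close> against measures on path space: the law of the
  shifted path on the event \<open>A\<close>, and the mixture of the path laws started from
  \<open>Z t\<close>. These agree on cylinders and hence coincide.\<close>

lemma markov_path:
  assumes t: "0 \<le> t" and A: "A \<in> Ft t" and H: "H \<in> borel_measurable (ucomp path_space)"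
  shows "(\<integral>\<^sup>+ \<omega>. indicator A \<omega> * H (shift_path t (path \<omega>)) \<partial>P z)
    = (\<integral>\<^sup>+ \<omega>. indicator A \<omega> * (\<integral>\<^sup>+ \<omega>'. H (path \<omega>') \<partial>P (Z t \<omega>)) \<partial>P z)"
proof -
  define Q where "Q = density (P z) (indicator A)"
  have AF: "A \<in> sets (P z)" using Ft_sub[OF t A] sets_P by simp
  note AF [measurable]
  have sQ: "sets Q = sets (P z)" "space Q = UNIV" by (auto simp: Q_def)
  note sQ(1)[measurable_cong]
  have fQ: "finite_measure Q"
  proof (rule finite_measureI)
    have "UNIV \<in> sets (P z)" using sets.top[of "P z"] by simp
    then have "emeasure Q UNIV = emeasure (P z) A"
      using AF by (simp add: Q_def emeasure_density)
    then show "emeasure Q (space Q) \<noteq> \<infinity>"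
      using sQ(2) finite_measure.emeasure_finite[OF finite_P] by simp
  qed
  define \<kappa> where "\<kappa> z = distr (P z) path_space path" for z
  have pz: "path \<in> P z' \<rightarrow>\<^sub>M path_space" for z' by (rule path_measurable)
  have spth [measurable]: "(\<lambda>\<omega>. shift_path t (path \<omega>)) \<in> P z \<rightarrow>\<^sub>M path_space"
    by (rule measurable_compose[OF pz measurable_shift[OF t]])
  have "\<kappa> \<in> ucomp borel \<rightarrow>\<^sub>M subprob_algebra path_space"
    unfolding \<kappa>_def using kernel[of z] measurable_distr[OF pz[of z]] by (rule measurable_compose)
  then have "(\<lambda>\<omega>. \<kappa> (Z t \<omega>)) \<in> P z \<rightarrow>\<^sub>M subprob_algebra path_space"
    by (rule measurable_compose[OF Z_measurable_ucomp[OF t]])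
  then have \<kappa>Z: "(\<lambda>\<omega>. \<kappa> (Z t \<omega>)) \<in> Q \<rightarrow>\<^sub>M subprob_algebra path_space"
    unfolding measurable_cong_sets[OF sQ(1) refl] .
  define \<mu>1 where "\<mu>1 = distr Q path_space (\<lambda>\<omega>. shift_path t (path \<omega>))"
  define \<mu>2 where "\<mu>2 = bind Q (\<lambda>\<omega>. \<kappa> (Z t \<omega>))"
  have s2: "sets \<mu>2 = sets path_space" unfolding \<mu>2_def
    by (rule sets_bind[OF sets_kernel[OF \<kappa>Z]]) (auto simp: sQ)
  have cyl_sets: "{p. rcont p \<and> cyl l p} \<in> sets path_space" if "cyl_ok l" for l :: "(real \<times> 's set) list"
    using that unfolding sets_path_space by (intro sigma_sets.Basic) (auto simp: cyls_def)
  have f1: "finite_measure \<mu>1" unfolding \<mu>1_def by (rule finite_measure.finite_measure_distr[OF fQ]) measurable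
  have em1: "emeasure \<mu>1 B = (\<integral>\<^sup>+ \<omega>. indicator A \<omega> * indicator B (shift_path t (path \<omega>)) \<partial>P z)"
    if [measurable]: "B \<in> sets path_space" for B
  proof -
    have "emeasure \<mu>1 B = (\<integral>\<^sup>+ p. indicator B p \<partial>\<mu>1)" by (simp add: \<mu>1_def)
    also have "\<dots> = (\<integral>\<^sup>+ \<omega>. indicator B (shift_path t (path \<omega>)) \<partial>Q)" unfolding \<mu>1_def by (rule nn_integral_distr) measurable
    also have "\<dots> = (\<integral>\<^sup>+ \<omega>. indicator A \<omega> * indicator B (shift_path t (path \<omega>)) \<partial>P z)" unfolding Q_def by (rule nn_integral_density) measurable
    finally show ?thesis .
  qed
  have ek: "emeasure (\<kappa> z') B = emeasure (P z') {\<omega>. path \<omega> \<in> B}" if "B \<in> sets path_space" for B z'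
    unfolding \<kappa>_def by (subst emeasure_distr[OF pz that]) (simp add: vimage_def)
  have kmeas: "(\<lambda>\<omega>. emeasure (\<kappa> (Z t \<omega>)) B) \<in> borel_measurable (P z)" if "B \<in> sets path_space" for B
    using measurable_emeasure_kernel[OF \<kappa>Z that] measurable_cong_sets[OF sQ(1) refl] by blast
  have em2: "emeasure \<mu>2 B = (\<integral>\<^sup>+ \<omega>. indicator A \<omega> * emeasure (\<kappa> (Z t \<omega>)) B \<partial>P z)"
    if B: "B \<in> sets path_space" for B
    unfolding \<mu>2_def
    by (subst emeasure_bind[OF _ \<kappa>Z B]) (auto simp: sQ, simp add: Q_def nn_integral_density kmeas[OF B])
  have f2: "finite_measure \<mu>2"
  proof (rule finite_measureI)
    have "(\<integral>\<^sup>+ \<omega>. indicator A \<omega> * emeasure (\<kappa> (Z t \<omega>)) (space path_space) \<partial>P z) \<le> (\<integral>\<^sup>+ \<omega>. 1 \<partial>P z)"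
    proof (rule nn_integral_mono)
      fix \<omega>
      have "emeasure (\<kappa> (Z t \<omega>)) (space path_space) \<le> 1"
        unfolding ek[OF sets.top] by (rule prob_space.emeasure_le_1[OF prob])
      then show "indicator A \<omega> * emeasure (\<kappa> (Z t \<omega>)) (space path_space) \<le> 1" by (simp add: indicator_def)
    qed
    also have "\<dots> < \<infinity>" using finite_measure.emeasure_finite[OF finite_P] by (simp add: less_top)
    finally show "emeasure \<mu>2 (space \<mu>2) \<noteq> \<infinity>"
      unfolding sets_eq_imp_space_eq[OF s2] em2[OF sets.top] by simp
  qed
  have \<mu>: "\<mu>1 = \<mu>2"
  proof (rule path_space_eqI[OF f1 f2])
    fix l :: "(real \<times> 's set) list" assume l: "cyl_ok l"
    have "emeasure \<mu>1 {p. rcont p \<and> cyl l p} = (\<integral>\<^sup>+ \<omega>. indicator A \<omega> * indicator {\<omega>. cyl l (shift_path t (path \<omega>))} \<omega> \<partial>P z)"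
      unfolding em1[OF cyl_sets[OF l]] using rcont_shift[OF rcont_path t] by (intro nn_integral_cong) (auto simp: indicator_def)
    also have "\<dots> = emeasure \<mu>2 {p. rcont p \<and> cyl l p}"
      unfolding em2[OF cyl_sets[OF l]] markov_cyl[OF l t A] by (simp add: ek[OF cyl_sets[OF l]])
    finally show "emeasure \<mu>1 {p. rcont p \<and> cyl l p} = emeasure \<mu>2 {p. rcont p \<and> cyl l p}" .
  qed (simp_all add: \<mu>1_def s2)
  \<comment> \<open>The version \<open>H'\<close> is chosen for the mixture but is used under single
    starting points. Its exceptional set has mixture mass 0, so it is null under the law started at
    \<open>Z t \<omega>\<close> for almost every \<omega> in \<open>A\<close>.\<close>
  obtain H' where H': "H' \<in> borel_measurable path_space" "AE p in \<mu>2. H p = H' p"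
    using ucomp_AE_eq[OF H f2 s2] by blast
  obtain D where D: "D \<in> null_sets \<mu>2" "{p\<in>space \<mu>2. H p \<noteq> H' p} \<subseteq> D"
    using H'(2) by (auto elim!: AE_E simp: null_sets_def)
  have Ds: "D \<in> sets path_space" using D(1) s2 by (auto simp: null_sets_def)
  have "(\<integral>\<^sup>+ \<omega>. indicator A \<omega> * emeasure (\<kappa> (Z t \<omega>)) D \<partial>P z) = 0"
    using D(1) em2[OF Ds] by (auto simp: null_sets_def)
  then have "AE \<omega> in P z. indicator A \<omega> * emeasure (\<kappa> (Z t \<omega>)) D = 0"
    by (subst (asm) nn_integral_0_iff_AE) (use kmeas[OF Ds] in auto)
  moreover have "indicator A \<omega> * (\<integral>\<^sup>+p. H p \<partial>\<kappa> (Z t \<omega>)) = indicator A \<omega> * (\<integral>\<^sup>+p. H' p \<partial>\<kappa> (Z t \<omega>))"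
    if "indicator A \<omega> * emeasure (\<kappa> (Z t \<omega>)) D = 0" for \<omega>
  proof (cases "\<omega> \<in> A")
    case True
    then have "D \<in> null_sets (\<kappa> (Z t \<omega>))" using that Ds by (auto simp: null_sets_def \<kappa>_def)
    then have "AE p in \<kappa> (Z t \<omega>). H p = H' p"
      by (rule AE_I') (use D(2) sets_eq_imp_space_eq[OF s2] in \<open>auto simp: \<kappa>_def\<close>)
    then show ?thesis using nn_integral_cong_AE by metis
  qed simp
  ultimately have AE: "AE \<omega> in P z. indicator A \<omega> * (\<integral>\<^sup>+p. H p \<partial>\<kappa> (Z t \<omega>)) = indicator A \<omega> * (\<integral>\<^sup>+p. H' p \<partial>\<kappa> (Z t \<omega>))"
    by auto
  have kH: "(\<integral>\<^sup>+p. H p \<partial>\<kappa> z') = (\<integral>\<^sup>+ \<omega>'. H (path \<omega>') \<partial>P z')" for z'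
    unfolding \<kappa>_def by (rule nn_integral_ucomp_eq[OF H pz finite_P, symmetric])
  have "(\<integral>\<^sup>+ \<omega>. indicator A \<omega> * H (shift_path t (path \<omega>)) \<partial>P z) = (\<integral>\<^sup>+ \<omega>. H (shift_path t (path \<omega>)) \<partial>Q)"
    unfolding Q_def
  proof (rule nn_integral_density[symmetric])
    have "(\<lambda>p. H (shift_path t p)) \<in> borel_measurable (ucomp path_space)"
      by (rule measurable_compose[OF measurable_ucomp_ucomp[OF measurable_shift[OF t]] H])
    then show "(\<lambda>\<omega>. H (shift_path t (path \<omega>))) \<in> borel_measurable (P z)" by (rule path_umeas)
  qed measurable
  also have "\<dots> = (\<integral>\<^sup>+ p. H p \<partial>\<mu>1)"
    unfolding \<mu>1_def by (rule nn_integral_ucomp_eq[OF H _ fQ]) measurable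
  also have "\<dots> = (\<integral>\<^sup>+ p. H' p \<partial>\<mu>2)" unfolding \<mu> by (rule nn_integral_cong_AE) fact
  also have "\<dots> = (\<integral>\<^sup>+ \<omega>. (\<integral>\<^sup>+p. H' p \<partial>\<kappa> (Z t \<omega>)) \<partial>Q)"
    unfolding \<mu>2_def by (rule nn_integral_bind[OF H'(1) \<kappa>Z])
  also have "\<dots> = (\<integral>\<^sup>+ \<omega>. indicator A \<omega> * (\<integral>\<^sup>+p. H' p \<partial>\<kappa> (Z t \<omega>)) \<partial>P z)"
    unfolding Q_def
  proof (rule nn_integral_density)
    have "(\<lambda>\<omega>. \<integral>\<^sup>+p. H' p \<partial>\<kappa> (Z t \<omega>)) \<in> borel_measurable Q"
      by (rule measurable_compose[OF \<kappa>Z nn_integral_measurable_subprob_algebra[OF H'(1)]])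
    then show "(\<lambda>\<omega>. \<integral>\<^sup>+p. H' p \<partial>\<kappa> (Z t \<omega>)) \<in> borel_measurable (P z)"
      using measurable_cong_sets[OF sQ(1) refl] by blast
  qed measurable
  also have "\<dots> = (\<integral>\<^sup>+ \<omega>. indicator A \<omega> * (\<integral>\<^sup>+p. H p \<partial>\<kappa> (Z t \<omega>)) \<partial>P z)"
    by (rule nn_integral_cong_AE) (use AE in auto)
  finally show ?thesis unfolding kH .
qed

text \<open>A universally measurable factor of the stopped path need only be universally measurable
  over \<open>Ft t\<close>; it is replaced by an \<open>Ft t\<close>-measurable version for the law
  at hand.\<close>

lemma markov_functional:
  assumes t: "0 \<le> t" and G: "G \<in> borel_measurable (ucomp path_space)"
    and H: "H \<in> borel_measurable (ucomp path_space)"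
  shows "(\<integral>\<^sup>+ \<omega>. G (stopped t (path \<omega>)) * H (shift_path t (path \<omega>)) \<partial>P z)
    = (\<integral>\<^sup>+ \<omega>. G (stopped t (path \<omega>)) * (\<integral>\<^sup>+ \<omega>'. H (path \<omega>') \<partial>P (Z t \<omega>)) \<partial>P z)"
proof -
  have sub: "sets (FtM t) \<subseteq> sets (P z)" using Ft_sub[OF t] by (auto simp: sets_FtM[OF t] sets_P)
  have id: "(\<lambda>\<omega>. \<omega>) \<in> P z \<rightarrow>\<^sub>M FtM t" using sub by (auto simp: measurable_def)
  have "(\<lambda>\<omega>. G (stopped t (path \<omega>))) \<in> borel_measurable (ucomp (FtM t))"
    by (rule measurable_compose[OF measurable_ucomp_ucomp[OF stopped_path_measurable[OF t]] G])
  moreover have "finite_measure (distr (P z) (FtM t) (\<lambda>\<omega>. \<omega>))"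
    by (rule finite_measure.finite_measure_distr[OF finite_P id])
  ultimately obtain G' where G': "G' \<in> borel_measurable (FtM t)"
    "AE \<omega> in distr (P z) (FtM t) (\<lambda>\<omega>. \<omega>). G (stopped t (path \<omega>)) = G' \<omega>"
    using ucomp_AE_eq[of _ "FtM t" "distr (P z) (FtM t) (\<lambda>\<omega>. \<omega>)"] by auto
  obtain D where D: "D \<in> null_sets (distr (P z) (FtM t) (\<lambda>\<omega>. \<omega>))" "{\<omega>. G (stopped t (path \<omega>)) \<noteq> G' \<omega>} \<subseteq> D"
    using G'(2) by (auto elim!: AE_E simp: null_sets_def)
  have "D \<in> null_sets (P z)" using D(1) null_sets_distr_iff[OF id] by auto
  then have AE: "AE \<omega> in P z. G (stopped t (path \<omega>)) = G' \<omega>" by (rule AE_I') (use D in auto)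
  have "(\<integral>\<^sup>+ \<omega>. G' \<omega> * H (shift_path t (path \<omega>)) \<partial>P z)
    = (\<integral>\<^sup>+ \<omega>. G' \<omega> * (\<integral>\<^sup>+ \<omega>'. H (path \<omega>') \<partial>P (Z t \<omega>)) \<partial>P z)"
  proof (rule nn_integral_subalgebra_eq[OF sub _ _ _ _ G'(1)])
    have "(\<lambda>p. H (shift_path t p)) \<in> borel_measurable (ucomp path_space)"
      by (rule measurable_compose[OF measurable_ucomp_ucomp[OF measurable_shift[OF t]] H])
    then show "(\<lambda>\<omega>. H (shift_path t (path \<omega>))) \<in> borel_measurable (P z)" by (rule path_umeas)
    show "(\<lambda>\<omega>. \<integral>\<^sup>+ \<omega>'. H (path \<omega>') \<partial>P (Z t \<omega>)) \<in> borel_measurable (P z)"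
      by (rule Z_umeas[OF t nn_integral_P_umeas[OF path_umeas[OF H]]])
  qed (auto simp: sets_FtM[OF t] intro: markov_path[OF t _ H])
  moreover have "(\<integral>\<^sup>+ \<omega>. G (stopped t (path \<omega>)) * K \<omega> \<partial>P z) = (\<integral>\<^sup>+ \<omega>. G' \<omega> * K \<omega> \<partial>P z)" for K
    by (rule nn_integral_cong_AE) (use AE in auto)
  ultimately show ?thesis by simp
qed

end

section \<open>Translation invariance of the path laws\<close>

locale additive_process = markov_process F Ft Z \<theta> P
  for F :: "'w set set" and Ft and Z :: "real \<Rightarrow> 'w \<Rightarrow> real \<times> 'e::topological_space" and \<theta> P +
  assumes homog: "\<And>(f :: real \<times> 'e \<Rightarrow> ennreal) t x y. f \<in> borel_measurable borel \<Longrightarrow> 0 \<le> t \<Longrightarrow>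
        (\<integral>\<^sup>+ \<omega>. f (Z t \<omega>) \<partial>P (x, y)) = (\<integral>\<^sup>+ \<omega>. f (x + fst (Z t \<omega>), snd (Z t \<omega>)) \<partial>P (0, y))"
begin

lemma homog_umeas:
  fixes f :: "real \<times> 'e \<Rightarrow> ennreal"
  assumes f: "f \<in> borel_measurable (ucomp borel)" and t: "0 \<le> t"
  shows "(\<integral>\<^sup>+ \<omega>. f (Z t \<omega>) \<partial>P (c + x, y)) = (\<integral>\<^sup>+ \<omega>. f (c + fst (Z t \<omega>), snd (Z t \<omega>)) \<partial>P (x, y))"
proof -
  note Zm = Z_measurable[OF t]
  have Zc: "(\<lambda>\<omega>. (c + fst (Z t \<omega>), snd (Z t \<omega>))) \<in> P z \<rightarrow>\<^sub>M borel" for z c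
    by (rule measurable_compose[OF Zm transl_borel])
  have "distr (P (c + x, y)) borel (Z t) = distr (P (x, y)) borel (\<lambda>\<omega>. (c + fst (Z t \<omega>), snd (Z t \<omega>)))"
  proof (rule measure_eqI)
    fix B :: "(real \<times> 'e) set" assume "B \<in> sets (distr (P (c + x, y)) borel (Z t))"
    then have B [measurable]: "B \<in> sets borel" by simp
    have B': "(\<lambda>z. indicator B (c + fst z, snd z) :: ennreal) \<in> borel_measurable borel"
      by (rule measurable_compose[OF transl_borel]) measurable
    have "(\<integral>\<^sup>+ \<omega>. indicator B (Z t \<omega>) \<partial>P (c + x, y)) = (\<integral>\<^sup>+ \<omega>. indicator B (c + x + fst (Z t \<omega>), snd (Z t \<omega>)) \<partial>P (0, y))"
      by (rule homog[OF _ t]) measurable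
    also have "\<dots> = (\<integral>\<^sup>+ \<omega>. indicator B (c + fst (Z t \<omega>), snd (Z t \<omega>)) \<partial>P (x, y))"
      using homog[OF B' t, of x y] by (simp add: add.assoc)
    finally show "emeasure (distr (P (c + x, y)) borel (Z t)) B
        = emeasure (distr (P (x, y)) borel (\<lambda>\<omega>. (c + fst (Z t \<omega>), snd (Z t \<omega>)))) B"
      using nn_integral_distr[OF Zm, of "indicator B" "(c + x, y)"] nn_integral_distr[OF Zc, of "indicator B" "(x,y)" c]
      by simp
  qed simp
  then show ?thesis
    using nn_integral_ucomp_eq[OF f Zm finite_P] nn_integral_ucomp_eq[OF f Zc finite_P] by simp
qed

text \<open>Invariance is assumed at single times only. The Markov property at the first time is
  applied on both sides, and the induction hypothesis identifies the continuation from a raised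
  state with the raised continuation. The intermediate function is a kernel integral, hence the need
  for universally measurable \<open>f\<close> in \<open>homog_umeas\<close>.\<close>

lemma transl_cyl:
  assumes "cyl_ok l"
  shows "emeasure (P (c + x, y)) {\<omega>. cyl l (path \<omega>)} = emeasure (P (x, y)) {\<omega>. cyl l (transl c (path \<omega>))}"
  using assms
proof (induction l arbitrary: x y)
  case Nil
  then show ?case using prob_space.emeasure_space_1[OF prob] by simp
next
  case (Cons a l)
  obtain s B where a: "a = (s, B)" by force
  have ok: "0 \<le> s" "B \<in> sets borel" "cyl_ok l" using Cons.prems a by (auto simp: cyl_ok_def)
  define H where "H p = (indicator {p. cyl l p} p :: ennreal)" for p
  have Hcyl: "{p. rcont p \<and> cyl l p} \<in> sets path_space"
    using ok unfolding sets_path_space by (intro sigma_sets.Basic) (auto simp: cyls_def)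
  have H: "H \<in> borel_measurable (ucomp path_space)"
    by (rule measurable_ucompI, rule measurable_cong[THEN iffD1, OF _ borel_measurable_indicator[OF Hcyl]])
       (auto simp: H_def indicator_def)
  have HT: "(\<lambda>p. H (transl c p)) \<in> borel_measurable (ucomp path_space)"
    by (rule measurable_compose[OF measurable_ucomp_ucomp[OF measurable_transl] H])
  define f where "f z = indicator B z * (\<integral>\<^sup>+ \<omega>. H (path \<omega>) \<partial>P z)" for z
  have f: "f \<in> borel_measurable (ucomp borel)"
  proof -
    have [measurable]: "B \<in> sets (ucomp borel)" using ok by (auto intro: sets_ucompI)
    note nn_integral_P_umeas[OF path_umeas[OF H], measurable]
    show ?thesis unfolding f_def by measurable
  qed
  have int: "(\<integral>\<^sup>+ \<omega>. H' (path \<omega>) \<partial>P z) = emeasure (P z) {\<omega>. Q (path \<omega>)}"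
    if "H' \<in> borel_measurable (ucomp path_space)" "\<And>p. H' p = indicator {p. Q p} p" for H' Q z
  proof -
    have "(\<lambda>\<omega>. H' (path \<omega>)) -` {1} \<inter> space (P z) \<in> sets (P z)"
      by (rule measurable_sets[OF path_umeas[OF that(1)]]) simp
    then have "{\<omega>. Q (path \<omega>)} \<in> sets (P z)"
      by (rule back_subst[where P="\<lambda>A. A \<in> sets (P z)"]) (auto simp: that(2) indicator_def)
    then have "emeasure (P z) {\<omega>. Q (path \<omega>)} = (\<integral>\<^sup>+ \<omega>. indicator {\<omega>. Q (path \<omega>)} \<omega> \<partial>P z)" by simp
    then show ?thesis by (simp add: that(2) indicator_def)
  qed
  have IH: "(\<integral>\<^sup>+ \<omega>. H (path \<omega>) \<partial>P (c + fst z, snd z)) = (\<integral>\<^sup>+ \<omega>. H (transl c (path \<omega>)) \<partial>P z)" for z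
    using Cons.IH[OF ok(3), of "fst z" "snd z"] int[OF H, of "cyl l"] int[OF HT, of "\<lambda>p. cyl l (transl c p)"]
    by (simp add: H_def indicator_def)
  have Bc: "Z s -` ((\<lambda>z. (c + fst z, snd z)) -` B) \<in> Ft s"
    using Z_Ft[OF ok(1)] measurable_sets[OF transl_borel ok(2)] by simp
  have sig: "sigma_algebra UNIV (Ft s)" using Ft_sigma ok by simp
  have Bs: "Z s -` B \<in> Ft s" using Z_Ft ok by simp
  have "emeasure (P (c + x, y)) {\<omega>. cyl (a # l) (path \<omega>)} = (\<integral>\<^sup>+ \<omega>. indicator (Z s -` B) \<omega> * H (shift_path s (path \<omega>)) \<partial>P (c + x, y))"
  proof -
    have "emeasure (P (c + x, y)) {\<omega>. cyl (a # l) (path \<omega>)} = (\<integral>\<^sup>+ \<omega>. indicator {\<omega>. cyl (a # l) (path \<omega>)} \<omega> \<partial>P (c + x, y))"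
      using cyl_path_sets[OF Cons.prems, of 0] by (simp add: shift_path_def)
    also have "\<dots> = (\<integral>\<^sup>+ \<omega>. indicator (Z s -` B) \<omega> * H (shift_path s (path \<omega>)) \<partial>P (c + x, y))"
      by (intro nn_integral_cong) (auto simp: a H_def indicator_def path_def)
    finally show ?thesis .
  qed
  also have "\<dots> = (\<integral>\<^sup>+ \<omega>. f (Z s \<omega>) \<partial>P (c + x, y))"
    unfolding markov_path[OF ok(1) Bs H] by (simp add: f_def indicator_def)
  also have "\<dots> = (\<integral>\<^sup>+ \<omega>. f (c + fst (Z s \<omega>), snd (Z s \<omega>)) \<partial>P (x, y))" by (rule homog_umeas[OF f ok(1)])
  also have "\<dots> = (\<integral>\<^sup>+ \<omega>. indicator (Z s -` ((\<lambda>z. (c + fst z, snd z)) -` B)) \<omega> * (\<integral>\<^sup>+ \<omega>'. H (transl c (path \<omega>')) \<partial>P (Z s \<omega>)) \<partial>P (x, y))"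
    unfolding f_def IH by (auto simp: indicator_def intro!: nn_integral_cong)
  also have "\<dots> = (\<integral>\<^sup>+ \<omega>. indicator (Z s -` ((\<lambda>z. (c + fst z, snd z)) -` B)) \<omega> * H (transl c (shift_path s (path \<omega>))) \<partial>P (x, y))"
    using markov_path[OF ok(1) Bc HT] by simp
  also have "\<dots> = (\<integral>\<^sup>+ \<omega>. indicator {\<omega>. cyl (a # l) (transl c (path \<omega>))} \<omega> \<partial>P (x, y))"
    by (intro nn_integral_cong) (auto simp: a H_def indicator_def transl_def path_def shift_path_def)
  also have "\<dots> = emeasure (P (x, y)) {\<omega>. cyl (a # l) (transl c (path \<omega>))}"
  proof (rule nn_integral_indicator)
    have "{p. rcont p \<and> cyl (a # l) p} \<in> sets path_space"
      using Cons.prems unfolding sets_path_space by (intro sigma_sets.Basic) (auto simp: cyls_def)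
    then have "(\<lambda>\<omega>. transl c (path \<omega>)) -` {p. rcont p \<and> cyl (a # l) p} \<inter> space (P (x, y)) \<in> sets (P (x, y))"
      by (rule measurable_sets[OF measurable_compose[OF path_measurable measurable_transl]])
    then show "{\<omega>. cyl (a # l) (transl c (path \<omega>))} \<in> sets (P (x, y))"
      by (rule back_subst[where P="\<lambda>A. A \<in> sets (P (x, y))"]) (auto simp: rcont_transl)
  qed
  finally show ?case .
qed

lemma translation:
  assumes H: "H \<in> borel_measurable (ucomp path_space)"
  shows "(\<integral>\<^sup>+ \<omega>. H (path \<omega>) \<partial>P (c + x, y)) = (\<integral>\<^sup>+ \<omega>. H (transl c (path \<omega>)) \<partial>P (x, y))"
proof -
  have T: "(\<lambda>\<omega>. transl c (path \<omega>)) \<in> P (x, y) \<rightarrow>\<^sub>M path_space"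
    by (rule measurable_compose[OF path_measurable measurable_transl])
  have "distr (P (c + x, y)) path_space path = distr (P (x, y)) path_space (\<lambda>\<omega>. transl c (path \<omega>))"
  proof (rule path_space_eqI)
    fix l :: "(real \<times> (real \<times> 'e) set) list" assume l: "cyl_ok l"
    have B: "{p. rcont p \<and> cyl l p} \<in> sets path_space"
      using l unfolding sets_path_space by (intro sigma_sets.Basic) (auto simp: cyls_def)
    show "emeasure (distr (P (c + x, y)) path_space path) {p. rcont p \<and> cyl l p} =
        emeasure (distr (P (x, y)) path_space (\<lambda>\<omega>. transl c (path \<omega>))) {p. rcont p \<and> cyl l p}"
      using transl_cyl[OF l, of c x y]
      by (simp add: emeasure_distr[OF path_measurable B] emeasure_distr[OF T B] vimage_def rcont_transl)
  qed (auto intro!: finite_measure.finite_measure_distr finite_P path_measurable T)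
  then show ?thesis
    using nn_integral_ucomp_eq[OF H path_measurable finite_P] nn_integral_ucomp_eq[OF H T finite_P] by simp
qed

end

section \<open>Shifts of the payoff\<close>


text \<open>The summand \<open>c\<close> serves plain lower bounds, with \<open>c = 0\<close>, as
  well as times restarted at a later moment; for empty \<open>S\<close> the right side is
  infinite.\<close>

lemma le_add_InfI:
  fixes a c :: ennreal
  assumes "\<And>x. x \<in> S \<Longrightarrow> a \<le> c + x"
  shows "a \<le> c + Inf S"
proof (rule ennreal_le_epsilon)
  fix e :: real assume top: "c + Inf S < top" and e: "0 < e"
  have "Inf S < Inf S + ennreal e"
    using top e by (cases "Inf S") (auto simp flip: ennreal_plus intro!: ennreal_lessI)
  then obtain x where x: "x \<in> S" "x < Inf S + ennreal e" using Inf_less_iff by blast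
  have "a \<le> c + x" using assms x by auto
  also have "\<dots> \<le> c + Inf S + ennreal e" using x(2) by (simp add: add.assoc add_left_mono less_imp_le)
  finally show "a \<le> c + Inf S + ennreal e" .
qed

lemma exp_neg_add: "exp_neg (a + b) = exp_neg a * exp_neg b"
  by (cases a; cases b)
     (auto simp: exp_neg_def enn2real_plus mult_exp_exp simp flip: ennreal_plus ennreal_mult)

lemma exp_neg_mono: "a \<le> b \<Longrightarrow> exp_neg b \<le> exp_neg a"
  by (cases a; cases b) (auto simp: exp_neg_def top_unique intro!: ennreal_leI)

lemma exp_neg_le_1: "exp_neg a \<le> 1"
  by (cases a) (auto simp: exp_neg_def)

lemma exp_neg_ennreal: "0 \<le> x \<Longrightarrow> exp_neg (ennreal x) = ennreal (exp (- x))"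
  by (simp add: exp_neg_def)

section \<open>Passage times under shift, stopping and translation\<close>

lemma tau_cases:
  fixes p :: "real \<Rightarrow> real \<times> 'e"
  assumes "\<And>s. 0 \<le> s \<Longrightarrow> (if k then 0 < s \<and> fst (p s) < 0 else fst (p s) \<le> 0) \<Longrightarrow> a \<le> c + ennreal s"
  shows "a \<le> c + tau k p"
proof (cases k)
  case True
  then show ?thesis unfolding tau_def tau_minus_def using assms by (auto intro!: le_add_InfI)
next
  case False
  then show ?thesis unfolding tau_def tau_minus_plus_def using assms by (auto intro!: le_add_InfI)
qed

lemma tau_lower:
  "0 \<le> s \<Longrightarrow> (if k then 0 < s \<and> fst (p s) < 0 else fst (p s) \<le> 0) \<Longrightarrow> tau k p \<le> ennreal s"
  by (cases k) (auto simp: tau_def tau_minus_def tau_minus_plus_def intro!: Inf_lower)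

text \<open>The time \<open>tau_minus\<close> does not read time 0; a negative value there counts
  because right-continuity keeps the path negative just afterwards.\<close>

lemma tau_True_le:
  fixes p :: "real \<Rightarrow> real \<times> 'e::topological_space"
  assumes "rcont p" "0 \<le> t" "fst (p t) < 0"
  shows "tau True p \<le> ennreal t"
proof (rule ennreal_le_epsilon)
  fix e :: real assume e: "0 < e"
  have "ennreal t < ennreal (t + e)" using assms(2) e by (intro ennreal_lessI) auto
  then obtain u where "t < u" "ennreal u < ennreal (t + e)" "fst (p u) < 0"
    using right_rational[OF rcont_fst[OF assms(1,2)] assms(3) _ assms(2)] by blast
  then have "tau True p \<le> ennreal u" using assms(2) by (intro tau_lower) auto
  also have "\<dots> \<le> ennreal t + ennreal e" using \<open>ennreal u < _\<close> assms(2) e by (simp add: less_imp_le)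
  finally show "tau True p \<le> ennreal t + ennreal e" .
qed

lemma le_tau_iff:
  assumes "0 \<le> t"
  shows "ennreal t \<le> tau k p \<longleftrightarrow> (\<forall>s\<ge>0. s < t \<longrightarrow> \<not> (if k then 0 < s \<and> fst (p s) < 0 else fst (p s) \<le> 0))"
proof (intro iffI allI impI notI)
  fix s assume "ennreal t \<le> tau k p" "0 \<le> s" "s < t" "if k then 0 < s \<and> fst (p s) < 0 else fst (p s) \<le> 0"
  then have "ennreal t \<le> ennreal s" using tau_lower order_trans by blast
  then show False using \<open>0 \<le> s\<close> \<open>s < t\<close> by simp
next
  assume *: "\<forall>s\<ge>0. s < t \<longrightarrow> \<not> (if k then 0 < s \<and> fst (p s) < 0 else fst (p s) \<le> 0)"
  have "ennreal t \<le> 0 + tau k p"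
  proof (rule tau_cases)
    fix s assume "0 \<le> s" "if k then 0 < s \<and> fst (p s) < 0 else fst (p s) \<le> 0"
    then have "t \<le> s" using * by (meson not_le)
    then show "ennreal t \<le> 0 + ennreal s" by (simp add: ennreal_leI)
  qed
  then show "ennreal t \<le> tau k p" by simp
qed

text \<open>Only times strictly below \<open>t\<close> matter, and stopping at \<open>t\<close>
  leaves them unchanged. The non-strict inequality thus makes survival a property of the stopped
  path.\<close>

lemma le_tau_stopped: "0 \<le> t \<Longrightarrow> ennreal t \<le> tau k (stopped t p) \<longleftrightarrow> ennreal t \<le> tau k p"
  by (simp add: le_tau_iff stopped_def)

lemma tau_shift:
  fixes p :: "real \<Rightarrow> real \<times> 'e::topological_space"
  assumes p: "rcont p" and t: "0 \<le> t" and le: "ennreal t \<le> tau k p"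
  shows "tau k p = ennreal t + tau k (shift_path t p)"
proof (rule antisym)
  show "tau k p \<le> ennreal t + tau k (shift_path t p)"
  proof (rule tau_cases)
    fix s assume s: "0 \<le> s" "if k then 0 < s \<and> fst (shift_path t p s) < 0 else fst (shift_path t p s) \<le> 0"
    then have "tau k p \<le> ennreal (t + s)" using t by (intro tau_lower) (auto simp: shift_path_def split: if_splits)
    then show "tau k p \<le> ennreal t + ennreal s" using t s by simp
  qed
  have "ennreal t + tau k (shift_path t p) \<le> 0 + tau k p"
  proof (rule tau_cases)
    fix s assume s: "0 \<le> s" "if k then 0 < s \<and> fst (p s) < 0 else fst (p s) \<le> 0"
    then have "t \<le> s" using le t unfolding le_tau_iff[OF t] by (meson not_le)
    \<comment> \<open>A negative value exactly at \<open>t\<close> moves to time 0 of the shifted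
      path, which \<open>tau True\<close> does not read; right-continuity covers this case.\<close>
    have "tau k (shift_path t p) \<le> ennreal (s - t)"
    proof (cases "k \<and> s = t")
      case True
      then have "tau True (shift_path t p) \<le> ennreal 0"
        using s by (intro tau_True_le rcont_shift p t) (auto simp: shift_path_def)
      then show ?thesis using True by simp
    next
      case False
      then show ?thesis using \<open>t \<le> s\<close> s by (intro tau_lower) (auto simp: shift_path_def split: if_splits)
    qed
    then have "ennreal t + tau k (shift_path t p) \<le> ennreal t + ennreal (s - t)" by (rule add_left_mono)
    also have "\<dots> = 0 + ennreal s" using \<open>t \<le> s\<close> t by (simp flip: ennreal_plus)
    finally show "ennreal t + tau k (shift_path t p) \<le> 0 + ennreal s" .
  qed
  then show "ennreal t + tau k (shift_path t p) \<le> tau k p" by simp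
qed

text \<open>A raised path is ruined no earlier. A positive rise also turns a non-strict inequality
  into a strict one, so the two kinds of passage time become comparable with each other.\<close>

lemma tau_transl_mono:
  fixes p :: "real \<Rightarrow> real \<times> 'e::topological_space"
  assumes p: "rcont p" and d: "0 \<le> d" "0 < d \<or> k = l"
  shows "tau l (transl c p) \<le> tau k (transl (c + d) p)"
proof -
  have "tau l (transl c p) \<le> 0 + tau k (transl (c + d) p)"
  proof (rule tau_cases)
    fix s assume s: "0 \<le> s" "if k then 0 < s \<and> fst (transl (c + d) p s) < 0 else fst (transl (c + d) p s) \<le> 0"
    have "tau l (transl c p) \<le> ennreal s"
    proof (cases "l \<and> \<not> k")
      case True
      then have "fst (transl c p s) < 0" using s d by (auto simp: transl_def)
      then show ?thesis using True tau_True_le[OF rcont_transl[OF p] s(1)] by simp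
    next
      case False
      then show ?thesis using s d by (intro tau_lower) (auto simp: transl_def split: if_splits)
    qed
    then show "tau l (transl c p) \<le> 0 + ennreal s" by simp
  qed
  then show ?thesis by simp
qed

section \<open>Arrivals after prepending a waiting time\<close>

lemma arr_time_Cons: "arr_time (t ## rs) (Suc k) = t + arr_time rs k"
  by (simp add: arr_time_def lessThan_Suc_eq_insert_0 sum.reindex)

lemma arr_time_0 [simp]: "arr_time rs 0 = 0"
  by (simp add: arr_time_def)

lemma arr_time_pos: "(\<And>n. 0 < rs !! n) \<Longrightarrow> 1 \<le> k \<Longrightarrow> 0 < arr_time rs k"
  unfolding arr_time_def by (intro sum_pos) (auto simp: lessThan_empty_iff)

lemma first_arr_lower: "1 \<le> k \<Longrightarrow> 0 < arr_time rs k \<Longrightarrow> p (arr_time rs k) \<in> R \<Longrightarrow> first_arr R p rs \<le> ennreal (arr_time rs k)"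
  unfolding first_arr_def by (auto intro!: Inf_lower)

lemma first_arr_greatest:
  assumes "\<And>k. 1 \<le> k \<Longrightarrow> 0 < arr_time rs k \<Longrightarrow> p (arr_time rs k) \<in> R \<Longrightarrow> a \<le> c + ennreal (arr_time rs k)"
  shows "a \<le> c + first_arr R p rs"
  unfolding first_arr_def using assms by (auto intro!: le_add_InfI)

lemma first_arr_Cons:
  assumes t: "0 < t" and pos: "\<And>n. 0 < rs !! n"
  shows "first_arr R p (t ## rs) = (if p t \<in> R then ennreal t else ennreal t + first_arr R (shift_path t p) rs)"
proof (cases "p t \<in> R")
  case True
  have "first_arr R p (t ## rs) \<le> ennreal t"
    using first_arr_lower[of 1 "t ## rs" p R] arr_time_Cons[of t rs 0] t True by simp
  moreover have "ennreal t \<le> 0 + first_arr R p (t ## rs)"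
  proof (rule first_arr_greatest)
    fix k :: nat assume "1 \<le> k"
    then obtain j where k: "k = Suc j" by (cases k) auto
    have "0 \<le> arr_time rs j" using arr_time_pos[of rs j] pos by (cases "j = 0") auto
    then show "ennreal t \<le> 0 + ennreal (arr_time (t ## rs) k)" by (simp add: k arr_time_Cons ennreal_leI)
  qed
  ultimately show ?thesis using True by simp
next
  case False
  have "first_arr R p (t ## rs) \<le> ennreal t + first_arr R (shift_path t p) rs"
  proof (rule first_arr_greatest)
    fix k :: nat assume "1 \<le> k" "0 < arr_time rs k" "shift_path t p (arr_time rs k) \<in> R"
    then show "first_arr R p (t ## rs) \<le> ennreal t + ennreal (arr_time rs k)"
      using first_arr_lower[of "Suc k" "t ## rs" p R] t by (simp add: arr_time_Cons shift_path_def)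
  qed
  moreover have "ennreal t + first_arr R (shift_path t p) rs \<le> 0 + first_arr R p (t ## rs)"
  proof (rule first_arr_greatest)
    fix k :: nat assume k: "1 \<le> k" "p (arr_time (t ## rs) k) \<in> R"
    then obtain j where j: "k = Suc j" by (cases k) auto
    have "j \<noteq> 0" using False k by (intro notI) (simp add: j arr_time_Cons)
    then have "0 < arr_time rs j" "first_arr R (shift_path t p) rs \<le> ennreal (arr_time rs j)"
      using k arr_time_pos[of rs j] pos by (auto simp: j arr_time_Cons shift_path_def intro!: first_arr_lower)
    then show "ennreal t + first_arr R (shift_path t p) rs \<le> 0 + ennreal (arr_time (t ## rs) k)"
      using t by (simp add: j arr_time_Cons)
  qed
  ultimately show ?thesis using False by (auto intro: antisym)
qed

text \<open>Only the total \<open>t + u\<close> enters the arrival times, so a clock that has run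
  for \<open>t\<close> may be restarted there. This is the pathwise half of memorylessness.\<close>

lemma first_arr_memoryless:
  assumes t: "0 \<le> t" "0 < u" and pos: "\<And>n. 0 < rs !! n"
  shows "first_arr R p ((t + u) ## rs) = ennreal t + first_arr R (shift_path t p) (u ## rs)"
proof -
  have "first_arr R (shift_path t p) (u ## rs) = (if p (t + u) \<in> R then ennreal u else ennreal u + first_arr R (shift_path (t + u) p) rs)"
    using first_arr_Cons[OF t(2) pos, of R "shift_path t p"] by (simp add: shift_shift) (simp add: shift_path_def)
  then show ?thesis using first_arr_Cons[of "t + u" rs R p] pos t by (simp add: add.assoc)
qed

section \<open>Discount and payoff along a shifted path\<close>

context barrier_model
begin

lemma path_proc: "proc path_space (\<lambda>t p. p t)"
  by (auto intro: measurable_coord)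

lemma rate_measurable:
  fixes p :: "real \<Rightarrow> real \<times> 'e"
  assumes "rcont p"
  shows "(\<lambda>s. ennreal (qq (snd (p (max 0 s))))) \<in> borel_measurable borel"
proof -
  have "(\<lambda>s. (\<lambda>(t, p). p (max 0 t)) (s, p)) \<in> borel_measurable borel"
    by (rule measurable_compose[OF _ proc_joint[OF path_proc], of "\<lambda>s. (s, p)"]) (use assms in \<open>auto intro!: measurable_Pair\<close>)
  then have [measurable]: "(\<lambda>s. p (max 0 s)) \<in> borel \<rightarrow>\<^sub>M borel" by simp
  show ?thesis by measurable
qed

lemma qi_eq: "qi p T = (\<integral>\<^sup>+ s. indicator {s. 0 \<le> s \<and> ennreal s < T} s * ennreal (qq (snd (p (max 0 s)))) \<partial>lborel)"
  unfolding qi_def qint_def by (intro nn_integral_cong) (auto simp: indicator_def max_def)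

lemma qi_mono: "T \<le> T' \<Longrightarrow> qi p T \<le> qi p T'"
  unfolding qi_def qint_def by (intro nn_integral_mono mult_right_mono) (auto simp: indicator_def)

lemma qi_transl [simp]: "qi (transl c p) T = qi p T"
  by (simp add: qi_def qint_def transl_def)

lemma qi_stopped: "qi (stopped t p) (ennreal t) = qi p (ennreal t)"
  unfolding qi_def qint_def stopped_def
  by (intro nn_integral_cong) (auto simp: indicator_def ennreal_less_iff min_def)

lemma qi_add:
  assumes p: "rcont p" and t: "0 \<le> t"
  shows "qi p (ennreal t + T) = qi p (ennreal t) + qi (shift_path t p) T"
proof -
  define f where "f s = ennreal (qq (snd (p (max 0 s))))" for s
  have [measurable]: "f \<in> borel_measurable borel" using rate_measurable[OF p] by (simp add: f_def[abs_def])
  have less_add: "ennreal s < ennreal t + T \<longleftrightarrow> s < t \<or> ennreal (s - t) < T" if "0 \<le> s" for s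
  proof (cases "s < t")
    case True
    then have "ennreal s < ennreal t" using that by (simp add: ennreal_lessI)
    then show ?thesis using True by (auto intro: less_le_trans)
  next
    case False
    then have "ennreal s = ennreal t + ennreal (s - t)" using t by (simp flip: ennreal_plus)
    then show ?thesis using False ennreal_add_left_cancel_less[of "ennreal t" "ennreal (s - t)" T] by simp
  qed
  have "qi p (ennreal t + T) = (\<integral>\<^sup>+ s. indicator {s. 0 \<le> s \<and> ennreal s < ennreal t + T} s * f s \<partial>lborel)"
    unfolding qi_eq f_def ..
  also have "\<dots> = (\<integral>\<^sup>+ s. indicator {s. 0 \<le> s \<and> ennreal s < ennreal t} s * f s + indicator {s. t \<le> s \<and> ennreal (s - t) < T} s * f s \<partial>lborel)"
    using t by (intro nn_integral_cong) (auto simp: indicator_def less_add ennreal_less_iff)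
  also have "\<dots> = qi p (ennreal t) + (\<integral>\<^sup>+ s. indicator {s. t \<le> s \<and> ennreal (s - t) < T} s * f s \<partial>lborel)"
    unfolding qi_eq f_def[symmetric] by (intro nn_integral_add) (auto simp: indicator_def)
  also have "(\<integral>\<^sup>+ s. indicator {s. t \<le> s \<and> ennreal (s - t) < T} s * f s \<partial>lborel)
      = (\<integral>\<^sup>+ s. indicator {s. t \<le> t + s \<and> ennreal s < T} (s) * f (t + s) \<partial>lborel)"
    by (subst nn_integral_real_affine[where c=1 and t=t]) (auto simp: indicator_def intro!: nn_integral_cong)
  also have "\<dots> = qi (shift_path t p) T"
    unfolding qi_eq f_def shift_path_def using t by (intro nn_integral_cong) (auto simp: indicator_def max_def)
  finally show ?thesis .
qed

lemma exp_neg_qi_add: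
  "rcont p \<Longrightarrow> 0 \<le> t \<Longrightarrow> exp_neg (qi p (ennreal t + T)) = exp_neg (qi p (ennreal t)) * exp_neg (qi (shift_path t p) T)"
  by (simp add: qi_add exp_neg_add)

text \<open>The lower bound \<open>q\<close> on the rate makes the discount uniformly exponential,
  which is the source of the contraction.\<close>

lemma exp_neg_qi_le:
  assumes "0 \<le> t"
  shows "exp_neg (qi p (ennreal t)) \<le> ennreal (exp (- q * t))"
proof -
  have "ennreal (q * t) = (\<integral>\<^sup>+ s. ennreal q * indicator {0..<t} s \<partial>lborel)"
    using assms q_pos by (simp add: nn_integral_cmult_indicator ennreal_mult)
  also have "\<dots> \<le> qi p (ennreal t)"
    unfolding qi_def qint_def using assms less_imp_le[OF qq_gt]
    by (intro nn_integral_mono) (auto simp: indicator_def ennreal_less_iff intro!: ennreal_leI)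
  finally have "exp_neg (qi p (ennreal t)) \<le> exp_neg (ennreal (q * t))" by (rule exp_neg_mono)
  then show ?thesis using assms q_pos by (simp add: exp_neg_ennreal)
qed

lemma payoff_le: "payoff k R p rs \<le> ennreal \<beta>"
proof -
  have "1 \<le> ennreal \<beta>" using beta by simp
  then show ?thesis
    using exp_neg_le_1[of "qi p (tau k p)"] exp_neg_le_1[of "qi p (first_arr R p rs)"]
      mult_left_mono[OF exp_neg_le_1[of "qi p (tau k p)"], of "ennreal \<beta>"]
    unfolding payoff_def by (auto intro: order_trans)
qed

lemma payoff_shift:
  assumes p: "rcont p" and t: "0 \<le> t" and le: "ennreal t \<le> tau k p"
    and arr: "first_arr R p rs = ennreal t + first_arr R (shift_path t p) rs'"
  shows "payoff k R p rs = exp_neg (qi p (ennreal t)) * payoff k R (shift_path t p) rs'"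
  unfolding payoff_def arr tau_shift[OF p t le]
  using ennreal_add_left_cancel_less[of "ennreal t"] ennreal_add_left_cancel_le[of "ennreal t"]
  by (simp add: exp_neg_qi_add[OF p t] distrib_left mult_ac)

text \<open>Excluding simultaneous ruin and arrival removes the tie in which the two flags pay
  differently, so one formula covers both.\<close>

lemma payoff_Cons:
  assumes p: "rcont p" and t: "0 < t" and pos: "\<And>n. 0 < rs !! n" and ne: "tau k p \<noteq> ennreal t"
  shows "payoff k R p (t ## rs) = (if ennreal t \<le> tau k p
     then exp_neg (qi p (ennreal t)) * (if p t \<in> R then 1 else payoff k R (shift_path t p) rs)
     else ennreal \<beta> * exp_neg (qi p (tau k p)))"
proof -
  have arr: "first_arr R p (t ## rs) = (if p t \<in> R then ennreal t else ennreal t + first_arr R (shift_path t p) rs)"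
    by (rule first_arr_Cons[OF t pos])
  consider "tau k p < ennreal t" | "ennreal t < tau k p" "p t \<in> R" | "ennreal t < tau k p" "p t \<notin> R"
    using ne by fastforce
  then show ?thesis
  proof cases
    case 1
    then have "tau k p < first_arr R p (t ## rs)" unfolding arr by (auto intro: less_le_trans)
    then have "\<not> (if k then first_arr R p (t ## rs) \<le> tau k p else first_arr R p (t ## rs) < tau k p)"
      by (metis less_imp_not_less not_le)
    then have "payoff k R p (t ## rs) = ennreal \<beta> * exp_neg (qi p (tau k p))"
      unfolding payoff_def using \<open>tau k p < first_arr R p (t ## rs)\<close> by (simp only: if_False if_True add_0)
    then show ?thesis using 1 by (simp add: not_le[symmetric])
  next
    case 2
    then have eq: "first_arr R p (t ## rs) = ennreal t" using arr by simp
    have "(if k then ennreal t \<le> tau k p else ennreal t < tau k p)" "\<not> tau k p < ennreal t" "ennreal t \<le> tau k p"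
      using 2 by (auto simp only: less_imp_le not_less split: if_splits)
    then show ?thesis unfolding payoff_def eq using \<open>p t \<in> R\<close>
      by (cases k) (simp_all only: if_True if_False mult_zero_right add_0_right mult_1_right)
  next
    case 3
    then show ?thesis using arr payoff_shift[OF p, of t k R "t ## rs" rs] t by auto
  qed
qed

lemma payoff_memoryless:
  assumes p: "rcont p" and t: "0 \<le> t" "0 < u" and pos: "\<And>n. 0 < rs !! n" and le: "ennreal t \<le> tau k p"
  shows "payoff k R p ((t + u) ## rs) = exp_neg (qi p (ennreal t)) * payoff k R (shift_path t p) (u ## rs)"
  by (rule payoff_shift[OF p t(1) le first_arr_memoryless[OF t pos]])

end

section \<open>The one-step equation\<close>


lemma exp_dist_AE: "(AE t in exp_dist r. Q t) \<longleftrightarrow> (AE t in lborel. 0 < exponential_density r t \<longrightarrow> Q t)"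
  unfolding exp_dist_def by (subst AE_density) auto

lemma sets_exp_dist [measurable_cong]: "sets (exp_dist r) = sets borel"
  by (simp add: exp_dist_def)

lemma space_exp_dist [simp]: "space (exp_dist r) = UNIV"
  by (simp add: exp_dist_def)

lemma prob_space_exp_dist: "0 < r \<Longrightarrow> prob_space (exp_dist r)"
  unfolding exp_dist_def by (rule prob_space_exponential_density)

lemma exp_dist_AE_pos: "AE t in exp_dist r. 0 < t"
  unfolding exp_dist_AE using AE_lborel_singleton[of 0]
  by eventually_elim (auto simp: exponential_density_def split: if_splits)

lemma exp_dist_AE_neq: "AE t in exp_dist r. a \<noteq> ennreal t"
  unfolding exp_dist_AE
  using AE_lborel_singleton[of "enn2real a"] exp_dist_AE_pos[of r, unfolded exp_dist_AE]
  by eventually_elim auto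

text \<open>The mean discount at rate \<open>q\<close> over one waiting time; the integrand is a
  multiple of the exponential density of rate \<open>r + q\<close>.\<close>

lemma exp_dist_laplace:
  assumes "0 < r" "0 < q"
  shows "(\<integral>\<^sup>+t. ennreal (exp (- q * t)) \<partial>exp_dist r) = ennreal (r / (r + q))"
proof -
  have "(\<integral>\<^sup>+t. ennreal (exp (- q * t)) \<partial>exp_dist r)
      = (\<integral>\<^sup>+t. ennreal (exponential_density r t) * ennreal (exp (- q * t)) \<partial>lborel)"
    unfolding exp_dist_def by (rule nn_integral_density) auto
  also have "\<dots> = (\<integral>\<^sup>+t. ennreal (r / (r + q)) * ennreal (exponential_density (r + q) t) \<partial>lborel)"
  proof (intro nn_integral_cong)
    fix t :: real
    have "r * exp (- t * r) * exp (- q * t) = r / (r + q) * ((r + q) * exp (- t * (r + q)))"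
    proof -
      have "exp (- t * r) * exp (- q * t) = exp (- t * (r + q))" by (simp add: mult_exp_exp algebra_simps)
      moreover have "r / (r + q) * ((r + q) * c) = r * c" for c using assms by simp
      ultimately show ?thesis by (simp only: mult.assoc)
    qed
    then have "exponential_density r t * exp (- q * t) = r / (r + q) * exponential_density (r + q) t"
      by (simp add: exponential_density_def)
    then show "ennreal (exponential_density r t) * ennreal (exp (- q * t))
        = ennreal (r / (r + q)) * ennreal (exponential_density (r + q) t)"
      using assms exponential_density_nonneg[of r t] exponential_density_nonneg[of "r + q" t]
      by (simp flip: ennreal_mult)
  qed
  also have "\<dots> = ennreal (r / (r + q)) * (\<integral>\<^sup>+t. ennreal (exponential_density (r + q) t) \<partial>lborel)"
    by (rule nn_integral_cmult) auto
  also have "(\<integral>\<^sup>+t. ennreal (exponential_density (r + q) t) \<partial>lborel) = 1"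
    using prob_space.emeasure_space_1[OF prob_space_exp_dist[of "r + q"]] assms
    by (simp add: exp_dist_def emeasure_density)
  finally show ?thesis by simp
qed

lemma le_of_geometric_error:
  fixes a b :: ennreal
  assumes "0 \<le> c" "c < 1" "\<And>n. a \<le> b + ennreal (c ^ n * K)"
  shows "a \<le> b"
proof -
  have "(\<lambda>n. c ^ n * K) \<longlonglongrightarrow> 0 * K"
    by (intro tendsto_mult LIMSEQ_power_zero tendsto_const) (use assms in auto)
  then have "(\<lambda>n. b + ennreal (c ^ n * K)) \<longlonglongrightarrow> b + ennreal 0"
    by (intro tendsto_add tendsto_const tendsto_ennrealI) simp
  then have "a \<le> b + ennreal 0" by (rule LIMSEQ_le_const) (use assms(3) in auto)
  then show ?thesis by simp
qed

locale additive_model = barrier_model h qq q \<beta> r + additive_process F Ft Z \<theta> P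
  for h :: "'e::topological_space \<Rightarrow> 'k::metric_space" and qq q \<beta> r
    and F :: "'w set set" and Ft Z \<theta> and P :: "real \<times> 'e \<Rightarrow> 'w measure"
begin

abbreviation "S \<equiv> stream_space (exp_dist r)"

definition mean_payoff :: "bool \<Rightarrow> (real \<times> 'e) set \<Rightarrow> (real \<Rightarrow> real \<times> 'e) \<Rightarrow> ennreal" where
  "mean_payoff k R p = (\<integral>\<^sup>+ rs. payoff k R p rs \<partial>S)"

definition V :: "bool \<Rightarrow> (real \<times> 'e) set \<Rightarrow> real \<times> 'e \<Rightarrow> ennreal" where
  "V k R z = (\<integral>\<^sup>+ \<omega>. mean_payoff k R (path \<omega>) \<partial>P z)"

text \<open>The reward of an arrival at \<open>z\<close>: inside the region the game stops and pays
  1, outside it starts afresh.\<close>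

definition W :: "bool \<Rightarrow> (real \<times> 'e) set \<Rightarrow> real \<times> 'e \<Rightarrow> ennreal" where
  "W k R z = (if z \<in> R then 1 else V k R z)"

text \<open>The payoff of one waiting period of length \<open>t\<close> with reward \<open>w\<close>
  at its end, where ruin during the period ends the game.\<close>

definition \<Phi> :: "bool \<Rightarrow> (real \<times> 'e \<Rightarrow> ennreal) \<Rightarrow> real \<Rightarrow> (real \<Rightarrow> real \<times> 'e) \<Rightarrow> ennreal" where
  "\<Phi> k w t p = (if ennreal t \<le> tau k p then exp_neg (qi p (ennreal t)) * w (p t)
     else ennreal \<beta> * exp_neg (qi p (tau k p)))"

lemma prob_\<nu>: "prob_space (exp_dist r)"
  using r_pos by (rule prob_space_exp_dist)

lemma prob_S: "prob_space S"
  using prob_\<nu> by (rule prob_space.prob_space_stream_space)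

lemma sets_S [measurable_cong]: "sets S = sets (stream_space borel)"
  by (rule sets_stream_space_cong) (rule sets_exp_dist)

lemma AE_S_pos: "AE rs in S. \<forall>n. 0 < rs !! n"
proof -
  have "AE rs in S. stream_all (\<lambda>t. 0 < t) rs"
    by (rule prob_space.AE_stream_all[OF prob_\<nu> _ exp_dist_AE_pos]) measurable
  then show ?thesis by (simp add: stream.pred_set sset_range image_iff) 
qed

lemma tau_True_path_measurable: "tau True \<in> borel_measurable path_space"
  using measurable_tau_True[of "\<lambda>t p. p t" path_space] by (auto intro: measurable_coord)

lemma tau_path_umeas: "tau k \<in> borel_measurable (ucomp path_space)"
  using measurable_tau_False[of "\<lambda>t p. p t" path_space] measurable_ucompI[OF tau_True_path_measurable]
  by (cases k) (auto intro: measurable_coord)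

lemma payoff_path_umeas:
  assumes [measurable]: "R \<in> sets borel"
  shows "(\<lambda>(p, rs). payoff k R p rs) \<in> borel_measurable (ucomp path_space \<Otimes>\<^sub>M S)"
proof -
  have "(\<lambda>(p, rs). payoff k R (\<lambda>t. p t) rs) \<in> borel_measurable (ucomp path_space \<Otimes>\<^sub>M stream_space borel)"
    by (rule payoff_measurable[OF proc_ucomp[OF path_proc] assms]) (rule tau_path_umeas)
  then show ?thesis by (simp cong: measurable_cong_sets add: sets_S)
qed

lemma path_measurable_ucomp: "path \<in> P z \<rightarrow>\<^sub>M ucomp path_space"
  by (rule measurable_ucomp_P[THEN iffD1, OF measurable_ucomp_ucomp[OF path_measurable]])

lemma payoff_P_measurable:
  assumes "R \<in> sets borel"
  shows "(\<lambda>(\<omega>, rs). payoff k R (path \<omega>) rs) \<in> borel_measurable (P z \<Otimes>\<^sub>M S)"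
proof -
  have [measurable]: "path \<in> P z \<rightarrow>\<^sub>M ucomp path_space" by (rule path_measurable_ucomp)
  have "(\<lambda>x. (\<lambda>(p, rs). payoff k R p rs) (path (fst x), snd x)) \<in> borel_measurable (P z \<Otimes>\<^sub>M S)"
    by (rule measurable_compose[OF _ payoff_path_umeas[OF assms]]) measurable
  then show ?thesis by (simp add: split_beta')
qed

lemma mean_payoff_umeas:
  assumes "R \<in> sets borel"
  shows "mean_payoff k R \<in> borel_measurable (ucomp path_space)"
proof -
  interpret S: prob_space S by (rule prob_S)
  show ?thesis unfolding mean_payoff_def[abs_def]
    by (rule S.borel_measurable_nn_integral) (rule payoff_path_umeas[OF assms])
qed

lemma mean_payoff_le: "mean_payoff k R p \<le> ennreal \<beta>"
proof -
  have "mean_payoff k R p \<le> (\<integral>\<^sup>+ rs. ennreal \<beta> \<partial>S)" unfolding mean_payoff_def by (intro nn_integral_mono payoff_le)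
  then show ?thesis by (simp add: prob_space.emeasure_space_1[OF prob_S])
qed

lemma V_le: "V k R z \<le> ennreal \<beta>"
proof -
  have "V k R z \<le> (\<integral>\<^sup>+ rs. ennreal \<beta> \<partial>P z)" unfolding V_def by (intro nn_integral_mono mean_payoff_le)
  then show ?thesis using prob_space.emeasure_space_1[OF prob, of z] by simp
qed

lemma V_umeas: "R \<in> sets borel \<Longrightarrow> V k R \<in> borel_measurable (ucomp borel)"
  unfolding V_def[abs_def] by (intro nn_integral_P_umeas path_umeas mean_payoff_umeas)

lemma W_umeas:
  assumes "R \<in> sets borel" shows "W k R \<in> borel_measurable (ucomp borel)"
proof -
  have [measurable]: "R \<in> sets (ucomp borel)" "V k R \<in> borel_measurable (ucomp borel)"
    using assms by (auto intro: sets_ucompI V_umeas)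
  show ?thesis unfolding W_def[abs_def] by measurable
qed

lemma W_le: "W k R z \<le> ennreal \<beta>"
  using V_le beta by (simp add: W_def)

lemma qi_path_umeas:
  assumes "T \<in> borel_measurable (ucomp path_space)"
  shows "(\<lambda>p. exp_neg (qi p (T p))) \<in> borel_measurable (ucomp path_space)"
proof -
  note [measurable] = assms
  have "(\<lambda>p. (\<lambda>(p, T). qi (\<lambda>t. p t) T) (p, T p)) \<in> borel_measurable (ucomp path_space)"
    by (rule measurable_compose[OF _ qi_measurable[OF proc_ucomp[OF path_proc]]]) measurable
  then have [measurable]: "(\<lambda>p. qi p (T p)) \<in> borel_measurable (ucomp path_space)" by simp
  show ?thesis by measurable
qed

lemma coord_ucomp: "0 \<le> t \<Longrightarrow> (\<lambda>p. p t) \<in> ucomp path_space \<rightarrow>\<^sub>M ucomp borel"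
  by (rule measurable_ucomp_ucomp[OF measurable_coord])

lemma \<Phi>_umeas:
  assumes "w \<in> borel_measurable (ucomp borel)" "0 \<le> t"
  shows "\<Phi> k w t \<in> borel_measurable (ucomp path_space)"
proof -
  note [measurable] = tau_path_umeas measurable_compose[OF coord_ucomp[OF assms(2)] assms(1)]
    qi_path_umeas[OF tau_path_umeas] qi_path_umeas[OF measurable_const, of "ennreal t"]
  show ?thesis unfolding \<Phi>_def[abs_def] by measurable
qed

definition g :: "bool \<Rightarrow> (real \<times> 'e) set \<Rightarrow> real \<times> 'e \<Rightarrow> real \<Rightarrow> ennreal" where
  "g k R z t = (\<integral>\<^sup>+ \<omega>. \<integral>\<^sup>+ rs. payoff k R (path \<omega>) (t ## rs) \<partial>S \<partial>P z)"

lemma payoff_Cons_measurable: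
  assumes "R \<in> sets borel"
  shows "(\<lambda>((t, \<omega>), rs). payoff k R (path \<omega>) (t ## rs)) \<in> borel_measurable ((exp_dist r \<Otimes>\<^sub>M P z) \<Otimes>\<^sub>M S)"
proof -
  have "(\<lambda>x. (\<lambda>(\<omega>, rs). payoff k R (path \<omega>) rs) (snd (fst x), fst (fst x) ## snd x))
      \<in> borel_measurable ((exp_dist r \<Otimes>\<^sub>M P z) \<Otimes>\<^sub>M S)"
    by (rule measurable_compose[OF _ payoff_P_measurable[OF assms]]) measurable
  then show ?thesis by (simp add: split_beta')
qed

lemma mean_Cons_measurable:
  assumes "R \<in> sets borel"
  shows "(\<lambda>(t, \<omega>). \<integral>\<^sup>+ rs. payoff k R (path \<omega>) (t ## rs) \<partial>S) \<in> borel_measurable (exp_dist r \<Otimes>\<^sub>M P z)"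
proof -
  interpret S: prob_space S by (rule prob_S)
  have "(\<lambda>x. \<integral>\<^sup>+ rs. payoff k R (path (snd x)) (fst x ## rs) \<partial>S) \<in> borel_measurable (exp_dist r \<Otimes>\<^sub>M P z)"
    by (rule S.borel_measurable_nn_integral) (use payoff_Cons_measurable[OF assms] in \<open>simp add: split_beta'\<close>)
  then show ?thesis by (simp add: split_beta')
qed

lemma g_measurable:
  assumes "R \<in> sets borel"
  shows "g k R z \<in> borel_measurable (exp_dist r)"
proof -
  interpret P: prob_space "P z" by (rule prob)
  show ?thesis unfolding g_def[abs_def]
    by (rule P.borel_measurable_nn_integral[OF mean_Cons_measurable[OF assms]])
qed

lemma mean_payoff_first:
  assumes "R \<in> sets borel" "rcont p"
  shows "mean_payoff k R p = (\<integral>\<^sup>+ t. \<integral>\<^sup>+ rs. payoff k R p (t ## rs) \<partial>S \<partial>exp_dist r)"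
  unfolding mean_payoff_def
proof (rule prob_space.nn_integral_stream_space[OF prob_\<nu>])
  show "payoff k R p \<in> borel_measurable S"
    using measurable_compose[OF measurable_Pair1' payoff_path_umeas[OF assms(1)], of p k] assms(2) by simp
qed

lemma V_eq_g:
  assumes R: "R \<in> sets borel"
  shows "V k R z = (\<integral>\<^sup>+ t. g k R z t \<partial>exp_dist r)"
proof -
  interpret pair_sigma_finite "exp_dist r" "P z"
    by (intro pair_sigma_finite.intro prob_space_imp_sigma_finite prob prob_\<nu>)
  show ?thesis
    unfolding V_def g_def mean_payoff_first[OF R rcont_path]
    using mean_Cons_measurable[OF R] by (intro Fubini') simp
qed

lemma mean_payoff_Cons:
  assumes R: "R \<in> sets borel" and p: "rcont p" and t: "0 < t" and ne: "tau k p \<noteq> ennreal t"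
  shows "(\<integral>\<^sup>+ rs. payoff k R p (t ## rs) \<partial>S) = (if ennreal t \<le> tau k p
     then exp_neg (qi p (ennreal t)) * (if p t \<in> R then 1 else mean_payoff k R (shift_path t p))
     else ennreal \<beta> * exp_neg (qi p (tau k p)))"
proof -
  have "(\<integral>\<^sup>+ rs. payoff k R p (t ## rs) \<partial>S) = (\<integral>\<^sup>+ rs. (if ennreal t \<le> tau k p
     then exp_neg (qi p (ennreal t)) * (if p t \<in> R then 1 else payoff k R (shift_path t p) rs)
     else ennreal \<beta> * exp_neg (qi p (tau k p))) \<partial>S)"
    using AE_S_pos by (intro nn_integral_cong_AE, eventually_elim) (rule payoff_Cons[OF p t _ ne], simp)
  moreover have "payoff k R (shift_path t p) \<in> borel_measurable S"
    using measurable_compose[OF measurable_Pair1' payoff_path_umeas[OF R], of "shift_path t p" k] rcont_shift[OF p] t by simp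
  ultimately show ?thesis
    by (simp add: prob_space.emeasure_space_1[OF prob_S] nn_integral_cmult mean_payoff_def)
qed

text \<open>By Fubini, ruin coincides with the first arrival with probability 0, since waiting times
  have no atoms. After an arrival outside \<open>R\<close> the payoff is a functional of the shifted
  path times a factor read from the past, so the Markov property replaces it by \<open>V\<close> at
  the current state.\<close>

lemma g_eq_\<Phi>:
  assumes R: "R \<in> sets borel"
  shows "AE t in exp_dist r. g k R z t = (\<integral>\<^sup>+ \<omega>. \<Phi> k (W k R) t (path \<omega>) \<partial>P z)"
proof -
  interpret pair_sigma_finite "exp_dist r" "P z"
    by (intro pair_sigma_finite.intro prob_space_imp_sigma_finite prob prob_\<nu>)
  note path_umeas[OF tau_path_umeas, measurable]
  have "AE t in exp_dist r. AE \<omega> in P z. tau k (path \<omega>) \<noteq> ennreal t"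
    by (rule AE_commute[THEN iffD2]) (measurable, use exp_dist_AE_neq in auto)
  then show ?thesis using exp_dist_AE_pos
  proof eventually_elim
    fix t assume t: "0 < t" and ne: "AE \<omega> in P z. tau k (path \<omega>) \<noteq> ennreal t"
    \<comment> \<open>\<open>A\<close> collects what is settled by time \<open>t\<close>, by
      stopping or by ruin; \<open>B\<close> is the discount when the game continues.\<close>
    define A where "A p = (if ennreal t \<le> tau k p then (if p t \<in> R then exp_neg (qi p (ennreal t)) else 0)
      else ennreal \<beta> * exp_neg (qi p (tau k p)))" for p
    define B where "B p = (if ennreal t \<le> tau k p \<and> p t \<notin> R then exp_neg (qi p (ennreal t)) else 0)" for p
    have [measurable]: "R \<in> sets (ucomp borel)" using R by (rule sets_ucompI)
    note [measurable] = tau_path_umeas coord_ucomp[OF less_imp_le[OF t]]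
      qi_path_umeas[OF tau_path_umeas] qi_path_umeas[OF measurable_const, of "ennreal t"]
    have Am: "A \<in> borel_measurable (ucomp path_space)" and Bm: "B \<in> borel_measurable (ucomp path_space)"
      unfolding A_def[abs_def] B_def[abs_def] by measurable
    have Hm: "mean_payoff k R \<in> borel_measurable (ucomp path_space)" using mean_payoff_umeas[OF R] .
    have HSm: "(\<lambda>p. mean_payoff k R (shift_path t p)) \<in> borel_measurable (ucomp path_space)"
      by (rule measurable_compose[OF measurable_ucomp_ucomp[OF measurable_shift] Hm]) (use t in auto)
    \<comment> \<open>The Markov property with a stopped prefactor applies because \<open>B\<close>
      reads the path up to \<open>t\<close> only.\<close>
    have Bst: "B (stopped t p) = B p" for p
    proof -
      have "stopped t p t = p t" by (simp add: stopped_def)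
      then show ?thesis using t by (simp add: B_def le_tau_stopped qi_stopped)
    qed
    note [measurable] = path_umeas[OF Am] path_umeas[OF Bm] path_umeas[OF HSm]
      Z_umeas[OF less_imp_le[OF t] V_umeas[OF R]]
    have "g k R z t = (\<integral>\<^sup>+ \<omega>. A (path \<omega>) + B (path \<omega>) * mean_payoff k R (shift_path t (path \<omega>)) \<partial>P z)"
      unfolding g_def using ne
      by (intro nn_integral_cong_AE, eventually_elim)
         (auto simp: mean_payoff_Cons[OF R rcont_path t] A_def B_def)
    also have "\<dots> = (\<integral>\<^sup>+ \<omega>. A (path \<omega>) \<partial>P z) + (\<integral>\<^sup>+ \<omega>. B (path \<omega>) * mean_payoff k R (shift_path t (path \<omega>)) \<partial>P z)"
      by (rule nn_integral_add) measurable
    also have "(\<integral>\<^sup>+ \<omega>. B (path \<omega>) * mean_payoff k R (shift_path t (path \<omega>)) \<partial>P z)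
        = (\<integral>\<^sup>+ \<omega>. B (path \<omega>) * V k R (Z t \<omega>) \<partial>P z)"
      using markov_functional[OF less_imp_le[OF t] Bm Hm, of z] by (simp add: Bst V_def)
    also have "(\<integral>\<^sup>+ \<omega>. A (path \<omega>) \<partial>P z) + (\<integral>\<^sup>+ \<omega>. B (path \<omega>) * V k R (Z t \<omega>) \<partial>P z)
        = (\<integral>\<^sup>+ \<omega>. A (path \<omega>) + B (path \<omega>) * V k R (Z t \<omega>) \<partial>P z)"
      by (rule nn_integral_add[symmetric]) measurable
    also have "\<dots> = (\<integral>\<^sup>+ \<omega>. \<Phi> k (W k R) t (path \<omega>) \<partial>P z)"
      by (intro nn_integral_cong) (auto simp: A_def B_def \<Phi>_def W_def path_def)
    finally show "g k R z t = (\<integral>\<^sup>+ \<omega>. \<Phi> k (W k R) t (path \<omega>) \<partial>P z)" .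
  qed
qed

text \<open>If the lower path survives to \<open>t\<close>, so does the raised one; both carry the
  same discount, and the error \<open>M\<close> is discounted too. If the lower path is ruined
  earlier it collects \<beta> then, while the raised path collects at most \<beta>, discounted for
  longer.\<close>

lemma \<Phi>_mono:
  assumes p: "rcont p" and d: "0 \<le> d" "0 < d \<or> k = l" and t: "0 \<le> t"
    and w: "\<And>x y. w (x + d, y) \<le> w' (x, y) + M" "\<And>z. w z \<le> ennreal \<beta>"
  shows "\<Phi> k w t (transl d p) \<le> \<Phi> l w' t p + ennreal (exp (- q * t)) * M"
proof -
  have tau: "tau l p \<le> tau k (transl d p)" using tau_transl_mono[OF p d, of 0] by simp
  show ?thesis
  proof (cases "ennreal t \<le> tau l p")
    case True
    have "\<Phi> k w t (transl d p) = exp_neg (qi p (ennreal t)) * w (fst (p t) + d, snd (p t))"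
    proof -
      have "transl d p t = (fst (p t) + d, snd (p t))" by (simp add: transl_def)
      then show ?thesis using order_trans[OF True tau] by (simp add: \<Phi>_def)
    qed
    also have "\<dots> \<le> exp_neg (qi p (ennreal t)) * (w' (p t) + M)"
      using w(1)[of "fst (p t)" "snd (p t)"] by (intro mult_left_mono) auto
    also have "\<dots> \<le> \<Phi> l w' t p + ennreal (exp (- q * t)) * M"
      using True exp_neg_qi_le[OF t] by (auto simp: \<Phi>_def distrib_left intro!: add_left_mono mult_right_mono)
    finally show ?thesis .
  next
    case False
    have mono: "exp_neg (qi p T) \<le> exp_neg (qi p (tau l p))" if "tau l p \<le> T" for T
      by (intro exp_neg_mono qi_mono that)
    have "\<Phi> k w t (transl d p) \<le> ennreal \<beta> * exp_neg (qi p (tau l p))"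
    proof (cases "ennreal t \<le> tau k (transl d p)")
      case True
      then have "\<Phi> k w t (transl d p) = exp_neg (qi p (ennreal t)) * w (transl d p t)" by (simp add: \<Phi>_def)
      also have "\<dots> \<le> exp_neg (qi p (tau l p)) * ennreal \<beta>"
        using False by (intro mult_mono mono w(2)) auto
      finally show ?thesis by (simp add: mult.commute)
    next
      case False
      then show ?thesis by (auto simp: \<Phi>_def intro!: mult_left_mono mono tau)
    qed
    also have "\<dots> \<le> \<Phi> l w' t p + ennreal (exp (- q * t)) * M"
      using False by (simp add: \<Phi>_def)
    finally show ?thesis .
  qed
qed

text \<open>Translation places both starting levels under one law, so the comparison becomes
  pathwise. An error in the rewards is discounted over one waiting time, which multiplies it by
  \<open>r / (r + q)\<close>.\<close>

lemma V_step:
  assumes R: "R \<in> sets borel" "R' \<in> sets borel" and d: "0 \<le> d" "0 < d \<or> k = l"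
    and le: "\<And>x y. W k R (x + d, y) \<le> W l R' (x, y) + M"
  shows "V k R (x + d, y) \<le> V l R' (x, y) + ennreal (r / (r + q)) * M"
proof -
  have "AE t in exp_dist r. g k R (x + d, y) t \<le> g l R' (x, y) t + ennreal (exp (- q * t)) * M"
    using g_eq_\<Phi>[OF R(1), of k "(x + d, y)"] g_eq_\<Phi>[OF R(2), of l "(x, y)"] exp_dist_AE_pos
  proof eventually_elim
    fix t :: real assume t: "0 < t"
      and eq: "g k R (x + d, y) t = (\<integral>\<^sup>+ \<omega>. \<Phi> k (W k R) t (path \<omega>) \<partial>P (x + d, y))"
        "g l R' (x, y) t = (\<integral>\<^sup>+ \<omega>. \<Phi> l (W l R') t (path \<omega>) \<partial>P (x, y))"
    have t0: "0 \<le> t" using t by simp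
    note [measurable] = path_umeas[OF \<Phi>_umeas[OF W_umeas[OF R(2)] t0]]
    have "g k R (x + d, y) t = (\<integral>\<^sup>+ \<omega>. \<Phi> k (W k R) t (transl d (path \<omega>)) \<partial>P (x, y))"
    proof -
      have "(\<integral>\<^sup>+ \<omega>. \<Phi> k (W k R) t (path \<omega>) \<partial>P (d + x, y)) = (\<integral>\<^sup>+ \<omega>. \<Phi> k (W k R) t (transl d (path \<omega>)) \<partial>P (x, y))"
        by (rule translation[OF \<Phi>_umeas[OF W_umeas[OF R(1)] t0]])
      then show ?thesis unfolding eq(1) by (simp only: add.commute[of x d])
    qed
    also have "\<dots> \<le> (\<integral>\<^sup>+ \<omega>. \<Phi> l (W l R') t (path \<omega>) + ennreal (exp (- q * t)) * M \<partial>P (x, y))"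
      by (intro nn_integral_mono \<Phi>_mono rcont_path d t0 le W_le)
    also have "\<dots> = (\<integral>\<^sup>+ \<omega>. \<Phi> l (W l R') t (path \<omega>) \<partial>P (x, y)) + (\<integral>\<^sup>+ \<omega>. ennreal (exp (- q * t)) * M \<partial>P (x, y))"
      by (rule nn_integral_add) measurable
    also have "\<dots> = g l R' (x, y) t + ennreal (exp (- q * t)) * M"
      using prob_space.emeasure_space_1[OF prob, of "(x, y)"] by (simp add: eq)
    finally show "g k R (x + d, y) t \<le> g l R' (x, y) t + ennreal (exp (- q * t)) * M" .
  qed
  then have "V k R (x + d, y) \<le> (\<integral>\<^sup>+ t. g l R' (x, y) t + ennreal (exp (- q * t)) * M \<partial>exp_dist r)"
    unfolding V_eq_g[OF R(1)] by (rule nn_integral_mono_AE)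
  also have "\<dots> = V l R' (x, y) + (\<integral>\<^sup>+ t. ennreal (exp (- q * t)) * M \<partial>exp_dist r)"
    unfolding V_eq_g[OF R(2)] by (rule nn_integral_add[OF g_measurable[OF R(2)]]) measurable
  also have "(\<integral>\<^sup>+ t. ennreal (exp (- q * t)) * M \<partial>exp_dist r) = ennreal (r / (r + q)) * M"
    by (subst nn_integral_multc) (measurable, simp only: exp_dist_laplace[OF r_pos q_pos])
  finally show ?thesis .
qed

section \<open>Comparison of values by geometric iteration\<close>

lemma rate_bounds: "0 \<le> r / (r + q)" "r / (r + q) < 1"
  using r_pos q_pos by auto

lemma geometric_Suc: "ennreal (r / (r + q)) * ennreal ((r / (r + q)) ^ n * \<beta>) = ennreal ((r / (r + q)) ^ Suc n * \<beta>)"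
  using rate_bounds beta by (simp flip: ennreal_mult add: mult.assoc)

lemma V_le_add_beta: "V k R z \<le> a + ennreal ((r / (r + q)) ^ 0 * \<beta>)"
  using order_trans[OF V_le] by (simp add: add_increasing)

lemma reg_borel:
  fixes b :: "'e \<Rightarrow> real"
  shows "b \<in> borel_measurable borel \<Longrightarrow> reg k b \<in> sets borel"
proof -
  assume [measurable]: "b \<in> borel_measurable borel"
  note [measurable] = fst_borel snd_borel
  have "{z \<in> space (borel :: (real \<times> 'e) measure). b (snd z) \<le> fst z} \<in> sets borel"
    "{z \<in> space (borel :: (real \<times> 'e) measure). b (snd z) < fst z} \<in> sets borel"
    by measurable
  then show ?thesis by (cases k) (auto simp: reg_def)
qed

text \<open>The induction runs over both flags and all pairs of levels together. The critical case
  has the upper point inside its region and the lower one outside: the reward 1 must be dominated by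
  the value at the lower level. This is done through the barrier level, where the value with flag
  \<open>False\<close> is at least 1 by hypothesis.\<close>

lemma V_antimono:
  assumes b: "b \<in> borel_measurable borel" and ge1: "\<And>y. 1 \<le> V False (reg False b) (b y, y)" and "x < x'"
  shows "V k (reg k b) (x', y) \<le> V l (reg l b) (x, y)"
proof -
  have *: "\<forall>k l x d y. 0 < d \<longrightarrow> V k (reg k b) (x + d, y) \<le> V l (reg l b) (x, y) + ennreal ((r / (r + q)) ^ n * \<beta>)" for n
  proof (induction n)
    case 0
    show ?case using V_le_add_beta by blast
  next
    case (Suc n)
    show ?case
    proof (intro allI impI)
      fix k l :: bool and x d :: real and y assume d: "0 < d"
      let ?M = "ennreal ((r / (r + q)) ^ n * \<beta>)"
      have "W k (reg k b) (x + d, y) \<le> W l (reg l b) (x, y) + ?M" for x y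
      proof (cases "(x, y) \<in> reg l b")
        case True
        then have "(x + d, y) \<in> reg k b" using d by (auto simp: reg_def split: if_splits)
        then show ?thesis using True by (simp add: W_def)
      next
        case False
        then have Wl: "W l (reg l b) (x, y) = V l (reg l b) (x, y)" by (simp add: W_def)
        show ?thesis
        proof (cases "(x + d, y) \<in> reg k b")
          case True
          have "1 \<le> V l (reg l b) (x, y) + ?M"
          proof (cases "x < b y")
            case True
            then have "V False (reg False b) (x + (b y - x), y) \<le> V l (reg l b) (x, y) + ?M"
              using Suc.IH[rule_format, of "b y - x" False x y l] by simp
            then show ?thesis using ge1[of y] by simp
          next
            case 2: False
            then have "l = False" "x = b y" using False by (auto simp: reg_def split: if_splits)
            then show ?thesis using ge1[of y] by (simp add: add_increasing2)
          qed
          then show ?thesis using True Wl by (simp add: W_def)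
        next
          case False
          then show ?thesis using Suc.IH d Wl by (simp add: W_def)
        qed
      qed
      then have "V k (reg k b) (x + d, y) \<le> V l (reg l b) (x, y) + ennreal (r / (r + q)) * ?M"
        by (intro V_step reg_borel b) (use d in auto)
      then show "V k (reg k b) (x + d, y) \<le> V l (reg l b) (x, y) + ennreal ((r / (r + q)) ^ Suc n * \<beta>)"
        unfolding geometric_Suc .
    qed
  qed
  have "V k (reg k b) (x + (x' - x), y) \<le> V l (reg l b) (x, y) + ennreal ((r / (r + q)) ^ n * \<beta>)" for n
    by (rule *[of n, rule_format]) (use \<open>x < x'\<close> in simp)
  then have "V k (reg k b) (x + (x' - x), y) \<le> V l (reg l b) (x, y)"
    by (rule le_of_geometric_error[OF rate_bounds])
  then show ?thesis by simp
qed

text \<open>Where the regions differ, stopping and continuing are worth the same, so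
  \<open>V k R\<close> satisfies the one-step equation of either region, and contraction leaves room
  for one solution only.\<close>

lemma V_perturb:
  assumes R: "R \<in> sets borel" "R' \<in> sets borel"
    and one: "\<And>z. (z \<in> R) \<noteq> (z \<in> R') \<Longrightarrow> V k R z = 1"
  shows "V k R' z = V k R z"
proof -
  have *: "\<forall>z. V k R' z \<le> V k R z + ennreal ((r / (r + q)) ^ n * \<beta>) \<and> V k R z \<le> V k R' z + ennreal ((r / (r + q)) ^ n * \<beta>)" for n
  proof (induction n)
    case 0
    show ?case using V_le_add_beta by blast
  next
    case (Suc n)
    let ?M = "ennreal ((r / (r + q)) ^ n * \<beta>)"
    have IH: "V k R' z \<le> V k R z + ?M" "V k R z \<le> V k R' z + ?M" for z using Suc by blast+
    have "W k R' z \<le> W k R z + ?M" "W k R z \<le> W k R' z + ?M" for z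
      using IH[of z] one[of z] by (auto simp: W_def)
    then have "V k R' (fst z + 0, snd z) \<le> V k R (fst z, snd z) + ennreal (r / (r + q)) * ?M"
      "V k R (fst z + 0, snd z) \<le> V k R' (fst z, snd z) + ennreal (r / (r + q)) * ?M" for z
      by (intro V_step R; simp)+
    then show ?case unfolding geometric_Suc by simp
  qed
  have "V k R' z \<le> V k R z" "V k R z \<le> V k R' z"
    by (rule le_of_geometric_error[OF rate_bounds], use * in blast)+
  then show ?thesis by (rule antisym)
qed

end

section \<open>Excessive potentials\<close>


text \<open>Memorylessness in integrated form: waiting at least \<open>s\<close> has weight
  \<open>exp (- r * s)\<close>, and the residual waiting time has the original law.\<close>

lemma exp_dist_shift:
  assumes r: "0 < r" and s: "0 \<le> s" and f [measurable]: "f \<in> borel_measurable borel"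
  shows "ennreal (exp (- r * s)) * (\<integral>\<^sup>+t. f t \<partial>exp_dist r) = (\<integral>\<^sup>+t. indicator {s..} t * f (t - s) \<partial>exp_dist r)"
proof -
  have [measurable]: "(\<lambda>t. f (t - s)) \<in> borel_measurable borel" by measurable
  have "(\<integral>\<^sup>+t. indicator {s..} t * f (t - s) \<partial>exp_dist r)
      = (\<integral>\<^sup>+t. ennreal (exponential_density r t) * (indicator {s..} t * f (t - s)) \<partial>lborel)"
    unfolding exp_dist_def by (rule nn_integral_density) auto
  also have "\<dots> = (\<integral>\<^sup>+t. ennreal (exponential_density r (s + t)) * (indicator {s..} (s + t) * f t) \<partial>lborel)"
    by (subst nn_integral_real_affine[where c=1 and t=s]) auto
  also have "\<dots> = (\<integral>\<^sup>+t. ennreal (exp (- r * s)) * (ennreal (exponential_density r t) * f t) \<partial>lborel)"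
  proof (rule nn_integral_cong)
    fix t :: real
    show "ennreal (exponential_density r (s + t)) * (indicator {s..} (s + t) * f t)
        = ennreal (exp (- r * s)) * (ennreal (exponential_density r t) * f t)"
    proof (cases "t < 0")
      case True
      then show ?thesis by (simp add: exponential_density_def)
    next
      case False
      have "exponential_density r (s + t) = exp (- r * s) * exponential_density r t"
        using False s by (simp add: exponential_density_def mult_exp_exp algebra_simps)
      then have "ennreal (exponential_density r (s + t)) = ennreal (exp (- r * s)) * ennreal (exponential_density r t)"
        using exponential_density_nonneg[OF r] by (simp add: ennreal_mult)
      then show ?thesis using False by (simp add: mult.assoc)
    qed
  qed
  also have "\<dots> = ennreal (exp (- r * s)) * (\<integral>\<^sup>+t. ennreal (exponential_density r t) * f t \<partial>lborel)"
    by (rule nn_integral_cmult) auto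
  also have "(\<integral>\<^sup>+t. ennreal (exponential_density r t) * f t \<partial>lborel) = (\<integral>\<^sup>+t. f t \<partial>exp_dist r)"
    unfolding exp_dist_def by (rule nn_integral_density[symmetric]) auto
  finally show ?thesis ..
qed

lemma exp_dist_tail:
  assumes "0 < r" "0 \<le> s"
  shows "emeasure (exp_dist r) {s..} = ennreal (exp (- r * s))"
  using exp_dist_shift[OF assms, of "\<lambda>_. 1"] prob_space.emeasure_space_1[OF prob_space_exp_dist[OF assms(1)]]
  by (simp add: sets_exp_dist)

text \<open>Continuity at infinity is treated separately because \<open>enn2real\<close> sends
  infinity to 0.\<close>

lemma tendsto_exp_neg:
  assumes a: "(f \<longlongrightarrow> a) G"
  shows "((\<lambda>x. exp_neg (f x)) \<longlongrightarrow> exp_neg a) G"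
proof (cases a)
  case (real x)
  have "\<forall>\<^sub>F y in G. f y < \<infinity>" using a real by (intro order_tendstoD(2)) auto
  then have "\<forall>\<^sub>F y in G. ennreal (exp (- enn2real (f y))) = exp_neg (f y)"
    by eventually_elim (auto simp: exp_neg_def)
  moreover have "((\<lambda>y. ennreal (exp (- enn2real (f y)))) \<longlongrightarrow> ennreal (exp (- x))) G"
    by (intro tendsto_intros) (use a real in auto)
  ultimately have "((\<lambda>y. exp_neg (f y)) \<longlongrightarrow> ennreal (exp (- x))) G"
    by (rule Lim_transform_eventually[rotated])
  then show ?thesis using real by (simp add: exp_neg_ennreal)
next
  case top
  have "((\<lambda>x. exp_neg (f x)) \<longlongrightarrow> 0) G"
  proof (rule order_tendstoI)
    fix e :: ennreal assume "0 < e"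
    then obtain d :: real where d: "0 < d" "ennreal d < e"
    proof (cases e)
      case (real x)
      then show ?thesis using that[of "x / 2"] \<open>0 < e\<close> by (auto simp: ennreal_less_iff)
    next
      case top
      then show ?thesis using that[of 1] by auto
    qed
    have "\<forall>\<^sub>F y in G. ennreal (max 0 (- ln d)) < f y" using a top by (intro order_tendstoD(1)) auto
    then show "\<forall>\<^sub>F y in G. exp_neg (f y) < e"
    proof eventually_elim
      fix y assume "ennreal (max 0 (- ln d)) < f y"
      then have "exp_neg (f y) \<le> exp_neg (ennreal (max 0 (- ln d)))" by (intro exp_neg_mono) auto
      also have "\<dots> = ennreal (exp (- max 0 (- ln d)))" by (rule exp_neg_ennreal) auto
      also have "\<dots> \<le> ennreal (exp (ln d))" by (intro ennreal_leI) auto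
      also have "\<dots> < e" using d by simp
      finally show "exp_neg (f y) < e" .
    qed
  qed simp
  then show ?thesis using top by (simp add: exp_neg_def)
qed

context additive_model
begin

lemma shift_joint: "(\<lambda>(t, p). shift_path (max 0 t) p) \<in> borel \<Otimes>\<^sub>M path_space \<rightarrow>\<^sub>M (path_space :: (real \<Rightarrow> real \<times> 'e) measure)"
proof -
  have "(\<lambda>x s. (\<lambda>s (t, p). p (max 0 t + s)) s x) \<in> borel \<Otimes>\<^sub>M path_space \<rightarrow>\<^sub>M (path_space :: (real \<Rightarrow> real \<times> 'e) measure)"
    using proc_shift[OF path_proc] by (intro measurable_path) auto
  then show ?thesis by (simp add: shift_path_def split_beta')
qed

text \<open>The properties of a weight behind excessiveness of its potentials: restarting the weight
  after time \<open>s\<close> can only lower it, and the loss disappears as \<open>s\<close> tends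
  to 0.\<close>

definition admissible :: "(real \<Rightarrow> (real \<Rightarrow> real \<times> 'e) \<Rightarrow> ennreal) \<Rightarrow> bool" where
  "admissible N \<longleftrightarrow> (\<lambda>(t, p). N t p) \<in> borel_measurable (borel \<Otimes>\<^sub>M path_space) \<and> (\<forall>t p. N t p \<le> 1) \<and>
     (\<forall>p s t. rcont p \<longrightarrow> 0 \<le> s \<longrightarrow> 0 \<le> t \<longrightarrow> N t (shift_path s p) \<le> N (s + t) p) \<and>
     (\<forall>p t. rcont p \<longrightarrow> 0 < t \<longrightarrow> ((\<lambda>s. N (t - s) (shift_path s p)) \<longlongrightarrow> N t p) (at_right 0))"

text \<open>An \<alpha>-potential normalised by \<alpha> and taken along a single path; the mean
  over paths comes later. The shifted quantity may depend on the whole future, not only on the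
  state. The clamp \<open>max 0 t\<close> only makes the shift total, the clock being positive
  almost surely.\<close>

definition potential :: "real \<Rightarrow> (real \<Rightarrow> (real \<Rightarrow> real \<times> 'e) \<Rightarrow> ennreal) \<Rightarrow> ((real \<Rightarrow> real \<times> 'e) \<Rightarrow> ennreal)
    \<Rightarrow> (real \<Rightarrow> real \<times> 'e) \<Rightarrow> ennreal" where
  "potential \<alpha> N D p = (\<integral>\<^sup>+t. N t p * D (shift_path (max 0 t) p) \<partial>exp_dist \<alpha>)"

lemma potential_integrand_measurable:
  assumes N: "admissible N" and D: "D \<in> borel_measurable path_space"
  shows "(\<lambda>(t, p). N t p * D (shift_path (max 0 t) p)) \<in> borel_measurable (borel \<Otimes>\<^sub>M path_space)"
proof -
  have [measurable]: "(\<lambda>x. N (fst x) (snd x)) \<in> borel_measurable (borel \<Otimes>\<^sub>M path_space)"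
    "(\<lambda>x. D (shift_path (max 0 (fst x)) (snd x))) \<in> borel_measurable (borel \<Otimes>\<^sub>M path_space)"
    using N measurable_compose[OF shift_joint D] by (simp_all add: admissible_def split_beta')
  show ?thesis unfolding split_beta' by measurable
qed

lemma potential_measurable:
  assumes "0 < \<alpha>" "admissible N" "D \<in> borel_measurable path_space"
  shows "potential \<alpha> N D \<in> borel_measurable path_space"
proof -
  interpret E: prob_space "exp_dist \<alpha>" by (rule prob_space_exp_dist) fact
  have sets: "sets (path_space \<Otimes>\<^sub>M exp_dist \<alpha>) = sets (path_space \<Otimes>\<^sub>M (borel :: real measure))"
    by (intro sets_pair_measure_cong sets_exp_dist refl)
  have "(\<lambda>x. (\<lambda>(t, p). N t p * D (shift_path (max 0 t) p)) (snd x, fst x)) \<in> borel_measurable (path_space \<Otimes>\<^sub>M borel)"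
    by (rule measurable_compose[OF _ potential_integrand_measurable[OF assms(2,3)]]) measurable
  then have "(\<lambda>(p, t). N t p * D (shift_path (max 0 t) p)) \<in> borel_measurable (path_space \<Otimes>\<^sub>M exp_dist \<alpha>)"
    unfolding measurable_cong_sets[OF sets refl] by (simp add: split_beta')
  then show ?thesis unfolding potential_def[abs_def] by (rule E.borel_measurable_nn_integral)
qed

text \<open>Running the process for time \<open>s\<close> and discounting discards clock times below
  \<open>s\<close> and restarts the weight at \<open>s\<close>; \<open>u s t p\<close> is the
  integrand that remains. It lies below the full integrand and converges to it, so both the
  inequality and the limit required of an excessive function follow.\<close>

lemma excessive_potential:
  assumes \<alpha>: "0 < \<alpha>" and N: "admissible N" and D: "D \<in> borel_measurable path_space"
    and bnd: "\<And>p. D p \<le> ennreal B"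
  shows "excessive P Z \<alpha> (\<lambda>z. \<integral>\<^sup>+\<omega>. potential \<alpha> N D (path \<omega>) \<partial>P z)"
proof -
  define f where "f z = (\<integral>\<^sup>+\<omega>. potential \<alpha> N D (path \<omega>) \<partial>P z)" for z
  define u where "u s t p = indicator {s..} t * (N (t - s) (shift_path s p) * D (shift_path (max 0 t) p))" for s t p
  have G: "potential \<alpha> N D \<in> borel_measurable path_space" by (rule potential_measurable[OF \<alpha> N D])
  have Gu: "potential \<alpha> N D \<in> borel_measurable (ucomp path_space)" by (rule measurable_ucompI[OF G])
  interpret E: prob_space "exp_dist \<alpha>" by (rule prob_space_exp_dist[OF \<alpha>])
  have N1: "N t p \<le> 1" for t p using N by (auto simp: admissible_def)
  have ND: "N t p * D p' \<le> ennreal B" for t p p'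
    using mult_mono[OF N1[of t p] bnd[of p']] by simp
  have meas_t: "(\<lambda>t. N t p * D (shift_path (max 0 t) p)) \<in> borel_measurable borel" if "rcont p" for p
    using measurable_compose[OF measurable_Pair2' potential_integrand_measurable[OF N D], of p] that by simp
  have shifted: "ennreal (exp (- \<alpha> * s)) * potential \<alpha> N D (shift_path s p) = (\<integral>\<^sup>+t. u s t p \<partial>exp_dist \<alpha>)"
    if "0 \<le> s" "rcont p" for s p
  proof -
    have "ennreal (exp (- \<alpha> * s)) * potential \<alpha> N D (shift_path s p) =
      (\<integral>\<^sup>+t. indicator {s..} t * (N (t - s) (shift_path s p) * D (shift_path (max 0 (t - s)) (shift_path s p))) \<partial>exp_dist \<alpha>)"
      unfolding potential_def by (rule exp_dist_shift[OF \<alpha> that(1) meas_t[OF rcont_shift[OF that(2,1)]]])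
    also have "\<dots> = (\<integral>\<^sup>+t. u s t p \<partial>exp_dist \<alpha>)"
      using that by (intro nn_integral_cong) (auto simp: u_def indicator_def shift_shift max_def)
    finally show ?thesis .
  qed
  have u_meas_t: "(\<lambda>t. u s t p) \<in> borel_measurable (exp_dist \<alpha>)" if "0 \<le> s" "rcont p" for s p
  proof -
    define v where "v t = N t (shift_path s p) * D (shift_path (max 0 t) (shift_path s p))" for t
    have [measurable]: "v \<in> borel_measurable borel"
      using meas_t[OF rcont_shift[OF that(2,1)]] by (simp add: v_def[abs_def])
    have "(\<lambda>t. indicator {s..} t * v (t - s)) \<in> borel_measurable borel" by measurable
    also have "(\<lambda>t. indicator {s..} t * v (t - s)) = (\<lambda>t. u s t p)"
      using that by (intro ext) (auto simp: v_def u_def indicator_def shift_shift max_def)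
    finally show ?thesis by (simp cong: measurable_cong_sets add: sets_exp_dist)
  qed
  have semigroup: "ennreal (exp (- \<alpha> * s)) * (\<integral>\<^sup>+\<omega>. f (Z s \<omega>) \<partial>P z) = (\<integral>\<^sup>+\<omega>. (\<integral>\<^sup>+t. u s t (path \<omega>) \<partial>exp_dist \<alpha>) \<partial>P z)"
    if s: "0 \<le> s" for s z
  proof -
    have "UNIV \<in> Ft s" using sets_FtM[OF s] sets.top[of "FtM s"] by simp
    from markov_path[OF s this Gu, of z]
    have "(\<integral>\<^sup>+\<omega>. f (Z s \<omega>) \<partial>P z) = (\<integral>\<^sup>+\<omega>. potential \<alpha> N D (shift_path s (path \<omega>)) \<partial>P z)" by (simp add: f_def)
    moreover have "(\<lambda>\<omega>. potential \<alpha> N D (shift_path s (path \<omega>))) \<in> borel_measurable (P z)"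
      by (rule path_umeas[OF measurable_compose[OF measurable_ucomp_ucomp[OF measurable_shift[OF s]] Gu]])
    ultimately show ?thesis by (simp add: shifted[OF s rcont_path, symmetric] nn_integral_cmult)
  qed
  have mono: "ennreal (exp (- \<alpha> * s)) * (\<integral>\<^sup>+\<omega>. f (Z s \<omega>) \<partial>P z) \<le> f z" if s: "0 \<le> s" for s z
    unfolding semigroup[OF s] unfolding f_def potential_def
  proof (intro nn_integral_mono)
    fix \<omega> t
    show "u s t (path \<omega>) \<le> N t (path \<omega>) * D (shift_path (max 0 t) (path \<omega>))"
    proof (cases "s \<le> t")
      case True
      have "N (t - s) (shift_path s (path \<omega>)) \<le> N (s + (t - s)) (path \<omega>)"
        using N s True rcont_path unfolding admissible_def by (metis diff_ge_0_iff_ge)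
      then show ?thesis using True by (auto simp: u_def intro!: mult_right_mono)
    qed (simp add: u_def)
  qed
  have lim: "((\<lambda>s. ennreal (exp (- \<alpha> * s)) * (\<integral>\<^sup>+\<omega>. f (Z s \<omega>) \<partial>P z)) \<longlongrightarrow> f z) (at_right 0)" for z
  proof (rule tendsto_at_right_sequentially[of 0 1])
    fix s :: "nat \<Rightarrow> real" assume s: "\<And>n. 0 < s n" "s \<longlonglongrightarrow> 0"
    have s0: "0 \<le> s n" for n using s(1)[of n] by simp
    have at: "filterlim s (at_right 0) sequentially"
      using s by (auto simp: filterlim_at intro!: always_eventually less_imp_neq[symmetric])
    have inner: "(\<lambda>n. \<integral>\<^sup>+t. u (s n) t p \<partial>exp_dist \<alpha>) \<longlonglongrightarrow> potential \<alpha> N D p" if p: "rcont p" for p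
      unfolding potential_def
    proof (rule nn_integral_dominated_convergence[where w="\<lambda>_. ennreal B"])
      show "(\<lambda>t. u (s n) t p) \<in> borel_measurable (exp_dist \<alpha>)" for n by (rule u_meas_t[OF s0 p])
      show "(\<lambda>t. N t p * D (shift_path (max 0 t) p)) \<in> borel_measurable (exp_dist \<alpha>)"
        using meas_t[OF p] by (simp cong: measurable_cong_sets add: sets_exp_dist)
      show "AE t in exp_dist \<alpha>. u (s n) t p \<le> ennreal B" for n
        using ND by (auto simp: u_def indicator_def)
      show "AE t in exp_dist \<alpha>. (\<lambda>n. u (s n) t p) \<longlonglongrightarrow> N t p * D (shift_path (max 0 t) p)"
        using exp_dist_AE_pos
      proof eventually_elim
        fix t :: real assume t: "0 < t"
        have "((\<lambda>s. N (t - s) (shift_path s p)) \<longlongrightarrow> N t p) (at_right 0)" using N p t by (auto simp: admissible_def)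
        then have "(\<lambda>n. N (t - s n) (shift_path (s n) p)) \<longlonglongrightarrow> N t p" by (rule filterlim_compose[OF _ at])
        moreover have "D (shift_path (max 0 t) p) \<noteq> \<top>" using bnd[of "shift_path (max 0 t) p"] by (auto simp: top_unique)
        moreover have "N t p \<noteq> \<top>" using N1[of t p] by (auto simp: top_unique)
        ultimately have "(\<lambda>n. N (t - s n) (shift_path (s n) p) * D (shift_path (max 0 t) p)) \<longlonglongrightarrow> N t p * D (shift_path (max 0 t) p)"
          by (intro tendsto_mult_ennreal tendsto_const) auto
        moreover have "\<forall>\<^sub>F n in sequentially. N (t - s n) (shift_path (s n) p) * D (shift_path (max 0 t) p) = u (s n) t p"
          using order_tendstoD(2)[OF s(2) t] by eventually_elim (auto simp: u_def)
        ultimately show "(\<lambda>n. u (s n) t p) \<longlonglongrightarrow> N t p * D (shift_path (max 0 t) p)"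
          by (rule Lim_transform_eventually)
      qed
    qed (simp_all add: E.emeasure_space_1[simplified])
    show "(\<lambda>n. ennreal (exp (- \<alpha> * s n)) * (\<integral>\<^sup>+\<omega>. f (Z (s n) \<omega>) \<partial>P z)) \<longlonglongrightarrow> f z"
      unfolding semigroup[OF s0] unfolding f_def
    proof (rule nn_integral_dominated_convergence[where w="\<lambda>_. ennreal B"])
      show "(\<lambda>\<omega>. \<integral>\<^sup>+t. u (s n) t (path \<omega>) \<partial>exp_dist \<alpha>) \<in> borel_measurable (P z)" for n
      proof -
        have "(\<lambda>\<omega>. potential \<alpha> N D (shift_path (s n) (path \<omega>))) \<in> borel_measurable (P z)"
          by (rule path_umeas[OF measurable_compose[OF measurable_ucomp_ucomp[OF measurable_shift[OF s0]] Gu]])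
        then show ?thesis by (simp add: shifted[OF s0 rcont_path, symmetric])
      qed
      show "(\<lambda>\<omega>. potential \<alpha> N D (path \<omega>)) \<in> borel_measurable (P z)" by (rule path_umeas[OF Gu])
      show "AE \<omega> in P z. (\<integral>\<^sup>+t. u (s n) t (path \<omega>) \<partial>exp_dist \<alpha>) \<le> ennreal B" for n
      proof (rule AE_I2)
        fix \<omega>
        have "(\<integral>\<^sup>+t. u (s n) t (path \<omega>) \<partial>exp_dist \<alpha>) \<le> (\<integral>\<^sup>+t. ennreal B \<partial>exp_dist \<alpha>)"
          using ND by (intro nn_integral_mono) (auto simp: u_def indicator_def)
        then show "(\<integral>\<^sup>+t. u (s n) t (path \<omega>) \<partial>exp_dist \<alpha>) \<le> ennreal B" using E.emeasure_space_1 by simp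
      qed
      show "AE \<omega> in P z. (\<lambda>n. \<integral>\<^sup>+t. u (s n) t (path \<omega>) \<partial>exp_dist \<alpha>) \<longlonglongrightarrow> potential \<alpha> N D (path \<omega>)"
        by (intro AE_I2 inner) simp
    qed (use prob_space.emeasure_space_1[OF prob, of z] in simp_all)
  qed simp
  have "f \<in> borel_measurable (ucomp borel)" unfolding f_def[abs_def] by (intro nn_integral_P_umeas path_umeas Gu)
  then have "excessive P Z \<alpha> f" unfolding excessive_def umeas_fun_iff using mono lim by blast
  then show ?thesis unfolding f_def[abs_def] .
qed

lemma excessive_right_limit:
  assumes "0 < \<alpha>" "excessive P Z \<alpha> f"
  shows "AE \<omega> in P z. ((\<lambda>s. f (Z s \<omega>)) \<longlongrightarrow> f z) (at_right 0)"
proof -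
  have "AE \<omega> in P z. \<forall>t\<ge>0. ((\<lambda>s. f (Z s \<omega>)) \<longlongrightarrow> f (Z t \<omega>)) (at_right t)"
    using excessive_all assms by blast
  then show ?thesis using start[of z] by eventually_elim auto
qed

end

section \<open>Approximation of the payoff by potentials\<close>


lemma exp_dist_head:
  assumes "0 < r" "0 \<le> s"
  shows "emeasure (exp_dist r) {..<s} = ennreal (1 - exp (- r * s))"
proof -
  interpret E: prob_space "exp_dist r" by (rule prob_space_exp_dist) fact
  have "{..<s} = space (exp_dist r) - {s..}" by auto
  then have "emeasure (exp_dist r) {..<s} = 1 - emeasure (exp_dist r) {s..}"
    using emeasure_compl[of "{s..}" "exp_dist r"] E.emeasure_space_1 by (simp add: sets_exp_dist)
  then show ?thesis using assms by (simp add: exp_dist_tail ennreal_minus flip: ennreal_1)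
qed

context barrier_model
begin

lemma qi_shift_eq:
  assumes p: "rcont p" and s: "0 \<le> s"
  shows "qi (shift_path s p) (ennreal (t - s)) = (\<integral>\<^sup>+u. indicator {s..<t} u * ennreal (qq (snd (p (max 0 u)))) \<partial>lborel)"
proof -
  note rate_measurable[OF p, measurable]
  have "(\<integral>\<^sup>+u. indicator {s..<t} u * ennreal (qq (snd (p (max 0 u)))) \<partial>lborel)
      = (\<integral>\<^sup>+u. indicator {s..<t} (s + u) * ennreal (qq (snd (p (max 0 (s + u))))) \<partial>lborel)"
    by (subst nn_integral_real_affine[where c=1 and t=s]) auto
  also have "\<dots> = qi (shift_path s p) (ennreal (t - s))"
    unfolding qi_def qint_def shift_path_def
  proof (intro nn_integral_cong)
    fix u :: real
    show "indicator {s..<t} (s + u) * ennreal (qq (snd (p (max 0 (s + u)))))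
        = indicator {u. 0 \<le> u \<and> ennreal u < ennreal (t - s)} u * ennreal (qq (snd (p (s + u))))"
    proof (cases "0 \<le> u")
      case True
      then have "(ennreal u < ennreal (t - s)) = (s + u < t)" "max 0 (s + u) = s + u"
        using s by (auto simp: ennreal_less_iff)
      then show ?thesis using True by (simp add: indicator_def)
    qed (simp add: indicator_def)
  qed
  finally show ?thesis ..
qed

text \<open>The rate may be unbounded and the accumulated rate infinite, so the integral over [0, s)
  cannot simply be subtracted. Along decreasing \<open>s n\<close> the integrals over [s n, t)
  increase, and monotone convergence applies.\<close>

lemma qi_shift_tendsto:
  assumes p: "rcont p" and t: "0 < t"
  shows "((\<lambda>s. qi (shift_path s p) (ennreal (t - s))) \<longlongrightarrow> qi p (ennreal t)) (at_right 0)"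
proof (rule tendsto_at_right_sequentially[OF t])
  fix s :: "nat \<Rightarrow> real" assume s: "\<And>n. 0 < s n" "decseq s" "s \<longlonglongrightarrow> 0"
  define f where "f u = ennreal (qq (snd (p (max 0 u))))" for u
  have [measurable]: "f \<in> borel_measurable borel" unfolding f_def[abs_def] by (rule rate_measurable[OF p])
  have "(\<lambda>n. \<integral>\<^sup>+u. indicator {s n..<t} u * f u \<partial>lborel) \<longlonglongrightarrow> (\<integral>\<^sup>+u. indicator {0<..<t} u * f u \<partial>lborel)"
  proof (rule nn_integral_LIMSEQ)
    show "incseq (\<lambda>n u. indicator {s n..<t} u * f u)"
    proof (rule incseq_SucI, rule le_funI)
      fix n u
      have "s (Suc n) \<le> s n" using s(2) by (rule decseq_SucD)
      then show "indicator {s n..<t} u * f u \<le> indicator {s (Suc n)..<t} u * f u"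
        by (intro mult_right_mono indicator_leI) auto
    qed
    fix u
    show "(\<lambda>n. indicator {s n..<t} u * f u) \<longlonglongrightarrow> indicator {0<..<t} u * f u"
    proof (cases "0 < u")
      case True
      have "\<forall>\<^sub>F n in sequentially. indicator {0<..<t} u * f u = indicator {s n..<t} u * f u"
        using order_tendstoD(2)[OF s(3) True] by eventually_elim (use True in \<open>auto simp: indicator_def\<close>)
      then show ?thesis by (rule Lim_transform_eventually[OF tendsto_const])
    next
      case False
      then have "\<not> s n \<le> u" for n using s(1)[of n] by auto
      then show ?thesis using False by simp
    qed
  qed measurable
  also have "(\<integral>\<^sup>+u. indicator {0<..<t} u * f u \<partial>lborel) = (\<integral>\<^sup>+u. indicator {0..<t} u * f u \<partial>lborel)"
    using AE_lborel_singleton[of 0] by (intro nn_integral_cong_AE, eventually_elim) (auto simp: indicator_def)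
  also have "\<dots> = qi p (ennreal t)"
    using qi_shift_eq[OF p order_refl, of t] by (simp add: f_def shift_path_def)
  finally show "(\<lambda>n. qi (shift_path (s n) p) (ennreal (t - s n))) \<longlonglongrightarrow> qi p (ennreal t)"
    using qi_shift_eq[OF p less_imp_le[OF s(1)]] by (simp add: f_def)
qed

end

section \<open>Survival weights and the effect of early arrivals\<close>

context additive_model
begin

text \<open>The raise by \<open>c\<close> is built into \<open>alive\<close> and \<open>disc\<close>
  so that the potentials can be followed along paths that start at level 0.\<close>

definition alive :: "real \<Rightarrow> real \<Rightarrow> (real \<Rightarrow> real \<times> 'e) \<Rightarrow> ennreal" where
  "alive c t p = (if ennreal t \<le> tau True (transl c p) then 1 else 0)"

definition disc :: "real \<Rightarrow> real \<Rightarrow> (real \<Rightarrow> real \<times> 'e) \<Rightarrow> ennreal" where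
  "disc c t p = (if ennreal t \<le> tau True (transl c p) then exp_neg (qi p (ennreal t)) else 0)"

text \<open>Survival and discount decrease with elapsed time; taking complements reverses the shift
  inequality into the one demanded of a weight.\<close>

lemma admissible_complement:
  assumes m: "(\<lambda>(t, p). m t p) \<in> borel_measurable (borel \<Otimes>\<^sub>M path_space)" "\<And>t p. m t p \<le> 1"
    and mono: "\<And>p s t. rcont p \<Longrightarrow> 0 \<le> s \<Longrightarrow> 0 \<le> t \<Longrightarrow> m (s + t) p \<le> m t (shift_path s p)"
    and lim: "\<And>p t. rcont p \<Longrightarrow> 0 < t \<Longrightarrow> ((\<lambda>s. m (t - s) (shift_path s p)) \<longlongrightarrow> m t p) (at_right 0)"
  shows "admissible (\<lambda>t p. 1 - m t p)"
  unfolding admissible_def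
proof (intro conjI allI impI)
  have [measurable]: "(\<lambda>x. m (fst x) (snd x)) \<in> borel_measurable (borel \<Otimes>\<^sub>M path_space)"
    using m(1) by (simp add: split_beta')
  show "(\<lambda>(t, p). 1 - m t p) \<in> borel_measurable (borel \<Otimes>\<^sub>M path_space)" unfolding split_beta' by measurable
  show "1 - m t p \<le> 1" for t p by (rule diff_le_self_ennreal)
  show "1 - m t (shift_path s p) \<le> 1 - m (s + t) p" if "rcont p" "0 \<le> s" "0 \<le> t" for p s t
    by (rule ennreal_minus_mono[OF order_refl mono[OF that]])
  show "((\<lambda>s. 1 - m (t - s) (shift_path s p)) \<longlongrightarrow> 1 - m t p) (at_right 0)" if "rcont p" "0 < t" for p t
    using m(2)[of t p] by (intro tendsto_diff_ennreal tendsto_const lim that) (auto simp: top_unique)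
qed

lemma admissible_one: "admissible (\<lambda>_ _. 1)"
  by (simp add: admissible_def)

lemma tau_transl_measurable: "(\<lambda>p. tau True (transl c p)) \<in> borel_measurable path_space"
  by (rule measurable_compose[OF measurable_transl tau_True_path_measurable])

lemma le_tau_shift:
  assumes p: "rcont p" and st: "0 \<le> s" "0 \<le> t" and le: "ennreal (s + t) \<le> tau k p"
  shows "ennreal t \<le> tau k (shift_path s p)"
proof -
  have "ennreal s \<le> ennreal (s + t)" using st by (intro ennreal_leI) auto
  then have "ennreal s \<le> tau k p" using le by (rule order_trans)
  then have "ennreal s + ennreal t \<le> ennreal s + tau k (shift_path s p)"
    using tau_shift[OF p st(1)] le st by simp
  then show ?thesis by (simp add: ennreal_add_left_cancel_le)
qed

text \<open>Ruin before \<open>t\<close> is witnessed by a negative value at some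
  \<open>u > 0\<close>, and every shift by less than \<open>u\<close> still sees it. A passage at
  time 0 would be lost by every shift, which is why \<open>tau True\<close> is used here.\<close>

lemma eventually_le_tau_shift:
  assumes p: "rcont p" and t: "0 < t"
  shows "\<forall>\<^sub>F s in at_right 0. ennreal (t - s) \<le> tau True (shift_path s p) \<longleftrightarrow> ennreal t \<le> tau True p"
proof (cases "ennreal t \<le> tau True p")
  case True
  show ?thesis using eventually_at_right_real[OF t]
  proof eventually_elim
    fix s assume "s \<in> {0<..<t}"
    then show "ennreal (t - s) \<le> tau True (shift_path s p) \<longleftrightarrow> ennreal t \<le> tau True p"
      using le_tau_shift[OF p, of s "t - s" True] True by auto
  qed
next
  case False
  then obtain u where u: "0 < u" "ennreal u < ennreal t" "fst (p u) < 0" by (auto simp: not_le tau_True_less_iff)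
  then have ut: "u < t" by (simp add: ennreal_less_iff)
  show ?thesis using eventually_at_right_real[OF u(1)]
  proof eventually_elim
    fix s assume s: "s \<in> {0<..<u}"
    then have "tau True (shift_path s p) \<le> ennreal (u - s)" using u by (intro tau_lower) (auto simp: shift_path_def)
    also have "\<dots> < ennreal (t - s)" using s ut by (intro ennreal_lessI) auto
    finally have "\<not> ennreal (t - s) \<le> tau True (shift_path s p)" by (simp only: not_le)
    then show "ennreal (t - s) \<le> tau True (shift_path s p) \<longleftrightarrow> ennreal t \<le> tau True p" using False by blast
  qed
qed

lemma admissible_alive: "admissible (\<lambda>t p. 1 - alive c t p)"
proof (rule admissible_complement)
  note tau_transl_measurable[of c, measurable]
  show "(\<lambda>(t, p). alive c t p) \<in> borel_measurable (borel \<Otimes>\<^sub>M path_space)"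
    unfolding alive_def split_beta' by measurable
  show "alive c t p \<le> 1" for t p by (simp add: alive_def)
  show "alive c (s + t) p \<le> alive c t (shift_path s p)" if "rcont p" "0 \<le> s" "0 \<le> t" for p s t
    using le_tau_shift[OF rcont_transl[OF that(1)] that(2,3)] by (auto simp: alive_def transl_shift)
  show "((\<lambda>s. alive c (t - s) (shift_path s p)) \<longlongrightarrow> alive c t p) (at_right 0)" if "rcont p" "0 < t" for p t
  proof (rule Lim_transform_eventually[OF tendsto_const])
    show "\<forall>\<^sub>F s in at_right 0. alive c t p = alive c (t - s) (shift_path s p)"
      using eventually_le_tau_shift[OF rcont_transl[OF that(1)] that(2), of c]
      by eventually_elim (simp add: alive_def transl_shift)
  qed
qed

lemma admissible_disc: "admissible (\<lambda>t p. 1 - disc c t p)"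
proof (rule admissible_complement)
  note tau_transl_measurable[of c, measurable]
  have "(\<lambda>x. (\<lambda>(p, T). qi (\<lambda>t. p t) T) (snd x, ennreal (fst x))) \<in> borel_measurable (borel \<Otimes>\<^sub>M path_space)"
    by (rule measurable_compose[OF _ qi_measurable[OF path_proc]]) measurable
  then have [measurable]: "(\<lambda>x. qi (snd x) (ennreal (fst x))) \<in> borel_measurable (borel \<Otimes>\<^sub>M path_space)" by simp
  show "(\<lambda>(t, p). disc c t p) \<in> borel_measurable (borel \<Otimes>\<^sub>M path_space)"
    unfolding disc_def split_beta' by measurable
  show "disc c t p \<le> 1" for t p by (simp add: disc_def exp_neg_le_1)
  show "disc c (s + t) p \<le> disc c t (shift_path s p)" if "rcont p" "0 \<le> s" "0 \<le> t" for p s t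
  proof -
    have "qi (shift_path s p) (ennreal t) \<le> qi p (ennreal (s + t))"
      using qi_add[OF that(1,2), of "ennreal t"] that by (simp add: add_increasing)
    then show ?thesis
      using le_tau_shift[OF rcont_transl[OF that(1)] that(2,3)] by (auto simp: disc_def transl_shift intro: exp_neg_mono)
  qed
  show "((\<lambda>s. disc c (t - s) (shift_path s p)) \<longlongrightarrow> disc c t p) (at_right 0)" if "rcont p" "0 < t" for p t
  proof (rule Lim_transform_eventually)
    show "\<forall>\<^sub>F s in at_right 0. (if ennreal t \<le> tau True (transl c p) then exp_neg (qi (shift_path s p) (ennreal (t - s))) else 0)
        = disc c (t - s) (shift_path s p)"
      using eventually_le_tau_shift[OF rcont_transl[OF that(1)] that(2), of c]
      by eventually_elim (simp add: disc_def transl_shift)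
    show "((\<lambda>s. if ennreal t \<le> tau True (transl c p) then exp_neg (qi (shift_path s p) (ennreal (t - s))) else 0) \<longlongrightarrow> disc c t p) (at_right 0)"
      using tendsto_exp_neg[OF qi_shift_tendsto[OF that]] by (simp add: disc_def)
  qed
qed

lemma payoff_path_measurable:
  assumes "R \<in> sets borel"
  shows "(\<lambda>(p, rs). payoff True R p rs) \<in> borel_measurable (path_space \<Otimes>\<^sub>M S)"
proof -
  have "(\<lambda>(p, rs). payoff True R (\<lambda>t. p t) rs) \<in> borel_measurable (path_space \<Otimes>\<^sub>M stream_space borel)"
    by (rule payoff_measurable[OF path_proc assms]) (rule tau_True_path_measurable)
  then show ?thesis by (simp cong: measurable_cong_sets add: sets_S)
qed

lemma mean_payoff_measurable:
  assumes "R \<in> sets borel" shows "mean_payoff True R \<in> borel_measurable path_space"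
proof -
  interpret S: prob_space S by (rule prob_S)
  show ?thesis unfolding mean_payoff_def[abs_def]
    by (rule S.borel_measurable_nn_integral) (rule payoff_path_measurable[OF assms])
qed

text \<open>The first waiting time is split at \<open>t\<close>. Early arrivals have probability
  \<open>1 - exp (- r * t)\<close> and pay at most \<beta>, which bounds \<open>A\<close>; otherwise
  the clock restarts at \<open>t\<close>.\<close>

lemma mean_payoff_split:
  assumes R: "R \<in> sets borel" and p: "rcont p" and t: "0 \<le> t" and le: "ennreal t \<le> tau True p"
  obtains A where "A \<le> ennreal (\<beta> * (1 - exp (- r * t)))"
    "mean_payoff True R p = A + ennreal (exp (- r * t)) * (exp_neg (qi p (ennreal t)) * mean_payoff True R (shift_path t p))"
proof -
  interpret S: prob_space S by (rule prob_S)
  interpret E: prob_space "exp_dist r" by (rule prob_\<nu>)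
  let ?L = "exp_neg (qi p (ennreal t))"
  define h where "h p u = (\<integral>\<^sup>+ rs. payoff True R p (u ## rs) \<partial>S)" for p u
  have hm: "h p \<in> borel_measurable borel" if "rcont p" for p
  proof -
    have "payoff True R p \<in> borel_measurable S"
      using measurable_compose[OF measurable_Pair1' payoff_path_measurable[OF R], of p] that by simp
    then have "(\<lambda>x. payoff True R p (fst x ## snd x)) \<in> borel_measurable (borel \<Otimes>\<^sub>M S)"
      by (rule measurable_compose[rotated]) measurable
    then have "(\<lambda>(u, rs). payoff True R p (u ## rs)) \<in> borel_measurable (borel \<Otimes>\<^sub>M S)"
      by (simp add: split_beta')
    then show ?thesis unfolding h_def[abs_def] by (rule S.borel_measurable_nn_integral)
  qed
  note [measurable] = hm[OF p] hm[OF rcont_shift[OF p t]]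
  have h_le: "h p u \<le> ennreal \<beta>" for u
  proof -
    have "h p u \<le> (\<integral>\<^sup>+ rs. ennreal \<beta> \<partial>S)" unfolding h_def by (intro nn_integral_mono payoff_le)
    then show ?thesis using S.emeasure_space_1 by simp
  qed
  have h_shift: "h p u = ?L * h (shift_path t p) (u - t)" if u: "t < u" for u
  proof -
    have "h p u = (\<integral>\<^sup>+ rs. ?L * payoff True R (shift_path t p) ((u - t) ## rs) \<partial>S)"
      unfolding h_def using AE_S_pos
    proof (intro nn_integral_cong_AE, eventually_elim)
      fix rs :: "real stream" assume "\<forall>n. 0 < rs !! n"
      then show "payoff True R p (u ## rs) = ?L * payoff True R (shift_path t p) ((u - t) ## rs)"
        using payoff_memoryless[OF p t, of "u - t" rs True R] u le by simp
    qed
    also have "\<dots> = ?L * h (shift_path t p) (u - t)" unfolding h_def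
    proof (rule nn_integral_cmult)
      have "payoff True R (shift_path t p) \<in> borel_measurable S"
        using measurable_compose[OF measurable_Pair1' payoff_path_measurable[OF R], of "shift_path t p"] rcont_shift[OF p t] by simp
      then show "(\<lambda>rs. payoff True R (shift_path t p) ((u - t) ## rs)) \<in> borel_measurable S"
        by (rule measurable_compose[rotated]) measurable
    qed
    finally show ?thesis .
  qed
  have "mean_payoff True R p = (\<integral>\<^sup>+u. h p u \<partial>exp_dist r)"
    unfolding h_def by (rule mean_payoff_first[OF R p])
  also have "\<dots> = (\<integral>\<^sup>+u. indicator {..<t} u * h p u + indicator {t..} u * h p u \<partial>exp_dist r)"
    by (intro nn_integral_cong) (auto simp: indicator_def)
  also have "\<dots> = (\<integral>\<^sup>+u. indicator {..<t} u * h p u \<partial>exp_dist r) + (\<integral>\<^sup>+u. indicator {t..} u * h p u \<partial>exp_dist r)"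
    by (rule nn_integral_add) measurable
  \<comment> \<open>The residual waiting time must be strictly positive for the restart, so the null
    event that the arrival falls exactly at \<open>t\<close> is dropped.\<close>
  also have "(\<integral>\<^sup>+u. indicator {t..} u * h p u \<partial>exp_dist r) = (\<integral>\<^sup>+u. indicator {t..} u * (?L * h (shift_path t p) (u - t)) \<partial>exp_dist r)"
    using exp_dist_AE_neq[of "ennreal t"] exp_dist_AE_pos
    by (intro nn_integral_cong_AE, eventually_elim) (auto simp: indicator_def less_le intro!: h_shift)
  also have "\<dots> = ennreal (exp (- r * t)) * (\<integral>\<^sup>+u. ?L * h (shift_path t p) u \<partial>exp_dist r)"
    by (rule exp_dist_shift[OF r_pos t, symmetric]) measurable
  also have "(\<integral>\<^sup>+u. ?L * h (shift_path t p) u \<partial>exp_dist r) = ?L * mean_payoff True R (shift_path t p)"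
    unfolding mean_payoff_first[OF R rcont_shift[OF p t]] h_def[symmetric] by (rule nn_integral_cmult) measurable
  finally have eq: "mean_payoff True R p = (\<integral>\<^sup>+u. indicator {..<t} u * h p u \<partial>exp_dist r)
      + ennreal (exp (- r * t)) * (?L * mean_payoff True R (shift_path t p))" .
  have "(\<integral>\<^sup>+u. indicator {..<t} u * h p u \<partial>exp_dist r) \<le> (\<integral>\<^sup>+u. ennreal \<beta> * indicator {..<t} u \<partial>exp_dist r)"
    by (intro nn_integral_mono) (auto simp: indicator_def h_le)
  also have "\<dots> = ennreal (\<beta> * (1 - exp (- r * t)))"
    using exp_dist_head[OF r_pos t] beta r_pos t by (simp add: nn_integral_cmult_indicator sets_exp_dist ennreal_mult)
  finally show ?thesis using eq by (rule that)
qed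

text \<open>For a surviving path the early arrivals contribute at most \<beta> times their
  probability, and replacing the late-arrival factor \<open>exp (- r * t)\<close> by 1 costs no
  more. After ruin \<open>disc\<close> is 0, and the trivial bound \<beta> is charged to the
  complement of \<open>alive\<close>.\<close>

lemma mean_payoff_bounds:
  fixes R c
  defines "D \<equiv> \<lambda>p. mean_payoff True R (transl c p)"
  assumes R: "R \<in> sets borel" and p: "rcont p" and t: "0 \<le> t"
  shows "D p \<le> disc c t p * D (shift_path t p) + (ennreal (\<beta> * (1 - exp (- r * t))) + ennreal \<beta> * (1 - alive c t p))"
    and "disc c t p * D (shift_path t p) \<le> D p + ennreal (\<beta> * (1 - exp (- r * t)))"
proof -
  let ?e = "exp (- r * t)"
  have e: "0 \<le> 1 - ?e" "0 \<le> ?e" using r_pos t by auto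
  have both: "D p \<le> disc c t p * D (shift_path t p) + (ennreal (\<beta> * (1 - ?e)) + ennreal \<beta> * (1 - alive c t p))
    \<and> disc c t p * D (shift_path t p) \<le> D p + ennreal (\<beta> * (1 - ?e))"
  proof (cases "ennreal t \<le> tau True (transl c p)")
    case True
    let ?x = "disc c t p * D (shift_path t p)"
    obtain A where A: "A \<le> ennreal (\<beta> * (1 - ?e))" "D p = A + ennreal ?e * ?x"
      using mean_payoff_split[OF R rcont_transl[OF p] t True]
      by (auto simp: D_def disc_def True transl_shift)
    have x: "?x \<le> ennreal \<beta>"
      using mult_mono[OF exp_neg_le_1[of "qi p (ennreal t)"] mean_payoff_le[of True R "transl c (shift_path t p)"]] True
      by (simp add: disc_def D_def)
    have "ennreal ?e * ?x \<le> 1 * ?x" using r_pos t by (intro mult_right_mono) auto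
    then have 1: "D p \<le> ?x + ennreal (\<beta> * (1 - ?e))"
      using A by (simp add: add.commute add_mono)
    have "?x = ennreal (?e + (1 - ?e)) * ?x" by simp
    also have "\<dots> = ennreal ?e * ?x + ennreal (1 - ?e) * ?x"
      by (subst ennreal_plus) (use e in \<open>simp_all add: distrib_right\<close>)
    also have "\<dots> \<le> D p + ennreal (1 - ?e) * ennreal \<beta>"
      using A x by (intro add_mono mult_left_mono) auto
    also have "ennreal (1 - ?e) * ennreal \<beta> = ennreal (\<beta> * (1 - ?e))"
      using e beta by (simp add: ennreal_mult mult.commute)
    finally show ?thesis using 1 by (auto simp: add.assoc[symmetric] intro: add_increasing2)
  next
    case False
    then show ?thesis using mean_payoff_le[of True R "transl c p"]
      by (auto simp: disc_def alive_def D_def intro: add_increasing)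
  qed
  show "D p \<le> disc c t p * D (shift_path t p) + (ennreal (\<beta> * (1 - exp (- r * t))) + ennreal \<beta> * (1 - alive c t p))"
    using both by blast
  show "disc c t p * D (shift_path t p) \<le> D p + ennreal (\<beta> * (1 - exp (- r * t)))"
    using both by blast
qed

end

section \<open>Right limits of the value function\<close>


context additive_model
begin

lemma potential_integrand_measurable_t:
  assumes "admissible N" "D \<in> borel_measurable path_space" "rcont p"
  shows "(\<lambda>t. N t p * D (shift_path (max 0 t) p)) \<in> borel_measurable (exp_dist \<alpha>)"
proof -
  have "(\<lambda>t. N t p * D (shift_path (max 0 t) p)) \<in> borel_measurable borel"
    using measurable_compose[OF measurable_Pair2' potential_integrand_measurable[OF assms(1,2)], of p] assms(3) by simp
  then show ?thesis by (simp cong: measurable_cong_sets add: sets_exp_dist)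
qed

text \<open>\<beta> times the probability that an arrival of rate \<open>r\<close> precedes an
  independent clock of rate \<alpha>.\<close>

lemma early_arrival_mass:
  assumes "0 < \<alpha>"
  shows "(\<integral>\<^sup>+t. ennreal (\<beta> * (1 - exp (- r * t))) \<partial>exp_dist \<alpha>) = ennreal (\<beta> * (r / (\<alpha> + r)))"
proof -
  interpret E: prob_space "exp_dist \<alpha>" by (rule prob_space_exp_dist) fact
  let ?I = "\<integral>\<^sup>+t. ennreal (1 - exp (- r * t)) \<partial>exp_dist \<alpha>"
  have "?I + ennreal (\<alpha> / (\<alpha> + r)) = (\<integral>\<^sup>+t. ennreal (1 - exp (- r * t)) + ennreal (exp (- r * t)) \<partial>exp_dist \<alpha>)"
    unfolding exp_dist_laplace[OF assms r_pos, symmetric] by (rule nn_integral_add[symmetric]) measurable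
  also have "\<dots> = (\<integral>\<^sup>+t. 1 \<partial>exp_dist \<alpha>)"
    using exp_dist_AE_pos[of \<alpha>]
    by (intro nn_integral_cong_AE, eventually_elim) (use r_pos in \<open>auto simp flip: ennreal_plus\<close>)
  also have "\<dots> = 1" using E.emeasure_space_1 by simp
  finally have "?I + ennreal (\<alpha> / (\<alpha> + r)) = 1" .
  then have "?I = 1 - ennreal (\<alpha> / (\<alpha> + r))" by (metis ennreal_add_diff_cancel_right ennreal_neq_top)
  also have "\<dots> = ennreal (r / (\<alpha> + r))"
    using assms r_pos by (simp add: ennreal_minus field_simps flip: ennreal_1)
  finally have I: "?I = ennreal (r / (\<alpha> + r))" .
  have "(\<integral>\<^sup>+t. ennreal (\<beta> * (1 - exp (- r * t))) \<partial>exp_dist \<alpha>) = (\<integral>\<^sup>+t. ennreal \<beta> * ennreal (1 - exp (- r * t)) \<partial>exp_dist \<alpha>)"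
    using beta by (intro nn_integral_cong) (simp add: ennreal_mult')
  also have "\<dots> = ennreal \<beta> * ?I" by (rule nn_integral_cmult) measurable
  also have "\<dots> = ennreal (\<beta> * (r / (\<alpha> + r)))"
    unfolding I by (rule ennreal_mult[symmetric]) (use assms r_pos beta in auto)
  finally show ?thesis .
qed

definition mean_at :: "(real \<times> 'e) set \<Rightarrow> real \<Rightarrow> (real \<Rightarrow> real \<times> 'e) \<Rightarrow> ennreal" where
  "mean_at R c p = mean_payoff True R (transl c p)"

lemma mean_at_measurable: "R \<in> sets borel \<Longrightarrow> mean_at R c \<in> borel_measurable path_space"
  unfolding mean_at_def[abs_def]
  by (rule measurable_compose[OF measurable_transl mean_payoff_measurable])

text \<open>The estimate at a fixed time is averaged over the clock, with \<open>disc\<close> split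
  as 1 minus its complement. The negative part is moved across the inequality, which avoids
  truncated subtraction in \<open>ennreal\<close>.\<close>

lemma potential_bounds:
  assumes R: "R \<in> sets borel" and \<alpha>: "0 < \<alpha>" and p: "rcont p"
  shows "(mean_at R c) p + potential \<alpha> (\<lambda>t p. 1 - disc c t p) (mean_at R c) p
      \<le> potential \<alpha> (\<lambda>_ _. 1) (mean_at R c) p + (ennreal (\<beta> * (r / (\<alpha> + r))) + ennreal \<beta> * potential \<alpha> (\<lambda>t p. 1 - alive c t p) (\<lambda>_. 1) p)"
    and "potential \<alpha> (\<lambda>_ _. 1) (mean_at R c) p
      \<le> (mean_at R c) p + potential \<alpha> (\<lambda>t p. 1 - disc c t p) (mean_at R c) p + ennreal (\<beta> * (r / (\<alpha> + r)))"
proof -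
  interpret E: prob_space "exp_dist \<alpha>" by (rule prob_space_exp_dist) fact
  let ?D' = "\<lambda>t. (mean_at R c) (shift_path (max 0 t) p)"
  let ?e = "\<lambda>t. ennreal (\<beta> * (1 - exp (- r * t)))"
  note [measurable] = potential_integrand_measurable_t[OF admissible_disc mean_at_measurable[OF R, of c] p, where \<alpha>=\<alpha>]
    potential_integrand_measurable_t[OF admissible_alive measurable_const p, where \<alpha>=\<alpha>, of "1::ennreal" c]
    potential_integrand_measurable_t[OF admissible_one mean_at_measurable[OF R, of c] p, where \<alpha>=\<alpha>]
  have const: "(mean_at R c) p = (\<integral>\<^sup>+t. (mean_at R c) p \<partial>exp_dist \<alpha>)" using E.emeasure_space_1 by simp
  have split: "disc c t p * x + (1 - disc c t p) * x = x" for t x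
    using exp_neg_le_1 by (simp add: disc_def add_diff_inverse_ennreal flip: distrib_right)
  have "(mean_at R c) p + potential \<alpha> (\<lambda>t p. 1 - disc c t p) (mean_at R c) p = (\<integral>\<^sup>+t. (mean_at R c) p + (1 - disc c t p) * ?D' t \<partial>exp_dist \<alpha>)"
    unfolding potential_def by (subst const, rule nn_integral_add[symmetric]) measurable
  also have "\<dots> \<le> (\<integral>\<^sup>+t. 1 * ?D' t + (?e t + ennreal \<beta> * ((1 - alive c t p) * 1)) \<partial>exp_dist \<alpha>)"
    using exp_dist_AE_pos
  proof (intro nn_integral_mono_AE, eventually_elim)
    fix t :: real assume "0 < t"
    then have "(mean_at R c) p \<le> disc c t p * ?D' t + (?e t + ennreal \<beta> * (1 - alive c t p))"
      using mean_payoff_bounds(1)[OF R p, of t c, folded mean_at_def] by simp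
    then have "(mean_at R c) p + (1 - disc c t p) * ?D' t \<le> (disc c t p * ?D' t + (?e t + ennreal \<beta> * (1 - alive c t p))) + (1 - disc c t p) * ?D' t"
      by (rule add_right_mono)
    also have "\<dots> = (disc c t p * ?D' t + (1 - disc c t p) * ?D' t) + (?e t + ennreal \<beta> * (1 - alive c t p))"
      by (simp add: ac_simps)
    finally show "(mean_at R c) p + (1 - disc c t p) * ?D' t \<le> 1 * ?D' t + (?e t + ennreal \<beta> * ((1 - alive c t p) * 1))"
      unfolding split by simp
  qed
  also have "\<dots> = potential \<alpha> (\<lambda>_ _. 1) (mean_at R c) p + (\<integral>\<^sup>+t. ?e t + ennreal \<beta> * ((1 - alive c t p) * 1) \<partial>exp_dist \<alpha>)"
    unfolding potential_def by (rule nn_integral_add) measurable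
  also have "(\<integral>\<^sup>+t. ?e t + ennreal \<beta> * ((1 - alive c t p) * 1) \<partial>exp_dist \<alpha>)
      = (\<integral>\<^sup>+t. ?e t \<partial>exp_dist \<alpha>) + (\<integral>\<^sup>+t. ennreal \<beta> * ((1 - alive c t p) * 1) \<partial>exp_dist \<alpha>)"
    by (rule nn_integral_add) measurable
  also have "(\<integral>\<^sup>+t. ennreal \<beta> * ((1 - alive c t p) * 1) \<partial>exp_dist \<alpha>) = ennreal \<beta> * potential \<alpha> (\<lambda>t p. 1 - alive c t p) (\<lambda>_. 1) p"
    unfolding potential_def by (rule nn_integral_cmult) measurable
  finally show "(mean_at R c) p + potential \<alpha> (\<lambda>t p. 1 - disc c t p) (mean_at R c) p
      \<le> potential \<alpha> (\<lambda>_ _. 1) (mean_at R c) p + (ennreal (\<beta> * (r / (\<alpha> + r))) + ennreal \<beta> * potential \<alpha> (\<lambda>t p. 1 - alive c t p) (\<lambda>_. 1) p)"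
    unfolding early_arrival_mass[OF \<alpha>] .
  have "potential \<alpha> (\<lambda>_ _. 1) (mean_at R c) p \<le> (\<integral>\<^sup>+t. ((mean_at R c) p + (1 - disc c t p) * ?D' t) + ?e t \<partial>exp_dist \<alpha>)"
    unfolding potential_def using exp_dist_AE_pos
  proof (intro nn_integral_mono_AE, eventually_elim)
    fix t :: real assume "0 < t"
    then have "disc c t p * ?D' t \<le> (mean_at R c) p + ?e t" using mean_payoff_bounds(2)[OF R p, of t c, folded mean_at_def] by simp
    then have "disc c t p * ?D' t + (1 - disc c t p) * ?D' t \<le> ((mean_at R c) p + ?e t) + (1 - disc c t p) * ?D' t"
      by (rule add_right_mono)
    then show "1 * ?D' t \<le> ((mean_at R c) p + (1 - disc c t p) * ?D' t) + ?e t" unfolding split by (simp add: ac_simps)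
  qed
  also have "\<dots> = (\<integral>\<^sup>+t. (mean_at R c) p + (1 - disc c t p) * ?D' t \<partial>exp_dist \<alpha>) + (\<integral>\<^sup>+t. ?e t \<partial>exp_dist \<alpha>)"
    by (rule nn_integral_add) measurable
  also have "(\<integral>\<^sup>+t. (mean_at R c) p + (1 - disc c t p) * ?D' t \<partial>exp_dist \<alpha>) = (mean_at R c) p + potential \<alpha> (\<lambda>t p. 1 - disc c t p) (mean_at R c) p"
    unfolding potential_def by (subst (2) const, rule nn_integral_add) measurable
  finally show "potential \<alpha> (\<lambda>_ _. 1) (mean_at R c) p
      \<le> (mean_at R c) p + potential \<alpha> (\<lambda>t p. 1 - disc c t p) (mean_at R c) p + ennreal (\<beta> * (r / (\<alpha> + r)))"
    unfolding early_arrival_mass[OF \<alpha>] .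
qed

lemma potential_le:
  assumes "0 < \<alpha>" "admissible N" "\<And>p. D p \<le> ennreal B"
  shows "potential \<alpha> N D p \<le> ennreal B"
proof -
  interpret E: prob_space "exp_dist \<alpha>" by (rule prob_space_exp_dist) fact
  have "N t p * D p' \<le> ennreal B" for t p'
    using mult_mono[OF _ assms(3), of "N t p" 1 p'] assms(2) by (simp add: admissible_def)
  then have "potential \<alpha> N D p \<le> (\<integral>\<^sup>+t. ennreal B \<partial>exp_dist \<alpha>)"
    unfolding potential_def by (intro nn_integral_mono)
  then show ?thesis using E.emeasure_space_1 by simp
qed

lemma mean_path_le:
  assumes "\<And>p. K p \<le> ennreal B"
  shows "(\<integral>\<^sup>+\<omega>. K (path \<omega>) \<partial>P z) \<le> ennreal B"
proof -
  have "(\<integral>\<^sup>+\<omega>. K (path \<omega>) \<partial>P z) \<le> (\<integral>\<^sup>+\<omega>. ennreal B \<partial>P z)" by (intro nn_integral_mono assms)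
  then show ?thesis using prob_space.emeasure_space_1[OF prob, of z] by simp
qed

text \<open>On a path that survives past some \<open>d > 0\<close>, ruin before the clock forces the
  clock to exceed \<open>d\<close>, an event of probability
  \<open>exp (- (real (Suc n)) * d)\<close>. Dominated convergence then averages over paths.\<close>

lemma early_ruin_vanishes:
  assumes pos: "AE \<omega> in P z. 0 < tau True (transl c (path \<omega>))"
  shows "(\<lambda>n. \<integral>\<^sup>+\<omega>. potential (real (Suc n)) (\<lambda>t p. 1 - alive c t p) (\<lambda>_. 1) (path \<omega>) \<partial>P z) \<longlonglongrightarrow> 0"
proof -
  let ?A = "\<lambda>n \<omega>. potential (real (Suc n)) (\<lambda>t p. 1 - alive c t p) (\<lambda>_. 1) (path \<omega>)"
  have "(\<lambda>n. \<integral>\<^sup>+\<omega>. ?A n \<omega> \<partial>P z) \<longlonglongrightarrow> (\<integral>\<^sup>+\<omega>. 0 \<partial>P z)"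
  proof (rule nn_integral_dominated_convergence[where w="\<lambda>_. 1"])
    show "?A n \<in> borel_measurable (P z)" for n
      by (intro path_umeas measurable_ucompI potential_measurable admissible_alive measurable_const) auto
    show "AE \<omega> in P z. ?A n \<omega> \<le> 1" for n
      using potential_le[OF _ admissible_alive, of "real (Suc n)" "\<lambda>_. 1" 1] by simp
    show "AE \<omega> in P z. (\<lambda>n. ?A n \<omega>) \<longlonglongrightarrow> 0"
      using pos
    proof eventually_elim
      fix \<omega> assume "0 < tau True (transl c (path \<omega>))"
      then obtain d where d: "0 < d" "ennreal d < tau True (transl c (path \<omega>))"
      proof (cases "tau True (transl c (path \<omega>))")
        case (real x)
        then show ?thesis using that[of "x / 2"] \<open>0 < tau True (transl c (path \<omega>))\<close> by (auto simp: ennreal_less_iff)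
      next
        case top
        then show ?thesis using that[of 1] by auto
      qed
      have "?A n \<omega> \<le> ennreal (exp (- (real (Suc n)) * d))" for n
      proof -
        have "?A n \<omega> \<le> (\<integral>\<^sup>+t. indicator {d..} t \<partial>exp_dist (real (Suc n)))"
          unfolding potential_def
        proof (intro nn_integral_mono)
          fix t :: real
          show "(1 - alive c t (path \<omega>)) * 1 \<le> indicator {d..} t"
          proof (cases "d \<le> t")
            case False
            then have "ennreal t \<le> ennreal d" by (intro ennreal_leI) simp
            then have "ennreal t \<le> tau True (transl c (path \<omega>))" using d(2) by (meson less_imp_le order_trans)
            then show ?thesis by (simp add: alive_def)
          qed (simp add: diff_le_self_ennreal)
        qed
        also have "\<dots> = ennreal (exp (- (real (Suc n)) * d))"
          using exp_dist_tail[of "real (Suc n)" d] d(1) by (simp add: sets_exp_dist)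
        finally show ?thesis .
      qed
      moreover have "(\<lambda>n. ennreal (exp (- (real (Suc n)) * d))) \<longlonglongrightarrow> ennreal 0"
      proof (rule tendsto_ennrealI)
        have "exp (- (real (Suc n)) * d) = exp (- d) ^ Suc n" for n
          by (simp only: exp_of_nat_mult[symmetric] minus_mult_commute)
        moreover have "(\<lambda>n. exp (- d) ^ Suc n) \<longlonglongrightarrow> 0"
          using LIMSEQ_power_zero[of "exp (- d)"] d(1) by (intro LIMSEQ_Suc) auto
        ultimately show "(\<lambda>n. exp (- (real (Suc n)) * d)) \<longlonglongrightarrow> 0" by presburger
      qed
      ultimately show "(\<lambda>n. ?A n \<omega>) \<longlonglongrightarrow> 0"
        by (intro tendsto_sandwich[OF always_eventually always_eventually tendsto_const, of 0 "\<lambda>n. ?A n \<omega>"]) auto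
    qed
  qed (use prob_space.emeasure_space_1[OF prob, of z] in simp_all)
  then show ?thesis by simp
qed

lemma tau_transl_pos:
  assumes "0 < c"
  shows "AE \<omega> in P (0, y). 0 < tau True (transl c (path \<omega>))"
  using start[of "(0, y)"]
proof eventually_elim
  fix \<omega> assume "Z 0 \<omega> = (0, y)"
  then have "- c < fst (path \<omega> 0)" using assms by (simp add: path_def)
  then have "\<forall>\<^sub>F s in at_right 0. - c < fst (path \<omega> s)"
    using order_tendstoD(1)[OF rcont_fst[OF rcont_path order_refl]] by blast
  then obtain b where b: "0 < b" "\<And>s. 0 < s \<Longrightarrow> s < b \<Longrightarrow> - c < fst (path \<omega> s)"
    by (auto simp: eventually_at_right_field)
  have "ennreal b \<le> tau True (transl c (path \<omega>))"
    using b by (subst le_tau_iff) (force simp: transl_def)+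
  moreover have "0 < ennreal b" using b(1) by simp
  ultimately show "0 < tau True (transl c (path \<omega>))" by (rule less_le_trans[rotated])
qed

text \<open>Up to a uniformly small error and the chance of an early ruin, the value function is the difference
  of two potentials that are excessive for the whole process, so it inherits their right-continuity along paths.\<close>

lemma V_right_limit:
  assumes R: "R \<in> sets borel" and c: "0 < c"
  shows "AE \<omega> in P (0, y). ((\<lambda>s. V True R (c + fst (Z s \<omega>), snd (Z s \<omega>))) \<longlongrightarrow> V True R (c, y)) (at_right 0)"
proof -
  let ?D = "mean_at R c"
  define a where "a n = real (Suc n)" for n
  let ?u = "\<lambda>n \<omega>. potential (a n) (\<lambda>_ _. 1) ?D (path \<omega>)"
  let ?w = "\<lambda>n \<omega>. potential (a n) (\<lambda>t p. 1 - disc c t p) ?D (path \<omega>)"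
  let ?k = "\<lambda>n \<omega>. potential (a n) (\<lambda>t p. 1 - alive c t p) (\<lambda>_. 1) (path \<omega>)"
  have a: "0 < a n" for n by (simp add: a_def)
  define v where "v z = (\<integral>\<^sup>+\<omega>. ?D (path \<omega>) \<partial>P z)" for z
  define u where "u n z = (\<integral>\<^sup>+\<omega>. ?u n \<omega> \<partial>P z)" for n z
  define w where "w n z = (\<integral>\<^sup>+\<omega>. ?w n \<omega> \<partial>P z)" for n z
  define k where "k n z = (\<integral>\<^sup>+\<omega>. ?k n \<omega> \<partial>P z)" for n z
  define e where "e n = \<beta> * (r / (a n + r))" for n
  have e0: "0 \<le> e n" for n using beta r_pos a[of n] by (simp add: e_def)
  note Dm = mean_at_measurable[OF R, of c]
  have one_m: "(\<lambda>_. 1 :: ennreal) \<in> borel_measurable (path_space :: (real \<Rightarrow> real \<times> 'e) measure)" by simp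
  note [measurable] =
    path_umeas[OF measurable_ucompI[OF Dm]]
    path_umeas[OF measurable_ucompI[OF potential_measurable[OF a admissible_one Dm]]]
    path_umeas[OF measurable_ucompI[OF potential_measurable[OF a admissible_disc Dm]]]
    path_umeas[OF measurable_ucompI[OF potential_measurable[OF a admissible_alive one_m]]]
  have D_le: "?D p \<le> ennreal \<beta>" for p unfolding mean_at_def by (rule mean_payoff_le)
  have bounds: "v z \<le> ennreal \<beta>" "u n z \<le> ennreal \<beta>" "w n z \<le> ennreal \<beta>" "k n z \<le> ennreal 1" for n z
    unfolding v_def u_def w_def k_def
    by (intro mean_path_le potential_le[OF a] admissible_one admissible_disc admissible_alive D_le; simp)+
  have le1: "v z + w n z \<le> u n z + (ennreal (e n) + ennreal \<beta> * k n z)" for n z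
  proof -
    have "v z + w n z = (\<integral>\<^sup>+\<omega>. ?D (path \<omega>) + ?w n \<omega> \<partial>P z)"
      unfolding v_def w_def by (rule nn_integral_add[symmetric]) measurable
    also have "\<dots> \<le> (\<integral>\<^sup>+\<omega>. ?u n \<omega> + (ennreal (e n) + ennreal \<beta> * ?k n \<omega>) \<partial>P z)"
      unfolding e_def by (intro nn_integral_mono potential_bounds(1)[OF R a rcont_path])
    also have "\<dots> = u n z + (\<integral>\<^sup>+\<omega>. ennreal (e n) + ennreal \<beta> * ?k n \<omega> \<partial>P z)"
      unfolding u_def by (rule nn_integral_add) measurable
    also have "(\<integral>\<^sup>+\<omega>. ennreal (e n) + ennreal \<beta> * ?k n \<omega> \<partial>P z)
        = (\<integral>\<^sup>+\<omega>. ennreal (e n) \<partial>P z) + (\<integral>\<^sup>+\<omega>. ennreal \<beta> * ?k n \<omega> \<partial>P z)"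
      by (rule nn_integral_add) measurable
    also have "(\<integral>\<^sup>+\<omega>. ennreal (e n) \<partial>P z) = ennreal (e n)"
      using prob_space.emeasure_space_1[OF prob, of z] by simp
    also have "(\<integral>\<^sup>+\<omega>. ennreal \<beta> * ?k n \<omega> \<partial>P z) = ennreal \<beta> * k n z"
      unfolding k_def by (rule nn_integral_cmult) measurable
    finally show ?thesis .
  qed
  have le2: "u n z \<le> v z + w n z + ennreal (e n)" for n z
  proof -
    have "u n z \<le> (\<integral>\<^sup>+\<omega>. (?D (path \<omega>) + ?w n \<omega>) + ennreal (e n) \<partial>P z)"
      unfolding u_def e_def by (intro nn_integral_mono potential_bounds(2)[OF R a rcont_path])
    also have "\<dots> = (\<integral>\<^sup>+\<omega>. ?D (path \<omega>) + ?w n \<omega> \<partial>P z) + (\<integral>\<^sup>+\<omega>. ennreal (e n) \<partial>P z)"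
      by (rule nn_integral_add) measurable
    also have "(\<integral>\<^sup>+\<omega>. ?D (path \<omega>) + ?w n \<omega> \<partial>P z) = v z + w n z"
      unfolding v_def w_def by (rule nn_integral_add) measurable
    also have "(\<integral>\<^sup>+\<omega>. ennreal (e n) \<partial>P z) = ennreal (e n)"
      using prob_space.emeasure_space_1[OF prob, of z] by simp
    finally show ?thesis .
  qed
  define v' u' w' k' where "v' z = enn2real (v z)" and "u' n z = enn2real (u n z)"
    and "w' n z = enn2real (w n z)" and "k' n z = enn2real (k n z)" for n z
  have fin: "v z < \<top>" "u n z < \<top>" "w n z < \<top>" "k n z < \<top>" for n z
    by (rule le_less_trans[OF bounds(1)] le_less_trans[OF bounds(2)] le_less_trans[OF bounds(3)] le_less_trans[OF bounds(4)]; simp)+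
  have real: "v z = ennreal (v' z)" "u n z = ennreal (u' n z)" "w n z = ennreal (w' n z)" "k n z = ennreal (k' n z)"
    and nonneg: "0 \<le> v' z" "0 \<le> u' n z" "0 \<le> w' n z" "0 \<le> k' n z" for n z
    using fin by (simp_all add: v'_def u'_def w'_def k'_def)
  \<comment> \<open>The bound is needed at every state the path may visit. The arrival error
    \<open>e n\<close> is uniform; the ruin error is not, but it is excessive as well and so stays
    close to its starting value for small times.\<close>
  have approx: "\<bar>v' z - (u' n z - w' n z)\<bar> \<le> e n + \<beta> * k' n z" for n z
  proof -
    have "ennreal (v' z + w' n z) \<le> ennreal (u' n z + (e n + \<beta> * k' n z))"
      using le1[of z n] e0[of n] nonneg(1)[of z] nonneg(2-4)[of n z] beta by (simp add: real ennreal_mult)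
    moreover have "ennreal (u' n z) \<le> ennreal (v' z + w' n z + e n)"
      using le2[of n z] e0[of n] nonneg(1)[of z] nonneg(2-4)[of n z] by (simp add: real)
    moreover have "0 \<le> \<beta> * k' n z" using beta nonneg by simp
    ultimately show ?thesis using e0[of n] nonneg(1)[of z] nonneg(2-4)[of n z] by (simp add: ennreal_le_iff del: ennreal_plus)
  qed
  have e_lim: "e \<longlonglongrightarrow> 0"
  proof -
    have "(\<lambda>n. \<beta> * r * (1 / real (Suc n))) \<longlonglongrightarrow> \<beta> * r * 0"
      by (intro tendsto_mult_left lim_1_over_n[THEN LIMSEQ_Suc])
    then have up: "(\<lambda>n. \<beta> * r * (1 / real (Suc n))) \<longlonglongrightarrow> 0" by simp
    have "e n \<le> \<beta> * r * (1 / real (Suc n))" for n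
      using beta r_pos by (simp add: e_def a_def frac_le del: of_nat_Suc)
    then show ?thesis
      by (intro tendsto_sandwich[OF always_eventually always_eventually tendsto_const up]) (use e0 in auto)
  qed
  have k_lim: "(\<lambda>n. k' n (0, y)) \<longlonglongrightarrow> 0"
    using early_ruin_vanishes[OF tau_transl_pos[OF c, of y]]
    unfolding k'_def k_def a_def by (intro tendsto_enn2real) (simp_all)
  have ex: "excessive P Z (a n) (u n)" "excessive P Z (a n) (w n)" "excessive P Z (a n) (k n)" for n
    unfolding u_def[abs_def] w_def[abs_def] k_def[abs_def]
    by (rule excessive_potential[OF a admissible_one Dm D_le] excessive_potential[OF a admissible_disc Dm D_le]
        excessive_potential[OF a admissible_alive one_m, of 1]; simp)+
  have "AE \<omega> in P (0, y). \<forall>n. ((\<lambda>s. u n (Z s \<omega>)) \<longlongrightarrow> u n (0, y)) (at_right 0) \<and>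
      ((\<lambda>s. w n (Z s \<omega>)) \<longlongrightarrow> w n (0, y)) (at_right 0) \<and> ((\<lambda>s. k n (Z s \<omega>)) \<longlongrightarrow> k n (0, y)) (at_right 0)"
    unfolding AE_all_countable
    using excessive_right_limit[OF a ex(1), where z="(0, y)"] excessive_right_limit[OF a ex(2), where z="(0, y)"]
      excessive_right_limit[OF a ex(3), where z="(0, y)"] by auto
  then show ?thesis
  proof eventually_elim
    fix \<omega> assume *: "\<forall>n. ((\<lambda>s. u n (Z s \<omega>)) \<longlongrightarrow> u n (0, y)) (at_right 0) \<and>
      ((\<lambda>s. w n (Z s \<omega>)) \<longlongrightarrow> w n (0, y)) (at_right 0) \<and> ((\<lambda>s. k n (Z s \<omega>)) \<longlongrightarrow> k n (0, y)) (at_right 0)"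
    have lim: "((\<lambda>s. u' n (Z s \<omega>)) \<longlongrightarrow> u' n (0, y)) (at_right 0)"
      "((\<lambda>s. w' n (Z s \<omega>)) \<longlongrightarrow> w' n (0, y)) (at_right 0)"
      "((\<lambda>s. \<beta> * k' n (Z s \<omega>)) \<longlongrightarrow> \<beta> * k' n (0, y)) (at_right 0)" for n
    proof -
      have "((\<lambda>s. u n (Z s \<omega>)) \<longlongrightarrow> ennreal (u' n (0, y))) (at_right 0)"
        "((\<lambda>s. w n (Z s \<omega>)) \<longlongrightarrow> ennreal (w' n (0, y))) (at_right 0)"
        "((\<lambda>s. k n (Z s \<omega>)) \<longlongrightarrow> ennreal (k' n (0, y))) (at_right 0)"
        unfolding real(2-4)[symmetric] using * by blast+
      from this(1,2)[THEN tendsto_enn2real] tendsto_mult_left[OF this(3)[THEN tendsto_enn2real], of \<beta>] nonneg(2-4)[of n "(0, y)"]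
      show "((\<lambda>s. u' n (Z s \<omega>)) \<longlongrightarrow> u' n (0, y)) (at_right 0)"
        "((\<lambda>s. w' n (Z s \<omega>)) \<longlongrightarrow> w' n (0, y)) (at_right 0)"
        "((\<lambda>s. \<beta> * k' n (Z s \<omega>)) \<longlongrightarrow> \<beta> * k' n (0, y)) (at_right 0)"
        unfolding u'_def w'_def k'_def by blast+
    qed
    have "((\<lambda>s. v' (Z s \<omega>)) \<longlongrightarrow> v' (0, y)) (at_right 0)"
    proof (rule tendstoI)
      fix d :: real assume d: "0 < d"
      have "(\<lambda>n. \<beta> * k' n (0, y)) \<longlonglongrightarrow> \<beta> * 0" by (intro tendsto_mult_left k_lim)
      then have "\<forall>\<^sub>F n in sequentially. \<beta> * k' n (0, y) < d / 8" using d by (intro order_tendstoD(2)) auto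
      moreover have "\<forall>\<^sub>F n in sequentially. e n < d / 8" using e_lim d by (intro order_tendstoD(2)) auto
      ultimately obtain n where n: "\<beta> * k' n (0, y) < d / 8" "e n < d / 8"
        using eventually_happens'[OF sequentially_bot eventually_conj] by blast
      \<comment> \<open>Seven eighths are spent: two on the increments of \<open>u'\<close> and
        \<open>w'\<close>, three on the error at \<open>Z s \<omega>\<close> (arrivals, initial ruin
        error, its change), and two on the error at the start.\<close>
      have d8: "0 < d / 8" using d by simp
      show "\<forall>\<^sub>F s in at_right 0. dist (v' (Z s \<omega>)) (v' (0, y)) < d"
        using tendstoD[OF lim(1) d8, of n] tendstoD[OF lim(2) d8, of n] tendstoD[OF lim(3) d8, of n]
      proof eventually_elim
        fix s assume "dist (u' n (Z s \<omega>)) (u' n (0, y)) < d / 8" "dist (w' n (Z s \<omega>)) (w' n (0, y)) < d / 8"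
          "dist (\<beta> * k' n (Z s \<omega>)) (\<beta> * k' n (0, y)) < d / 8"
        then show "dist (v' (Z s \<omega>)) (v' (0, y)) < d"
          using approx[of "Z s \<omega>" n] approx[of "(0, y)" n] n unfolding dist_real_def by linarith
      qed
    qed
    then have "((\<lambda>s. v (Z s \<omega>)) \<longlongrightarrow> v (0, y)) (at_right 0)" unfolding real by (rule tendsto_ennrealI)
    moreover have "v z = V True R (c + fst z, snd z)" for z
      unfolding v_def V_def mean_at_def
      using translation[OF mean_payoff_umeas[OF R, of True], where c=c and x="fst z" and y="snd z"] by simp
    ultimately show "((\<lambda>s. V True R (c + fst (Z s \<omega>), snd (Z s \<omega>))) \<longlongrightarrow> V True R (c, y)) (at_right 0)" by simp
  qed
qed

end

section \<open>Barriers\<close>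


lemma embeds_homeomorphism:
  fixes h :: "'e::topological_space \<Rightarrow> 'k::metric_space"
  assumes "homeomorphism UNIV A h g"
  shows "embeds h" "inj h"
proof -
  have gh: "g (h x) = x" for x using assms by (simp add: homeomorphism_def)
  then show "inj h" by (metis injI)
  show "embeds h" unfolding embeds_def
  proof (intro conjI allI impI)
    show "continuous_on UNIV h" using assms by (simp add: homeomorphism_def)
    fix U :: "'e set" assume "open U"
    then have "openin (top_of_set A) (h ` U)"
      using homeomorphism_imp_open_map[OF assms, of U] by simp
    then obtain T where "open T" "h ` U = A \<inter> T" by (auto simp: openin_open)
    moreover have "h x \<in> A" for x using assms by (auto simp: homeomorphism_def)
    ultimately have "x \<in> U \<longleftrightarrow> h x \<in> T" for x
      using inj_image_mem_iff[OF \<open>inj h\<close>, of x U] by simp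
    then have "U = h -` T" by blast
    then show "\<exists>T. open T \<and> U = h -` T" using \<open>open T\<close> by blast
  qed
qed

text \<open>Allows a barrier to be changed at one state without losing measurability.\<close>

lemma singleton_borel_embeds:
  fixes h :: "'e::topological_space \<Rightarrow> 'k::metric_space"
  assumes "embeds h" "inj h"
  shows "{y :: 'e} \<in> sets borel"
proof -
  have "closed (h -` {h y})"
    using assms(1) by (intro closed_vimage) (auto simp: embeds_def)
  moreover have "h -` {h y} = {y}" using assms(2) by (auto dest: injD)
  ultimately show ?thesis by simp
qed

lemma hit_time_pos:
  assumes "\<forall>\<^sub>F t in at_right 0. Y t \<omega> \<notin> A"
  shows "0 < hit_time Y A \<omega>"
proof -
  obtain d where d: "0 < d" "\<And>t. 0 < t \<Longrightarrow> t < d \<Longrightarrow> Y t \<omega> \<notin> A"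
    using assms by (auto simp: eventually_at_right_field)
  have "ennreal d \<le> hit_time Y A \<omega>"
    unfolding hit_time_def using d by (intro Inf_greatest) (force intro!: ennreal_leI simp: not_less[symmetric])
  moreover have "0 < ennreal d" using d(1) by simp
  ultimately show ?thesis by (rule less_le_trans[rotated])
qed

context additive_model
begin

lemma rho_eq_V:
  assumes b: "b \<in> borel_measurable borel"
  shows "rho1 P (exp_dist r) (\<lambda>t \<omega>. fst (Z t \<omega>)) (\<lambda>t \<omega>. snd (Z t \<omega>)) qq \<beta> b y = V True (reg True b) (b y, y)"
    and "rho2 P (exp_dist r) (\<lambda>t \<omega>. fst (Z t \<omega>)) (\<lambda>t \<omega>. snd (Z t \<omega>)) qq \<beta> b y = V False (reg False b) (b y, y)"
proof -
  interpret S: prob_space S by (rule prob_S)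
  define z where "z = (b y, y)"
  define stop where "stop k \<omega> rs = (if (if k then first_arr (reg k b) (\<lambda>t. Z t \<omega>) rs \<le> tau k (\<lambda>t. Z t \<omega>)
        else first_arr (reg k b) (\<lambda>t. Z t \<omega>) rs < tau k (\<lambda>t. Z t \<omega>))
      then exp_neg (qi (\<lambda>t. Z t \<omega>) (first_arr (reg k b) (\<lambda>t. Z t \<omega>) rs)) else 0)" for k \<omega> rs
  define ruin where "ruin k \<omega> rs = (if tau k (\<lambda>t. Z t \<omega>) < first_arr (reg k b) (\<lambda>t. Z t \<omega>) rs
      then exp_neg (qi (\<lambda>t. Z t \<omega>) (tau k (\<lambda>t. Z t \<omega>))) else 0)" for k \<omega> rs
  have proc: "proc (P z) Z" using Z_measurable rcont_path by (auto simp: path_def)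
  have tau_meas: "(\<lambda>\<omega>. tau k (\<lambda>t. Z t \<omega>)) \<in> borel_measurable (P z)" for k
    using path_umeas[OF tau_path_umeas] by (simp add: path_def)
  have sets: "sets (P z \<Otimes>\<^sub>M S) = sets (P z \<Otimes>\<^sub>M stream_space borel)"
    by (rule sets_pair_measure_cong[OF refl sets_S])
  have [measurable]: "(\<lambda>(\<omega>, rs). stop k \<omega> rs) \<in> borel_measurable (P z \<Otimes>\<^sub>M S)"
    "(\<lambda>(\<omega>, rs). ruin k \<omega> rs) \<in> borel_measurable (P z \<Otimes>\<^sub>M S)" for k
    unfolding measurable_cong_sets[OF sets refl] stop_def ruin_def
    by (rule payoff_parts_measurable[OF proc reg_borel[OF b] tau_meas])+
  have "V k (reg k b) z = (\<integral>\<^sup>+ (\<omega>, rs). payoff k (reg k b) (path \<omega>) rs \<partial>(P z \<Otimes>\<^sub>M S))" for k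
    unfolding V_def mean_payoff_def
    using S.nn_integral_fst[OF payoff_P_measurable[OF reg_borel[OF b]]] by (simp add: split_beta')
  also have "(\<integral>\<^sup>+ (\<omega>, rs). payoff k (reg k b) (path \<omega>) rs \<partial>(P z \<Otimes>\<^sub>M S))
      = (\<integral>\<^sup>+ x. (\<lambda>(\<omega>, rs). stop k \<omega> rs) x + ennreal \<beta> * (\<lambda>(\<omega>, rs). ruin k \<omega> rs) x \<partial>(P z \<Otimes>\<^sub>M S))" for k
    by (intro nn_integral_cong) (simp add: payoff_def stop_def ruin_def path_def split_beta')
  also have "\<dots> k = (\<integral>\<^sup>+ (\<omega>, rs). stop k \<omega> rs \<partial>(P z \<Otimes>\<^sub>M S)) + (\<integral>\<^sup>+ x. ennreal \<beta> * (\<lambda>(\<omega>, rs). ruin k \<omega> rs) x \<partial>(P z \<Otimes>\<^sub>M S))" for k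
    by (rule nn_integral_add) measurable
  also have "(\<integral>\<^sup>+ x. ennreal \<beta> * (\<lambda>(\<omega>, rs). ruin k \<omega> rs) x \<partial>(P z \<Otimes>\<^sub>M S))
      = ennreal \<beta> * (\<integral>\<^sup>+ (\<omega>, rs). ruin k \<omega> rs \<partial>(P z \<Otimes>\<^sub>M S))" for k
    by (rule nn_integral_cmult) measurable
  finally have V: "V k (reg k b) z = (\<integral>\<^sup>+ (\<omega>, rs). stop k \<omega> rs \<partial>(P z \<Otimes>\<^sub>M S))
      + ennreal \<beta> * (\<integral>\<^sup>+ (\<omega>, rs). ruin k \<omega> rs \<partial>(P z \<Otimes>\<^sub>M S))" for k .
  have T: "T_plus_minus (\<lambda>t \<omega>. fst (Z t \<omega>)) (\<lambda>t \<omega>. snd (Z t \<omega>)) b \<omega> rs = first_arr (reg True b) (\<lambda>t. Z t \<omega>) rs"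
    "T_plus (\<lambda>t \<omega>. fst (Z t \<omega>)) (\<lambda>t \<omega>. snd (Z t \<omega>)) b \<omega> rs = first_arr (reg False b) (\<lambda>t. Z t \<omega>) rs" for \<omega> rs
    by (simp_all add: T_plus_minus_def T_plus_def first_arr_def reg_def)
  have tau: "tau_minus (\<lambda>t \<omega>. fst (Z t \<omega>)) \<omega> = tau True (\<lambda>t. Z t \<omega>)"
    "tau_minus_plus (\<lambda>t \<omega>. fst (Z t \<omega>)) \<omega> = tau False (\<lambda>t. Z t \<omega>)" for \<omega>
    by (simp_all add: tau_def tau_minus_def tau_minus_plus_def)
  have qi: "qint qq (\<lambda>t \<omega>. snd (Z t \<omega>)) \<omega> s = qi (\<lambda>t. Z t \<omega>) s" for \<omega> s
    by (simp add: qi_def qint_def)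
  show "rho1 P (exp_dist r) (\<lambda>t \<omega>. fst (Z t \<omega>)) (\<lambda>t \<omega>. snd (Z t \<omega>)) qq \<beta> b y = V True (reg True b) (b y, y)"
    unfolding V[unfolded z_def] rho1_def stop_def[abs_def] ruin_def[abs_def] T tau qi by simp
  show "rho2 P (exp_dist r) (\<lambda>t \<omega>. fst (Z t \<omega>)) (\<lambda>t \<omega>. snd (Z t \<omega>)) qq \<beta> b y = V False (reg False b) (b y, y)"
    unfolding V[unfolded z_def] rho2_def stop_def[abs_def] ruin_def[abs_def] T tau qi by simp
qed

text \<open>The sign condition of \<open>Xi\<close> is kept apart, so that a modified barrier can be
  tested through its values alone.\<close>

definition barrier :: "('e \<Rightarrow> real) \<Rightarrow> bool" where
  "barrier b \<longleftrightarrow> b \<in> borel_measurable borel \<and>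
     (\<forall>y. V True (reg True b) (b y, y) \<le> 1 \<and> 1 \<le> V False (reg False b) (b y, y))"

lemma Xi_iff_barrier:
  "b \<in> Xi P (exp_dist r) (\<lambda>t \<omega>. fst (Z t \<omega>)) (\<lambda>t \<omega>. snd (Z t \<omega>)) qq \<beta> \<longleftrightarrow> barrier b \<and> (\<forall>y. 0 \<le> b y)"
  unfolding Xi_def barrier_def by (auto simp: rho_eq_V)

lemma barrier_antimono:
  "barrier b \<Longrightarrow> x < x' \<Longrightarrow> V k (reg k b) (x', y) \<le> V l (reg l b) (x, y)"
  unfolding barrier_def by (intro V_antimono) auto

lemma V_ge_1_below: "barrier b \<Longrightarrow> x < b y \<Longrightarrow> 1 \<le> V k (reg k b) (x, y)"
  using barrier_antimono[of b x "b y" False y k] by (auto simp: barrier_def intro: order_trans)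

lemma V_le_1_above: "barrier b \<Longrightarrow> b y < x \<Longrightarrow> V k (reg k b) (x, y) \<le> 1"
  using barrier_antimono[of b "b y" x k y True] by (auto simp: barrier_def intro: order_trans)

text \<open>The regions differ only at the state \<open>y0\<close>, on levels where the value is 1,
  so no value changes anywhere. The two conditions then have to be checked afresh only at the new
  level.\<close>

lemma barrier_fun_upd:
  assumes b: "barrier b" and single: "{y0} \<in> sets borel"
    and one: "\<And>k x. ((x, y0) \<in> reg k b) \<noteq> ((x, y0) \<in> reg k (b(y0 := x0))) \<Longrightarrow> V k (reg k b) (x, y0) = 1"
    and x0: "V True (reg True b) (x0, y0) \<le> 1" "1 \<le> V False (reg False b) (x0, y0)"
  shows "barrier (b(y0 := x0))"
proof -
  have bm [measurable]: "b \<in> borel_measurable borel" using b by (simp add: barrier_def)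
  have "(\<lambda>y. if y \<in> {y0} then x0 else b y) \<in> borel_measurable borel"
    by (rule measurable_If_set) (use single in auto)
  then have bm': "b(y0 := x0) \<in> borel_measurable borel" by (simp add: fun_upd_def)
  have "V k (reg k (b(y0 := x0))) z = V k (reg k b) z" for k z
  proof (rule V_perturb[OF reg_borel[OF bm] reg_borel[OF bm']])
    fix z :: "real \<times> 'e" assume ne: "(z \<in> reg k b) \<noteq> (z \<in> reg k (b(y0 := x0)))"
    then have "snd z = y0" by (auto simp: reg_def split: if_splits)
    then have "z = (fst z, y0)" by (metis prod.collapse)
    then show "V k (reg k b) z = 1" using one[of "fst z" k] ne by metis
  qed
  then show ?thesis using b x0 bm' by (auto simp: barrier_def)
qed

text \<open>If the value at \<open>x0\<close> were at most 1, monotonicity would pin it to 1 on the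
  levels gained by the region when the barrier is lowered to \<open>x0\<close> at \<open>y0\<close>.
  The lowered function would be a barrier, against minimality.\<close>

lemma V_gt_1_below_least:
  assumes b: "barrier b" and least: "\<And>b'. barrier b' \<Longrightarrow> (\<And>y. 0 \<le> b' y) \<Longrightarrow> (\<And>y. b y \<le> b' y)"
    and nonneg: "\<And>y. 0 \<le> b y" and single: "{y0} \<in> sets borel" and x0: "0 \<le> x0" "x0 < b y0"
  shows "1 < V True (reg True b) (x0, y0)"
proof (rule ccontr)
  assume "\<not> 1 < V True (reg True b) (x0, y0)"
  then have le: "V True (reg True b) (x0, y0) \<le> 1" by simp
  have "barrier (b(y0 := x0))"
  proof (rule barrier_fun_upd[OF b single _ le V_ge_1_below[of b x0 y0, OF b x0(2)]])
    fix k x assume ne: "((x, y0) \<in> reg k b) \<noteq> ((x, y0) \<in> reg k (b(y0 := x0)))"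
    show "V k (reg k b) (x, y0) = 1"
    proof (rule antisym)
      have "x0 < x \<or> k \<and> x = x0" using ne x0 by (auto simp: reg_def split: if_splits)
      then show "V k (reg k b) (x, y0) \<le> 1"
        using barrier_antimono[OF b, of x0 x k y0 True] le by (auto intro: order_trans)
      have "x < b y0 \<or> \<not> k \<and> x = b y0" using ne x0 by (auto simp: reg_def split: if_splits)
      then show "1 \<le> V k (reg k b) (x, y0)"
        using V_ge_1_below[OF b, of x y0 k] b by (auto simp: barrier_def)
    qed
  qed
  then have "b y0 \<le> (b(y0 := x0)) y0" by (rule least) (use x0 nonneg in auto)
  then show False using x0 by simp
qed

text \<open>The mirror argument raises the barrier, but to a level \<open>x0\<close> strictly below
  \<open>x1\<close>: the lower bound at a barrier is stated with flag \<open>False\<close>, and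
  passing to it from flag \<open>True\<close> costs a strict step in the level.\<close>

lemma V_lt_1_above_greatest:
  assumes b: "barrier b" and greatest: "\<And>b'. barrier b' \<Longrightarrow> (\<And>y. 0 \<le> b' y) \<Longrightarrow> (\<And>y. b' y \<le> b y)"
    and nonneg: "\<And>y. 0 \<le> b y" and single: "{y0} \<in> sets borel" and x1: "b y0 < x1"
  shows "V True (reg True b) (x1, y0) < 1"
proof (rule ccontr)
  assume "\<not> V True (reg True b) (x1, y0) < 1"
  moreover obtain x0 where x0: "b y0 < x0" "x0 < x1" using dense[OF x1] by auto
  ultimately have ge: "1 \<le> V False (reg False b) (x0, y0)"
    using barrier_antimono[OF b x0(2), of True y0 False] by (auto intro: order_trans)
  have "barrier (b(y0 := x0))"
  proof (rule barrier_fun_upd[OF b single _ V_le_1_above[OF b x0(1)] ge])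
    fix k x assume ne: "((x, y0) \<in> reg k b) \<noteq> ((x, y0) \<in> reg k (b(y0 := x0)))"
    show "V k (reg k b) (x, y0) = 1"
    proof (rule antisym)
      have "b y0 < x \<or> k \<and> x = b y0" using ne x0 by (auto simp: reg_def split: if_splits)
      then show "V k (reg k b) (x, y0) \<le> 1"
        using V_le_1_above[OF b, of y0 x k] b by (auto simp: barrier_def)
      have "x < x0 \<or> \<not> k \<and> x = x0" using ne x0 by (auto simp: reg_def split: if_splits)
      then show "1 \<le> V k (reg k b) (x, y0)"
        using barrier_antimono[OF b, of x x0 False y0 k] ge by (auto intro: order_trans)
    qed
  qed
  moreover have "0 \<le> x0" using nonneg[of y0] x0 by linarith
  ultimately have "(b(y0 := x0)) y0 \<le> b y0" using greatest[of "b(y0 := x0)" y0] nonneg by auto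
  then show False using x0 by simp
qed

section \<open>From right limits to fine semicontinuity\<close>

lemma fst_path_limit: "AE \<omega> in P (0, y). ((\<lambda>s. fst (Z s \<omega>)) \<longlongrightarrow> 0) (at_right 0)"
  using start[of "(0, y)"]
proof eventually_elim
  fix \<omega> assume "Z 0 \<omega> = (0, y)"
  then show "((\<lambda>s. fst (Z s \<omega>)) \<longlongrightarrow> 0) (at_right 0)"
    using rcont_fst[OF rcont_path order_refl, of \<omega>] by (simp add: path_def)
qed

text \<open>Choose \<open>c\<close> between \<open>a\<close> and \<open>b y\<close>, so the value at
  \<open>(c, y)\<close> exceeds 1. For small \<open>s\<close> it still exceeds 1 at the raised
  state, which therefore is not above the barrier; as \<open>fst (Z s \<omega>)\<close> exceeds
  \<open>a - c\<close>, the barrier there exceeds \<open>a\<close>. Negative \<open>a\<close> is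
  treated apart, because the right limit is available for positive \<open>c\<close> only.\<close>

lemma least_barrier_finely_lsc:
  assumes b: "barrier b" and least: "\<And>b'. barrier b' \<Longrightarrow> (\<And>y. 0 \<le> b' y) \<Longrightarrow> (\<And>y. b y \<le> b' y)"
    and nonneg: "\<And>y. 0 \<le> b y" and single: "\<And>y::'e. {y} \<in> sets borel"
  shows "finely_lsc (\<lambda>t \<omega>. snd (Z t \<omega>)) (\<lambda>y. P (0, y)) b"
  unfolding finely_lsc_def finely_open_def
proof (intro allI ballI)
  fix a y assume "y \<in> {y. b y > a}"
  then have ay: "a < b y" by simp
  let ?v = "V True (reg True b)"
  show "AE \<omega> in P (0, y). 0 < hit_time (\<lambda>t \<omega>. snd (Z t \<omega>)) (UNIV - {y. b y > a}) \<omega>"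
  proof (cases "0 \<le> a")
    case False
    have "a < b y" for y using False nonneg[of y] by linarith
    then have empty: "UNIV - {y. b y > a} = {}" by auto
    show ?thesis unfolding empty hit_time_def by simp
  next
    case True
    obtain c where c: "a < c" "c < b y" using dense[OF ay] by auto
    have "1 < ?v (c, y)" by (rule V_gt_1_below_least[OF b]) (use least nonneg single c True in auto)
    have "0 < c" using True c by linarith
    have R: "reg True b \<in> sets borel" using b by (intro reg_borel) (simp add: barrier_def)
    show ?thesis using V_right_limit[OF R \<open>0 < c\<close>, of y] fst_path_limit[of y]
    proof eventually_elim
      fix \<omega> assume lim: "((\<lambda>s. ?v (c + fst (Z s \<omega>), snd (Z s \<omega>))) \<longlongrightarrow> ?v (c, y)) (at_right 0)"
        "((\<lambda>s. fst (Z s \<omega>)) \<longlongrightarrow> 0) (at_right 0)"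
      show "0 < hit_time (\<lambda>t \<omega>. snd (Z t \<omega>)) (UNIV - {y. b y > a}) \<omega>"
      proof (rule hit_time_pos)
        have "a - c < 0" using c by simp
        show "\<forall>\<^sub>F s in at_right 0. snd (Z s \<omega>) \<notin> UNIV - {y. b y > a}"
          using order_tendstoD(1)[OF lim(1) \<open>1 < ?v (c, y)\<close>] order_tendstoD(1)[OF lim(2) \<open>a - c < 0\<close>]
        proof eventually_elim
          fix s assume "1 < ?v (c + fst (Z s \<omega>), snd (Z s \<omega>))" and "a - c < fst (Z s \<omega>)"
          then have "b (snd (Z s \<omega>)) \<ge> c + fst (Z s \<omega>)"
            using V_le_1_above[OF b, of "snd (Z s \<omega>)" "c + fst (Z s \<omega>)" True] by (meson not_le)
          then show "snd (Z s \<omega>) \<notin> UNIV - {y. b y > a}" using \<open>a - c < fst (Z s \<omega>)\<close> by auto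
        qed
      qed
    qed
  qed
qed

text \<open>Here \<open>c\<close> lies above the barrier at \<open>y\<close> and below
  \<open>a\<close>; a value below 1 along the path keeps the raised state from falling below the
  barrier. Nonnegativity of \<open>b\<close> already forces \<open>c\<close> to be positive.\<close>

lemma greatest_barrier_finely_usc:
  assumes b: "barrier b" and greatest: "\<And>b'. barrier b' \<Longrightarrow> (\<And>y. 0 \<le> b' y) \<Longrightarrow> (\<And>y. b' y \<le> b y)"
    and nonneg: "\<And>y. 0 \<le> b y" and single: "\<And>y::'e. {y} \<in> sets borel"
  shows "finely_usc (\<lambda>t \<omega>. snd (Z t \<omega>)) (\<lambda>y. P (0, y)) b"
  unfolding finely_usc_def finely_open_def
proof (intro allI ballI)
  fix a y assume "y \<in> {y. b y < a}"
  then obtain c where c: "b y < c" "c < a" using dense by blast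
  let ?v = "V True (reg True b)"
  have "?v (c, y) < 1" by (rule V_lt_1_above_greatest[OF b]) (use greatest nonneg single c in auto)
  have "0 < c" using nonneg[of y] c by linarith
  have R: "reg True b \<in> sets borel" using b by (intro reg_borel) (simp add: barrier_def)
  show "AE \<omega> in P (0, y). 0 < hit_time (\<lambda>t \<omega>. snd (Z t \<omega>)) (UNIV - {y. b y < a}) \<omega>"
    using V_right_limit[OF R \<open>0 < c\<close>, of y] fst_path_limit[of y]
  proof eventually_elim
    fix \<omega> assume lim: "((\<lambda>s. ?v (c + fst (Z s \<omega>), snd (Z s \<omega>))) \<longlongrightarrow> ?v (c, y)) (at_right 0)"
      "((\<lambda>s. fst (Z s \<omega>)) \<longlongrightarrow> 0) (at_right 0)"
    show "0 < hit_time (\<lambda>t \<omega>. snd (Z t \<omega>)) (UNIV - {y. b y < a}) \<omega>"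
    proof (rule hit_time_pos)
      have "0 < a - c" using c by simp
      show "\<forall>\<^sub>F s in at_right 0. snd (Z s \<omega>) \<notin> UNIV - {y. b y < a}"
        using order_tendstoD(2)[OF lim(1) \<open>?v (c, y) < 1\<close>] order_tendstoD(2)[OF lim(2) \<open>0 < a - c\<close>]
      proof eventually_elim
        fix s assume "?v (c + fst (Z s \<omega>), snd (Z s \<omega>)) < 1" and "fst (Z s \<omega>) < a - c"
        then have "b (snd (Z s \<omega>)) \<le> c + fst (Z s \<omega>)"
          using V_ge_1_below[OF b, of "c + fst (Z s \<omega>)" "snd (Z s \<omega>)" True] by (meson not_le)
        then show "snd (Z s \<omega>) \<notin> UNIV - {y. b y < a}" using \<open>fst (Z s \<omega>) < a - c\<close> by auto
      qed
    qed
  qed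
qed

end

theorem theorem3p5:
  fixes h :: "'e::topological_space \<Rightarrow> 'k::metric_space"
    and F :: "'w set set" and Ft :: "real \<Rightarrow> 'w set set"
    and X :: "real \<Rightarrow> 'w \<Rightarrow> real" and Y :: "real \<Rightarrow> 'w \<Rightarrow> 'e"
    and \<theta> :: "real \<Rightarrow> 'w \<Rightarrow> 'w" and P :: "real \<times> 'e \<Rightarrow> 'w measure"
    and q \<beta> r :: real and qq :: "'e \<Rightarrow> real"
    and b_low b_up :: "'e \<Rightarrow> real"
  assumes radon: "radon_embedding h"
    and rp: "right_process F Ft (\<lambda>t \<omega>. (X t \<omega>, Y t \<omega>)) \<theta> P"
    and rpY: "right_process F Ft Y \<theta> (\<lambda>y. P (0, y))"
    and cadlag: "\<forall>\<omega>. \<forall>t>0. \<exists>l. ((\<lambda>s. X s \<omega>) \<longlongrightarrow> l) (at_left t)"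
    and homog: "\<forall>(f :: real \<times> 'e \<Rightarrow> ennreal) t x y. f \<in> borel_measurable borel \<longrightarrow> t \<ge> 0 \<longrightarrow>
        (\<integral>\<^sup>+ \<omega>. f (X t \<omega>, Y t \<omega>) \<partial>P (x, y)) = (\<integral>\<^sup>+ \<omega>. f (X t \<omega> + x, Y t \<omega>) \<partial>P (0, y))"
    and moment: "\<exists>C::real. \<forall>y. (\<integral>\<^sup>+ \<omega>. (SUP s\<in>{0..1}. ennreal \<bar>X s \<omega>\<bar>) \<partial>P (0, y)) \<le> ennreal C"
    and q_pos: "q > 0"
    and qq_meas: "qq \<in> borel_measurable borel"
    and qq_gt: "\<forall>y. qq y > q"
    and beta: "\<beta> > 1"
    and r_pos: "r > 0"
    and low_in: "b_low \<in> Xi P (exp_dist r) X Y qq \<beta>"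
    and up_in: "b_up \<in> Xi P (exp_dist r) X Y qq \<beta>"
    and Xi_char: "\<forall>b :: 'e \<Rightarrow> real. b \<in> borel_measurable borel \<longrightarrow> (\<forall>y. b y \<ge> 0) \<longrightarrow>
        (b \<in> Xi P (exp_dist r) X Y qq \<beta> \<longleftrightarrow> (\<forall>y. b_low y \<le> b y \<and> b y \<le> b_up y))"
  shows "finely_lsc Y (\<lambda>y. P (0, y)) b_low \<and> finely_usc Y (\<lambda>y. P (0, y)) b_up"
proof -
  obtain A g where hom: "homeomorphism (UNIV :: 'e set) A h g" using radon by (auto simp: radon_embedding_def)
  note h = embeds_homeomorphism[OF hom]
  note single = singleton_borel_embeds[OF h]
  define Z where "Z t \<omega> = (X t \<omega>, Y t \<omega>)" for t \<omega>
  interpret additive_model h qq q \<beta> r F Ft Z \<theta> P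
  proof
    show "right_process F Ft Z \<theta> P" using rp by (simp add: Z_def[abs_def])
    fix f :: "real \<times> 'e \<Rightarrow> ennreal" and t x :: real and y :: 'e
    assume "f \<in> borel_measurable borel" "0 \<le> t"
    then show "(\<integral>\<^sup>+ \<omega>. f (Z t \<omega>) \<partial>P (x, y)) = (\<integral>\<^sup>+ \<omega>. f (x + fst (Z t \<omega>), snd (Z t \<omega>)) \<partial>P (0, y))"
      using homog by (simp add: Z_def add.commute)
  qed (use h qq_meas q_pos qq_gt beta r_pos in auto)
  have XY: "(\<lambda>t \<omega>. fst (Z t \<omega>)) = X" "(\<lambda>t \<omega>. snd (Z t \<omega>)) = Y" by (simp_all add: Z_def)
  note Xi = Xi_iff_barrier[unfolded XY]
  have char: "b_low y \<le> b y" "b y \<le> b_up y" if "barrier b" "\<And>y. 0 \<le> b y" for b y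
    using Xi_char Xi[of b] that by (auto simp: barrier_def)
  have "barrier b_low" "barrier b_up" and nonneg: "\<And>y. 0 \<le> b_low y" "\<And>y. 0 \<le> b_up y"
    using low_in up_in Xi by auto
  then show ?thesis
    using least_barrier_finely_lsc[of b_low, unfolded XY] greatest_barrier_finely_usc[of b_up, unfolded XY] char single
    by blast
qed

end
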